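(* Let $m\ge 4$ be an integer, $0<\epsilon\le 1$, $\Omega=(a,b)$, $T_{\rm end}>0$, and let $\Phi$ be the exact solution of the one-dimensional semiclassical Dirac equation with periodic boundary conditions (written out in the context). Assume: (A) $\Phi\in C^2([0,T_{\rm end}];W^{m,\infty}_p(\Omega))$ and $V,A_1\in C^m(\Omega)$, with $V,A_1$ periodic on $\Omega$; (B) for all $0\le r\le 2$ and $0\le k\le m$, $$\Big\|\frac{\partial^{r+k}}{\partial t^r\partial x^k}\Phi\Big\|_{L^\infty([0,T_{\rm end}];(L^\infty(\Omega))^2)}\le \frac{C_{r+k}}{\epsilon^{r+k}},\qquad \|\partial_x^kV\|_{L^\infty(\Omega)}\le D_k,\qquad \|\partial_x^kA_1\|_{L^\infty(\Omega)}\le D_k,$$ with constants $C_{r+k},D_k$ independent of $\epsilon$. Assume further that $\tau=o(\epsilon)$ and $h=o(\epsilon)$. Let $\Phi_I^n$ be the trigonometric interpolant of the numerical solution $\Phi^n$ produced by the second-order splitting scheme $S_2$. Then there are positive constants $C_2$ and $E_{m,2}$, independent of $\epsilon,\tau,h$, such that for all integers $0\le n\le T_{\rm end}/\tau$, $$\|\Phi(t_n,\cdot)-\Phi_I^n(\cdot)\|_{L^2}\le C_2T_{\rm end}\,\frac{\tau^2}{\epsilon^3}+E_{m,2}\,\frac{T_{\rm end}}{\tau}\Big(\frac{h}{\epsilon(b-a)}\Big)^m .$$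
   Context: Pauli matrices: $\sigma_1=\begin{pmatrix}0&1\\1&0\end{pmatrix}$, $\sigma_3=\begin{pmatrix}1&0\\0&-1\end{pmatrix}$; $I_2$ is the $2\times2$ identity. Problem: $V,A_1:\overline\Omega\to\mathbb R$ are given time-independent potentials, $\Phi=\Phi(t,x)\in\mathbb C^2$ solves $$i\epsilon\,\partial_t\Phi=\big[-i\epsilon\sigma_1\partial_x+\sigma_3+V(x)I_2-A_1(x)\sigma_1\big]\Phi,\quad x\in\Omega=(a,b),$$ with $\Phi(t,a)=\Phi(t,b)$, $\partial_x\Phi(t,a)=\partial_x\Phi(t,b)$ and $\Phi(0,x)=\Phi_0(x)$. The solution (and initial datum) may depend on $\epsilon$. $W^{m,\infty}_p(\Omega)=\{f\in W^{m,\infty}(\Omega):\partial_x^kf(a)=\partial_x^kf(b),\ k=0,\dots,m-1\}$ (componentwise for $\mathbb C^2$-valued functions). Periodicity of $V,A_1$ means that $\partial_x^k V$ and $\partial_x^k A_1$ agree at $a$ and $b$ for $k=0,\dots,m-1$. $\|f\|_{L^2}=(\int_\Omega|f|^2dx)^{1/2}$. Grid: $M$ is an even positive integer, $h=(b-a)/M$, $x_j=a+jh$ $(0\le j\le M-1)$, $\tau>0$, $t_n=n\tau$, $\mu_l=2\pi l/(b-a)$ for $-M/2\le l\le M/2-1$. For grid values $U=(U_0,\dots,U_{M-1})$ put $\hat U_l=\frac1M\sum_{j=0}^{M-1}U_je^{-i\mu_l(x_j-a)}$ and let the interpolant be $U_I(x)=\sum_{l=-M/2}^{M/2-1}\hat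 U_le^{i\mu_l(x-a)}$. Scheme $S_2$: with $W_j=-\frac i\epsilon V(x_j)I_2+\frac i\epsilon A_1(x_j)\sigma_1$, set $\Phi_j^0=\Phi_0(x_j)$ and, for $n\ge0$, $$\Phi_j^{n,*}=e^{\frac\tau2W_j}\Phi_j^n,\qquad \Phi_j^{n,**}=\sum_{l=-M/2}^{M/2-1}e^{\tau(-i\mu_l\sigma_1-\frac i\epsilon\sigma_3)}\,\widehat{\Phi^{n,*}}_l\,e^{i\mu_l(x_j-a)},\qquad \Phi_j^{n+1}=e^{\frac\tau2W_j}\Phi_j^{n,**}.$$ Asymptotic conditions: $\tau=o(\epsilon)$, $h=o(\epsilon)$ are understood as: there is a fixed bounded function $\eta:(0,1]\to(0,\infty)$ with $\eta(\epsilon)\to0$ as $\epsilon\to0^+$ such that $\tau/\epsilon\le\eta(\epsilon)$ and $h/\epsilon\le\eta(\epsilon)$; constants in the conclusion may depend on $\eta$ and on the data of the problem ($m$, $T_{\rm end}$, $a$, $b$, the $C_{r+k}$, $D_k$), but not on $\epsilon,\tau,h$. *)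

theory Defs
  imports "HOL-Analysis.Analysis" "HOL-Probability.Essential_Supremum"
begin

section \<open>Matrices on \<open>\<complex>\<^sup>2\<close>\<close>

definition sigma1 :: "complex^2^2" where
  "sigma1 = vector [vector [0, 1], vector [1, 0]]"

definition sigma3 :: "complex^2^2" where
  "sigma3 = vector [vector [1, 0], vector [0, -1]]"

definition mscale :: "complex \<Rightarrow> complex^2^2 \<Rightarrow> complex^2^2" (infixr \<open>*m\<close> 75) where
  "c *m A = (\<chi> i. c *s (A $ i))"

text \<open>The library's \<^const>\<open>exp\<close> is not available on matrices (their ring structure in the
  library is the entrywise one), hence the exponential series is written out.\<close>

definition mexp :: "complex^2^2 \<Rightarrow> complex^2^2" where
  "mexp A = (\<Sum>k. (1 / fact k) *\<^sub>R ((\<lambda>B. A ** B) ^^ k) (mat 1))"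


section \<open>Function spaces on \<open>\<Omega> = (a, b)\<close>\<close>

definition test_fun :: "real \<Rightarrow> real \<Rightarrow> (real \<Rightarrow> real) \<Rightarrow> bool" where
  "test_fun a b \<phi> \<longleftrightarrow>
     (\<forall>k. (deriv ^^ k) \<phi> differentiable_on UNIV) \<and>
     compact (closure {x. \<phi> x \<noteq> 0}) \<and> closure {x. \<phi> x \<noteq> 0} \<subseteq> {a<..<b}"

definition loc_integrable :: "real \<Rightarrow> real \<Rightarrow> (real \<Rightarrow> 'a::euclidean_space) \<Rightarrow> bool" where
  "loc_integrable a b f \<longleftrightarrow> (\<forall>K. compact K \<and> K \<subseteq> {a<..<b} \<longrightarrow> integrable (lebesgue_on K) f)"

definition weak_deriv ::
    "real \<Rightarrow> real \<Rightarrow> nat \<Rightarrow> (real \<Rightarrow> 'a::euclidean_space) \<Rightarrow> (real \<Rightarrow> 'a) \<Rightarrow> bool" where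
  "weak_deriv a b k f g \<longleftrightarrow>
     loc_integrable a b f \<and> loc_integrable a b g \<and>
     (\<forall>\<phi>. test_fun a b \<phi> \<longrightarrow>
        (LINT x|lebesgue_on {a<..<b}. (deriv ^^ k) \<phi> x *\<^sub>R f x) =
        (-1) ^ k *\<^sub>R (LINT x|lebesgue_on {a<..<b}. \<phi> x *\<^sub>R g x))"

text \<open>A representative of the \<open>k\<close>-th weak derivative, which is unique up to null sets.\<close>

definition wderiv ::
    "real \<Rightarrow> real \<Rightarrow> nat \<Rightarrow> (real \<Rightarrow> 'a::euclidean_space) \<Rightarrow> (real \<Rightarrow> 'a)" where
  "wderiv a b k f = (SOME g. weak_deriv a b k f g)"

definition Linf_norm :: "real \<Rightarrow> real \<Rightarrow> (real \<Rightarrow> 'a::real_normed_vector) \<Rightarrow> ereal" where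
  "Linf_norm a b f = esssup (lebesgue_on {a<..<b}) (\<lambda>x. ereal (norm (f x)))"

definition in_Winf :: "nat \<Rightarrow> real \<Rightarrow> real \<Rightarrow> (real \<Rightarrow> 'a::euclidean_space) \<Rightarrow> bool" where
  "in_Winf m a b f \<longleftrightarrow>
     (\<forall>k\<le>m. (\<exists>g. weak_deriv a b k f g) \<and> Linf_norm a b (wderiv a b k f) < \<infinity>)"

definition Winf_norm :: "nat \<Rightarrow> real \<Rightarrow> real \<Rightarrow> (real \<Rightarrow> 'a::euclidean_space) \<Rightarrow> ereal" where
  "Winf_norm m a b f = (\<Sum>k\<le>m. Linf_norm a b (wderiv a b k f))"

text \<open>For \<open>k < m\<close> the \<open>k\<close>-th weak derivative of a function in \<open>W\<^sup>m\<^sup>,\<^sup>\<infinity>\<close> has a unique representative that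
  is continuous on \<open>[a, b]\<close>; its values at \<open>a\<close> and \<open>b\<close> are the ones meant in the periodicity
  condition.\<close>

definition in_Winf_per :: "nat \<Rightarrow> real \<Rightarrow> real \<Rightarrow> (real \<Rightarrow> 'a::euclidean_space) \<Rightarrow> bool" where
  "in_Winf_per m a b f \<longleftrightarrow>
     in_Winf m a b f \<and>
     (\<forall>k<m. \<exists>g. weak_deriv a b k f g \<and> continuous_on {a..b} g \<and> g a = g b)"

text \<open>\<open>U 0 \<in> C\<^sup>n([0, T]; W\<^sup>m\<^sup>,\<^sup>\<infinity>\<^sub>p)\<close> with \<open>U r\<close> its \<open>r\<close>-th time derivative, \<open>r \<le> n\<close>: the difference
  quotients converge in the norm of the space, and \<open>U n\<close> is continuous in that norm.\<close>

definition Cn_into_Winf_per ::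
    "nat \<Rightarrow> real \<Rightarrow> nat \<Rightarrow> real \<Rightarrow> real \<Rightarrow> (nat \<Rightarrow> real \<Rightarrow> real \<Rightarrow> 'a::euclidean_space) \<Rightarrow> bool" where
  "Cn_into_Winf_per n T m a b U \<longleftrightarrow>
     (\<forall>r\<le>n. \<forall>t\<in>{0..T}. in_Winf_per m a b (U r t)) \<and>
     (\<forall>r<n. \<forall>t\<in>{0..T}.
        ((\<lambda>s. Winf_norm m a b (\<lambda>x. (U r s x - U r t x) /\<^sub>R (s - t) - U (Suc r) t x)) \<longlongrightarrow> 0)
          (at t within {0..T})) \<and>
     (\<forall>t\<in>{0..T}.
        ((\<lambda>s. Winf_norm m a b (\<lambda>x. U n s x - U n t x)) \<longlongrightarrow> 0) (at t within {0..T}))"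

definition Linf_time_norm ::
    "real \<Rightarrow> real \<Rightarrow> real \<Rightarrow> (real \<Rightarrow> real \<Rightarrow> 'a::real_normed_vector) \<Rightarrow> ereal" where
  "Linf_time_norm T a b u = esssup (lebesgue_on {0..T}) (\<lambda>t. Linf_norm a b (u t))"

definition L2_norm :: "real \<Rightarrow> real \<Rightarrow> (real \<Rightarrow> 'a::real_normed_vector) \<Rightarrow> real" where
  "L2_norm a b f = sqrt (LINT x|lebesgue_on {a<..<b}. (norm (f x))\<^sup>2)"

text \<open>Classical derivatives on \<open>[a, b]\<close>, one-sided at the end points.\<close>

primrec cderiv ::
    "real \<Rightarrow> real \<Rightarrow> nat \<Rightarrow> (real \<Rightarrow> 'a::real_normed_vector) \<Rightarrow> (real \<Rightarrow> 'a)" where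
  "cderiv a b 0 f = f"
| "cderiv a b (Suc k) f = (\<lambda>x. vector_derivative (cderiv a b k f) (at x within {a..b}))"

text \<open>\<open>C\<^sup>m\<close> on the open interval; for \<open>k < m\<close> the \<open>k\<close>-th derivative extends to \<open>[a, b]\<close>, with equal
  end-point values. (If a derivative extends continuously to \<open>a\<close>, its limit there is the one-sided
  derivative, so that continuity on \<open>[a, b]\<close> is the right requirement on \<^const>\<open>cderiv\<close>.)\<close>

definition Cm_periodic :: "nat \<Rightarrow> real \<Rightarrow> real \<Rightarrow> (real \<Rightarrow> real) \<Rightarrow> bool" where
  "Cm_periodic m a b V \<longleftrightarrow>
     (\<forall>k<m. cderiv a b k V differentiable_on {a<..<b}) \<and>
     continuous_on {a<..<b} (cderiv a b m V) \<and>
     (\<forall>k<m. continuous_on {a..b} (cderiv a b k V) \<and> cderiv a b k V a = cderiv a b k V b)"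


section \<open>The Dirac equation\<close>

definition dirac_solution ::
    "real \<Rightarrow> real \<Rightarrow> real \<Rightarrow> real \<Rightarrow> (real \<Rightarrow> real) \<Rightarrow> (real \<Rightarrow> real) \<Rightarrow> (real \<Rightarrow> complex^2) \<Rightarrow>
     (real \<Rightarrow> real \<Rightarrow> complex^2) \<Rightarrow> bool" where
  "dirac_solution \<epsilon> T a b V A1 \<Phi>0 \<Phi> \<longleftrightarrow>
     (\<forall>t\<in>{0..T}. \<Phi> t differentiable_on {a..b}) \<and>
     (\<forall>x\<in>{a<..<b}. (\<lambda>t. \<Phi> t x) differentiable_on {0..T}) \<and>
     (\<forall>t\<in>{0..T}. \<forall>x\<in>{a<..<b}.
        (\<i> * of_real \<epsilon>) *s vector_derivative (\<lambda>s. \<Phi> s x) (at t within {0..T}) =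
        (- \<i> * of_real \<epsilon>) *s (sigma1 *v cderiv a b 1 (\<Phi> t) x) +
        (sigma3 + V x *\<^sub>R mat 1 - A1 x *\<^sub>R sigma1) *v \<Phi> t x) \<and>
     (\<forall>t\<in>{0..T}. \<Phi> t a = \<Phi> t b \<and> cderiv a b 1 (\<Phi> t) a = cderiv a b 1 (\<Phi> t) b) \<and>
     (\<forall>x\<in>{a..b}. \<Phi> 0 x = \<Phi>0 x)"


section \<open>The splitting scheme\<close>

definition mesh :: "real \<Rightarrow> real \<Rightarrow> nat \<Rightarrow> real" where
  "mesh a b M = (b - a) / real M"

definition node :: "real \<Rightarrow> real \<Rightarrow> nat \<Rightarrow> nat \<Rightarrow> real" where
  "node a b M j = a + real j * mesh a b M"

definition mu :: "real \<Rightarrow> real \<Rightarrow> int \<Rightarrow> real" where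
  "mu a b l = 2 * pi * of_int l / (b - a)"

definition modes :: "nat \<Rightarrow> int set" where
  "modes M = {- (int M div 2) .. int M div 2 - 1}"

definition dft :: "real \<Rightarrow> real \<Rightarrow> nat \<Rightarrow> (nat \<Rightarrow> complex^2) \<Rightarrow> int \<Rightarrow> complex^2" where
  "dft a b M U l =
     (1 / of_nat M) *s (\<Sum>j<M. exp (- \<i> * of_real (mu a b l * (node a b M j - a))) *s U j)"

definition interpolant :: "real \<Rightarrow> real \<Rightarrow> nat \<Rightarrow> (nat \<Rightarrow> complex^2) \<Rightarrow> real \<Rightarrow> complex^2" where
  "interpolant a b M U x =
     (\<Sum>l\<in>modes M. exp (\<i> * of_real (mu a b l * (x - a))) *s dft a b M U l)"

definition potential_flow ::
    "real \<Rightarrow> real \<Rightarrow> real \<Rightarrow> nat \<Rightarrow> (real \<Rightarrow> real) \<Rightarrow> (real \<Rightarrow> real) \<Rightarrow> real \<Rightarrow>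
     (nat \<Rightarrow> complex^2) \<Rightarrow> nat \<Rightarrow> complex^2" where
  "potential_flow \<epsilon> a b M V A1 s U j =
     (let x = node a b M j;
          W = (- \<i> / of_real \<epsilon> * of_real (V x)) *m mat 1 + (\<i> / of_real \<epsilon> * of_real (A1 x)) *m sigma1
      in mexp (of_real s *m W) *v U j)"

definition free_flow ::
    "real \<Rightarrow> real \<Rightarrow> real \<Rightarrow> nat \<Rightarrow> real \<Rightarrow> (nat \<Rightarrow> complex^2) \<Rightarrow> nat \<Rightarrow> complex^2" where
  "free_flow \<epsilon> a b M s U j =
     (\<Sum>l\<in>modes M. exp (\<i> * of_real (mu a b l * (node a b M j - a))) *s
        (mexp (of_real s *m ((- \<i> * of_real (mu a b l)) *m sigma1 - (\<i> / of_real \<epsilon>) *m sigma3))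
           *v dft a b M U l))"

text \<open>Grid functions are maps on \<open>nat\<close> of which only the values at \<open>j < M\<close> matter.\<close>

primrec S2 ::
    "real \<Rightarrow> real \<Rightarrow> real \<Rightarrow> nat \<Rightarrow> real \<Rightarrow> (real \<Rightarrow> real) \<Rightarrow> (real \<Rightarrow> real) \<Rightarrow>
     (real \<Rightarrow> complex^2) \<Rightarrow> nat \<Rightarrow> nat \<Rightarrow> complex^2" where
  "S2 \<epsilon> a b M \<tau> V A1 \<Phi>0 0 = (\<lambda>j. \<Phi>0 (node a b M j))"
| "S2 \<epsilon> a b M \<tau> V A1 \<Phi>0 (Suc n) =
     potential_flow \<epsilon> a b M V A1 (\<tau> / 2)
       (free_flow \<epsilon> a b M \<tau>
         (potential_flow \<epsilon> a b M V A1 (\<tau> / 2) (S2 \<epsilon> a b M \<tau> V A1 \<Phi>0 n)))"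

end

theory Submission
  imports Defs "HOL-Probability.Characteristic_Functions"
begin

text \<open>Every step of the scheme is an isometry for the discrete \<open>L\<^sup>2\<close> norm, so the errors of the single
  steps add up and each of them has to be of size \<open>\<tau>\<^sup>3 / \<epsilon>\<^sup>3 + (\<tau> / \<epsilon>) (h / \<epsilon>)\<^sup>m\<close>. The exact solution is
  replaced by its projection \<open>p\<close> onto the Fourier modes of the grid. It satisfies the collocated
  equation \<open>p' = (A + B) p\<close>, with \<open>A\<close> the free part and \<open>B\<close> the potential, up to a defect that
  involves only the bounded operator \<open>B\<close>; interpolating \<open>\<Phi>\<close> instead would cost a derivative, hence a
  factor \<open>1 / h\<close>. Since \<open>A + B\<close>, \<open>A\<close> and \<open>B\<close> all generate isometries, the exact and the split flow can
  be expanded to second order at \<open>p\<close>, and the remainders are words of length three in \<open>A\<close> and \<open>B\<close>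
  applied to \<open>p\<close>, which are of size \<open>\<epsilon>\<^sup>-\<^sup>3\<close> because \<open>\<epsilon> \<partial>\<^sub>x\<close> is bounded on \<open>p\<close>.

  Smoothness is used in the form of finite-difference bounds, and Fourier coefficients are those of a
  grid with \<open>K M\<close> points, where inversion, aliasing and Parseval are finite identities; \<open>K\<close> tends to
  infinity in the end.\<close>

section \<open>Linear flows on \<open>\<complex>\<^sup>2\<close>\<close>

text \<open>The shape of the final bound: n \<tau> <= T adds the local errors up to T \<tau>^2 /
  \<epsilon>^3 + (T / \<epsilon>) (h / \<epsilon>)^m. Boundedness of \<tau> / \<epsilon> turns T /
  \<epsilon> into a multiple of T / \<tau>, and boundedness of \<tau> puts the initial sampling
  error, of size (h / \<epsilon>)^m, under the same term. The main obstacle is the form of the data.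
  Derivative bounds concern arbitrarily chosen representatives of weak derivatives and hold at
  almost every time, and the equation holds inside the interval only, whereas a grid argument needs
  values at every node and every time, including the node a. Difference bounds bridge this gap: they
  are pointwise, survive periodic extension and pass to pointwise limits in time. Weak derivatives
  are therefore used just once, against test functions that are smoothed indicators of intervals. On
  the grid with K M points the x-derivative becomes a difference quotient. The error has constants
  depending on M, but it is of order 1 / K, and M stays fixed while K grows.\<close>

lemma norm_vec2: "(norm (v::complex^2))\<^sup>2 = (cmod (v$1))\<^sup>2 + (cmod (v$2))\<^sup>2"
  by (simp add: norm_vec_def L2_set_def sum_2)

lemma inner_vec2: "inner (v::complex^2) w = Re (cnj (v$1) * w$1) + Re (cnj (v$2) * w$2)"
  by (simp add: inner_vec_def sum_2 inner_complex_def)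

lemma vec2_eq_iff: "(v::complex^2) = w \<longleftrightarrow> v$1 = w$1 \<and> v$2 = w$2"
  by (simp add: vec_eq_iff forall_2)

lemma matrix_vector_mult_2: "((A::complex^2^2) *v v) $ i = A$i$1 * v$1 + A$i$2 * v$2"
  by (simp add: matrix_vector_mult_def sum_2)

lemma mscale_vec [simp]: "(c *m A) *v v = c *s (A *v v)"
  by (simp add: vec_eq_iff mscale_def matrix_vector_mult_def sum_distrib_left mult.assoc)

lemma norm_smult_vec [simp]: "norm (c *s (v::complex^2)) = cmod c * norm v"
proof -
  have "(norm (c *s v))\<^sup>2 = (cmod c * norm v)\<^sup>2"
    by (simp add: norm_vec2 norm_mult power_mult_distrib algebra_simps)
  then show ?thesis by (simp add: power2_eq_iff_nonneg)
qed

lemma bounded_linear_matrix_vector: "bounded_linear ((*v) (A::complex^2^2))"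
proof -
  have "linear ((*v) A)"
    by (rule linearI) (simp_all add: vec2_eq_iff matrix_vector_mult_2 algebra_simps)
  then show ?thesis by (simp add: linear_conv_bounded_linear)
qed

lemma matrix_vector_scaleR: "(A::complex^2^2) *v (r *\<^sub>R v) = r *\<^sub>R (A *v v)"
  using bounded_linear_matrix_vector[of A] by (simp add: bounded_linear.linear linear_scale)

lemma has_vector_derivative_vec2:
  fixes f :: "real \<Rightarrow> complex^2"
  assumes "\<And>i. ((\<lambda>s. f s $ i) has_vector_derivative f' $ i) F"
  shows "(f has_vector_derivative f') F"
proof -
  have bl: "bounded_linear (\<lambda>z. z *s (axis i 1 :: complex^2))" for i :: 2
  proof -
    have "linear (\<lambda>z. z *s (axis i 1 :: complex^2))"
      by (rule linearI) (simp_all add: vec_eq_iff algebra_simps)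
    then show ?thesis by (simp add: linear_conv_bounded_linear)
  qed
  have eq: "v = v$1 *s axis 1 1 + v$2 *s axis 2 1" for v :: "complex^2"
    by (simp add: vec2_eq_iff axis_def)
  have "((\<lambda>s. f s $ i *s (axis i 1 :: complex^2)) has_vector_derivative (f' $ i *s axis i 1)) F" for i
    using bounded_linear.has_vector_derivative[OF bl assms] .
  then have "((\<lambda>s. f s $ 1 *s (axis 1 1 :: complex^2) + f s $ 2 *s axis 2 1) has_vector_derivative
      (f' $ 1 *s axis 1 1 + f' $ 2 *s axis 2 1)) F"
    by (intro has_vector_derivative_add)
  then show ?thesis using eq by simp
qed

lemma sigma1_vec: "(sigma1 *v v)$1 = v$2" "(sigma1 *v v)$2 = v$1"
  by (simp_all add: matrix_vector_mult_2 sigma1_def)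

lemma sigma3_vec: "(sigma3 *v v)$1 = v$1" "(sigma3 *v v)$2 = - v$2"
  by (simp_all add: matrix_vector_mult_2 sigma3_def)

lemma norm_sigma1 [simp]: "norm (sigma1 *v v) = norm v"
proof -
  have "(norm (sigma1 *v v))\<^sup>2 = (norm v)\<^sup>2" by (simp add: norm_vec2 sigma1_vec)
  then show ?thesis by (simp add: power2_eq_iff_nonneg)
qed

lemma norm_sigma3 [simp]: "norm (sigma3 *v v) = norm v"
proof -
  have "(norm (sigma3 *v v))\<^sup>2 = (norm v)\<^sup>2" by (simp add: norm_vec2 sigma3_vec)
  then show ?thesis by (simp add: power2_eq_iff_nonneg)
qed

text \<open>With the real inner product this says that the real part of the Hermitian form of
  \<open>G\<close> vanishes, that is, \<open>G\<close> is anti-Hermitian. It is stated in the form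
  in which energy identities use it.\<close>

definition skew :: "complex^2^2 \<Rightarrow> bool" where
  "skew G \<longleftrightarrow> (\<forall>v. inner v (G *v v) = 0)"

section \<open>The matrix exponential as a series acting on vectors\<close>

lemma mat_vec_bound: "norm ((A::complex^2^2) *v v) \<le> (\<Sum>i\<in>UNIV. \<Sum>j\<in>UNIV. cmod (A$i$j)) * norm v"
proof -
  have "norm (A *v v) \<le> (\<Sum>i\<in>UNIV. cmod ((A *v v)$i))"
    by (simp add: norm_vec_def L2_set_le_sum)
  also have "\<dots> \<le> (\<Sum>i\<in>UNIV. \<Sum>j\<in>UNIV. cmod (A$i$j) * norm v)"
  proof (rule sum_mono)
    fix i
    have "cmod ((A *v v)$i) \<le> (\<Sum>j\<in>UNIV. cmod (A$i$j * v$j))"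
      by (simp add: matrix_vector_mult_def norm_sum)
    also have "\<dots> \<le> (\<Sum>j\<in>UNIV. cmod (A$i$j) * norm v)"
      by (intro sum_mono) (simp add: norm_mult mult_left_mono Finite_Cartesian_Product.norm_nth_le)
    finally show "cmod ((A *v v)$i) \<le> (\<Sum>j\<in>UNIV. cmod (A$i$j) * norm v)" .
  qed
  finally show ?thesis by (simp add: sum_distrib_right)
qed

lemma mat_pow_vec: "((\<lambda>B. A ** B) ^^ k) (mat 1) *v v = (((*v) (A::complex^2^2)) ^^ k) v"
  by (induction k) (simp_all add: matrix_vector_mul_assoc[symmetric])

lemma matrix_column: "(A::complex^2^2) *v axis j 1 = (\<chi> i. A$i$j)"
  by (simp add: vec_eq_iff matrix_vector_mult_def axis_def if_distrib cong: if_cong)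

lemma pow_vec_bound:
  "norm ((((*v) (A::complex^2^2)) ^^ k) v) \<le> (\<Sum>i\<in>UNIV. \<Sum>j\<in>UNIV. cmod (A$i$j)) ^ k * norm v"
proof (induction k)
  case (Suc k)
  let ?c = "\<Sum>i\<in>UNIV. \<Sum>j\<in>UNIV. cmod (A$i$j)"
  have c: "0 \<le> ?c" by (intro sum_nonneg) auto
  have "norm ((((*v) A) ^^ Suc k) v) \<le> ?c * norm ((((*v) A) ^^ k) v)"
    using mat_vec_bound[of A "(((*v) A) ^^ k) v"] by simp
  also have "\<dots> \<le> ?c * (?c ^ k * norm v)" by (rule mult_left_mono[OF Suc c])
  finally show ?case by (simp add: mult.assoc)
qed simp

lemma summable_exp_vec: "summable (\<lambda>k. (1 / fact k) *\<^sub>R (((*v) (A::complex^2^2)) ^^ k) v)"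
proof -
  let ?c = "\<Sum>i\<in>UNIV. \<Sum>j\<in>UNIV. cmod (A$i$j)"
  have "summable (\<lambda>k. inverse (fact k) * ?c ^ k * norm v)"
    by (intro summable_mult2 summable_exp)
  then show ?thesis
  proof (rule summable_comparison_test')
    fix k :: nat
    have "norm ((1 / fact k) *\<^sub>R (((*v) A) ^^ k) v) = inverse (fact k) * norm ((((*v) A) ^^ k) v)"
      by (simp add: divide_inverse)
    also have "\<dots> \<le> inverse (fact k) * (?c ^ k * norm v)"
      by (intro mult_left_mono pow_vec_bound) auto
    finally show "norm ((1 / fact k) *\<^sub>R (((*v) A) ^^ k) v) \<le> inverse (fact k) * ?c ^ k * norm v"
      by (simp add: mult.assoc)
  qed
qed

text \<open>Column j of a matrix power is that power applied to \<open>axis j 1\<close>, so the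
  entries of the matrix series are components of convergent vector series. Convergence of the matrix
  series follows entrywise, and evaluation at \<open>v\<close> is bounded linear in the
  matrix.\<close>

lemma mexp_vec: "mexp A *v v = (\<Sum>k. (1 / fact k) *\<^sub>R (((*v) A) ^^ k) v)"
proof -
  let ?t = "\<lambda>k. (1 / fact k) *\<^sub>R ((\<lambda>B. A ** B) ^^ k) (mat 1)"
  have comp: "?t k $ i $ j = ((1 / fact k) *\<^sub>R (((*v) A) ^^ k) (axis j 1)) $ i" for k i j
  proof -
    have "((\<lambda>B. A ** B) ^^ k) (mat 1) $ i $ j = (((\<lambda>B. A ** B) ^^ k) (mat 1) *v axis j 1) $ i"
      by (simp add: matrix_column)
    then show ?thesis by (simp only: mat_pow_vec vector_scaleR_component)
  qed
  have "summable ?t"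
  proof -
    have 1: "summable (\<lambda>k. ?t k $ i $ j)" for i j
      unfolding comp by (rule bounded_linear.summable[OF bounded_linear_vec_nth summable_exp_vec])
    have 2: "(\<lambda>k. ?t k $ i) sums (\<chi> j. \<Sum>k. ?t k $ i $ j)" for i
      unfolding sums_def by (rule vec_tendstoI) (use 1[of i] in \<open>simp add: summable_LIMSEQ\<close>)
    have "?t sums (\<chi> i. \<chi> j. \<Sum>k. ?t k $ i $ j)"
      unfolding sums_def by (rule vec_tendstoI) (use 2 in \<open>simp add: sums_def\<close>)
    then show ?thesis by (rule sums_summable)
  qed
  have bl: "bounded_linear (\<lambda>B::complex^2^2. B *v v)"
  proof -
    have "linear (\<lambda>B::complex^2^2. B *v v)"
      by (rule linearI) (simp_all add: vec2_eq_iff matrix_vector_mult_2 algebra_simps)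
    then show ?thesis by (simp add: linear_conv_bounded_linear)
  qed
  have sc: "(r *\<^sub>R B) *v v = r *\<^sub>R (B *v v)" for r and B :: "complex^2^2"
    by (simp add: vec2_eq_iff matrix_vector_mult_2 algebra_simps)
  have "mexp A *v v = (\<Sum>k. ?t k *v v)"
    unfolding mexp_def by (rule bounded_linear.suminf[OF bl \<open>summable ?t\<close>])
  also have "(\<lambda>k. ?t k *v v) = (\<lambda>k. (1 / fact k) *\<^sub>R (((*v) A) ^^ k) v)"
    by (simp add: sc mat_pow_vec)
  finally show ?thesis by simp
qed

lemma mscale_pow_vec: "(((*v) (c *m G)) ^^ k) v = c ^ k *s (((*v) G) ^^ k) v"
proof (induction k)
  case (Suc k)
  have "(((*v) (c *m G)) ^^ Suc k) v = c *s (G *v (c ^ k *s (((*v) G) ^^ k) v))"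
    by (simp add: Suc)
  also have "\<dots> = c ^ Suc k *s (((*v) G) ^^ Suc k) v"
    by (simp add: vec2_eq_iff matrix_vector_mult_2 algebra_simps)
  finally show ?case .
qed simp

lemma mexp_0 [simp]: "mexp (of_real 0 *m G) *v v = v"
proof -
  have "(1 / fact k) *\<^sub>R (((*v) (of_real 0 *m G)) ^^ k) v = (if k = 0 then v else 0)" for k
    by (cases k) (simp_all add: mscale_pow_vec)
  then have "mexp (of_real 0 *m G) *v v = (\<Sum>k. if k = 0 then v else 0)" by (simp only: mexp_vec)
  then show ?thesis using sums_unique[OF sums_single[of 0 "\<lambda>_. v"]] by simp
qed

text \<open>Each component is an everywhere convergent scalar power series in \<open>s\<close> with
  coefficients \<open>c i k\<close>, so it may be differentiated term by term; the coefficients of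
  the derivative are those of the series for \<open>G\<close> applied to the flow.\<close>

lemma mexp_flow_deriv:
  "((\<lambda>s. mexp (of_real s *m G) *v v) has_vector_derivative G *v (mexp (of_real s *m G) *v v)) (at s)"
proof -
  define c where "c i k = (1 / fact k) *\<^sub>R ((((*v) G) ^^ k) v $ i)" for i :: 2 and k
  have trm: "((1 / fact k) *\<^sub>R (((*v) (of_real s *m G)) ^^ k) v) $ i = c i k * of_real s ^ k" for s k i
    by (simp add: mscale_pow_vec c_def mult.commute)
  have sm: "summable (\<lambda>k. c i k * z ^ k)" for i and z :: complex
  proof -
    have "summable (\<lambda>k. ((1 / fact k) *\<^sub>R (((*v) (z *m G)) ^^ k) v) $ i)"
      by (rule bounded_linear.summable[OF bounded_linear_vec_nth summable_exp_vec])
    then show ?thesis by (simp add: mscale_pow_vec c_def mult.commute)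
  qed
  have val: "(mexp (of_real s *m G) *v v) $ i = (\<Sum>k. c i k * of_real s ^ k)" for i s
  proof -
    have "(mexp (of_real s *m G) *v v) $ i
        = (\<Sum>k. ((1 / fact k) *\<^sub>R (((*v) (of_real s *m G)) ^^ k) v) $ i)"
      unfolding mexp_vec
      by (rule bounded_linear.suminf[OF bounded_linear_vec_nth summable_exp_vec])
    then show ?thesis by (simp only: trm)
  qed
  have dc: "diffs (c i) k = G$i$1 * c 1 k + G$i$2 * c 2 k" for i k
  proof -
    have "diffs (c i) k = (of_nat (Suc k) / fact (Suc k)) * ((G *v (((*v) G) ^^ k) v) $ i)"
      by (simp add: diffs_def c_def scaleR_conv_of_real)
    also have "of_nat (Suc k) / fact (Suc k) = (1 / fact k :: complex)"
      by (simp del: of_nat_Suc)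
    also have "\<dots> * ((G *v (((*v) G) ^^ k) v) $ i) = G$i$1 * c 1 k + G$i$2 * c 2 k"
      by (simp add: matrix_vector_mult_2 c_def scaleR_conv_of_real field_simps)
    finally show ?thesis .
  qed
  have "((\<lambda>s. (mexp (of_real s *m G) *v v) $ i) has_vector_derivative
      (G *v (mexp (of_real s *m G) *v v)) $ i) (at s)" for i
  proof -
    have "((\<lambda>z. \<Sum>k. c i k * z ^ k) has_field_derivative (\<Sum>k. diffs (c i) k * of_real s ^ k))
        (at (of_real s :: complex))"
      by (rule termdiffs_strong_converges_everywhere) (rule sm)
    moreover have "(\<Sum>k. diffs (c i) k * of_real s ^ k)
        = (\<Sum>k. G$i$1 * (c 1 k * of_real s ^ k) + G$i$2 * (c 2 k * of_real s ^ k))"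
      by (simp add: dc algebra_simps)
    moreover have "\<dots> = G$i$1 * (\<Sum>k. c 1 k * of_real s ^ k) + G$i$2 * (\<Sum>k. c 2 k * of_real s ^ k)"
      using sm by (simp add: suminf_add[symmetric] suminf_mult summable_mult)
    ultimately have "((\<lambda>z. \<Sum>k. c i k * z ^ k) has_field_derivative
        (G *v (mexp (of_real s *m G) *v v)) $ i) (at (of_real s :: complex))"
      by (simp only: matrix_vector_mult_2[of G "mexp (of_real s *m G) *v v" i] val)
    from has_vector_derivative_real_field[OF this]
    show ?thesis unfolding val .
  qed
  then show ?thesis by (rule has_vector_derivative_vec2)
qed


text \<open>The squared norm has as derivative twice the inner product of the flow with
  \<open>G\<close> applied to it, which is zero.\<close>

lemma skew_norm_mexp:
  assumes "skew G"
  shows "norm (mexp (of_real s *m G) *v v) = norm v"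
proof -
  let ?f = "\<lambda>s. mexp (of_real s *m G) *v v"
  have D: "((\<lambda>s. inner (?f s) (?f s)) has_real_derivative 0) (at s)" for s
  proof -
    have "((\<lambda>s. inner (?f s) (?f s)) has_vector_derivative
        (inner (?f s) (G *v ?f s) + inner (G *v ?f s) (?f s))) (at s)"
      by (rule bounded_bilinear.has_vector_derivative[OF bounded_bilinear_inner])
        (rule mexp_flow_deriv)+
    then show ?thesis
      using assms by (simp add: skew_def inner_commute has_real_derivative_iff_has_vector_derivative)
  qed
  have "inner (?f s) (?f s) = inner (?f 0) (?f 0)"
    using DERIV_const_ratio_const2 DERIV_isconst_all[of "\<lambda>s. inner (?f s) (?f s)" s 0] D by blast
  then have "(norm (?f s))\<^sup>2 = (norm v)\<^sup>2"
    using mexp_0[of G v] by (simp only: power2_norm_eq_inner)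
  then show ?thesis by (simp add: power2_eq_iff_nonneg)
qed

text \<open>The bound on the derivative is replaced by its largest value on [0, \<tau>] instead of
  being integrated. This gives away a factor 1 / (k + 1), which is why the Taylor remainders below
  carry no factorials.\<close>

lemma norm_le_of_deriv_le:
  fixes f :: "real \<Rightarrow> 'a::real_normed_vector"
  assumes "0 \<le> \<tau>" and f: "\<And>s. (f has_vector_derivative f' s) (at s)"
    and le: "\<And>s. 0 \<le> s \<Longrightarrow> norm (f' s) \<le> c * s ^ k"
  shows "norm (f \<tau> - f 0) \<le> c * \<tau> ^ Suc k"
proof (cases "\<tau> = 0")
  case False
  have "0 \<le> c" using order_trans[OF norm_ge_zero le[of 1]] by simp
  have "norm (f \<tau> - f 0) \<le> (c * \<tau> ^ k) * norm (\<tau> - 0)"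
  proof (rule differentiable_bound[where S="{0..\<tau>}" and f'="\<lambda>s h. h *\<^sub>R f' s"])
    show "onorm (\<lambda>h. h *\<^sub>R f' s) \<le> c * \<tau> ^ k" if "s \<in> {0..\<tau>}" for s
    proof (rule onorm_le)
      fix h :: real
      have "norm (f' s) \<le> c * s ^ k" using that le by auto
      also have "\<dots> \<le> c * \<tau> ^ k"
        using that \<open>0 \<le> c\<close> by (intro mult_left_mono power_mono) auto
      finally show "norm (h *\<^sub>R f' s) \<le> c * \<tau> ^ k * norm h"
        by (simp add: mult.commute mult_left_mono)
    qed
  qed (use assms(1) f in \<open>auto simp: has_vector_derivative_def intro: has_derivative_at_withinI\<close>)
  then show ?thesis using assms(1) by (simp add: mult_ac)
qed simp

text \<open>The flow commutes with \<open>G\<close>, so the derivative of a remainder at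
  \<open>v\<close> is the remainder of one order less at \<open>G *v v\<close>; the isometry starts
  the recursion. The bounds contain powers of \<open>G\<close> applied to \<open>v\<close> rather
  than a norm of \<open>G\<close>, because the free generator grows with the frequency and only
  smoothness of the data compensates for it.\<close>

lemma mexp_taylor:
  assumes G: "skew G" and "0 \<le> \<tau>"
  defines "E \<equiv> \<lambda>v. mexp (of_real \<tau> *m G) *v v"
  shows mexp_taylor1: "norm (E v - v) \<le> \<tau> * norm (G *v v)"
    and mexp_taylor2: "norm (E v - v - \<tau> *\<^sub>R (G *v v)) \<le> \<tau>\<^sup>2 * norm (G *v (G *v v))"
    and mexp_taylor3: "norm (E v - v - \<tau> *\<^sub>R (G *v v) - (\<tau>\<^sup>2 / 2) *\<^sub>R (G *v (G *v v)))
        \<le> \<tau> ^ 3 * norm (G *v (G *v (G *v v)))"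
proof -
  let ?f = "\<lambda>s v. mexp (of_real s *m G) *v v"
  have comm: "G *v ?f s v = ?f s (G *v v)" for s v
  proof -
    have "G *v ?f s v = (\<Sum>k. G *v ((1 / fact k) *\<^sub>R (((*v) (of_real s *m G)) ^^ k) v))"
      unfolding mexp_vec by (rule bounded_linear.suminf[OF bounded_linear_matrix_vector summable_exp_vec])
    also have "(\<lambda>k. G *v ((1 / fact k) *\<^sub>R (((*v) (of_real s *m G)) ^^ k) v))
        = (\<lambda>k. (1 / fact k) *\<^sub>R (((*v) (of_real s *m G)) ^^ k) (G *v v))"
    proof
      fix k
      have sw: "G *v (((*v) G) ^^ k) v = (((*v) G) ^^ k) (G *v v)"
        by (rule funpow_swap1)
      have "G *v (of_real s ^ k *s w) = of_real s ^ k *s (G *v w)" for w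
        by (simp add: vec2_eq_iff matrix_vector_mult_2 algebra_simps)
      then show "G *v ((1 / fact k) *\<^sub>R (((*v) (of_real s *m G)) ^^ k) v)
        = (1 / fact k) *\<^sub>R (((*v) (of_real s *m G)) ^^ k) (G *v v)"
        by (simp add: mscale_pow_vec matrix_vector_scaleR sw)
    qed
    finally show ?thesis by (simp only: mexp_vec)
  qed
  have D: "((\<lambda>s. ?f s v) has_vector_derivative ?f s (G *v v)) (at s)" for s v
    using mexp_flow_deriv[of G v s] by (simp only: comm)
  have t1: "norm (?f s v - v) \<le> s * norm (G *v v)" if "0 \<le> s" for s v
    using norm_le_of_deriv_le[where f="\<lambda>s. ?f s v" and k=0 and c="norm (G *v v)", OF that D]
      skew_norm_mexp[OF G] mexp_0[of G v] by (simp add: mult.commute)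
  have t2: "norm (?f s v - v - s *\<^sub>R (G *v v)) \<le> s\<^sup>2 * norm (G *v (G *v v))" if "0 \<le> s" for s v
  proof -
    have "((\<lambda>s. ?f s v - v - s *\<^sub>R (G *v v)) has_vector_derivative (?f s (G *v v) - G *v v)) (at s)"
      for s by (auto intro!: derivative_eq_intros D)
    from norm_le_of_deriv_le[where k=1 and c="norm (G *v (G *v v))", OF that this]
    show ?thesis using t1 mexp_0[of G v]
      by (simp add: mult.commute power2_eq_square diff_diff_eq add.commute)
  qed
  have t3: "norm (?f s v - v - s *\<^sub>R (G *v v) - (s\<^sup>2 / 2) *\<^sub>R (G *v (G *v v)))
      \<le> s ^ 3 * norm (G *v (G *v (G *v v)))" if "0 \<le> s" for s v
  proof -
    have "((\<lambda>s. ?f s v - v - s *\<^sub>R (G *v v) - (s\<^sup>2 / 2) *\<^sub>R (G *v (G *v v))) has_vector_derivative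
        (?f s (G *v v) - G *v v - s *\<^sub>R (G *v (G *v v)))) (at s)"
      for s by (auto intro!: derivative_eq_intros D simp: power2_eq_square)
    from norm_le_of_deriv_le[where k=2 and c="norm (G *v (G *v (G *v v)))", OF that this]
    show ?thesis using t2 mexp_0[of G v]
      by (simp add: mult.commute power3_eq_cube power2_eq_square diff_diff_eq algebra_simps)
  qed
  show "norm (E v - v) \<le> \<tau> * norm (G *v v)"
    "norm (E v - v - \<tau> *\<^sub>R (G *v v)) \<le> \<tau>\<^sup>2 * norm (G *v (G *v v))"
    "norm (E v - v - \<tau> *\<^sub>R (G *v v) - (\<tau>\<^sup>2 / 2) *\<^sub>R (G *v (G *v v)))
        \<le> \<tau> ^ 3 * norm (G *v (G *v (G *v v)))"
    unfolding E_def using t1 t2 t3 assms(2) by blast+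
qed

lemma skew_free: "skew ((- \<i> * of_real \<mu>) *m sigma1 - (\<i> / of_real \<epsilon>) *m sigma3)"
proof -
  have "((- \<i> * of_real \<mu>) *m sigma1 - (\<i> / of_real \<epsilon>) *m sigma3) *v v
      = (- \<i> * of_real \<mu>) *s (sigma1 *v v) - (\<i> / of_real \<epsilon>) *s (sigma3 *v v)" for v
    by (simp add: matrix_vector_mult_diff_rdistrib)
  then show ?thesis
    by (simp add: skew_def inner_vec2 sigma1_vec sigma3_vec) (simp add: field_simps)
qed

lemma skew_potential: "skew ((- \<i> / of_real \<epsilon> * of_real V) *m mat 1 + (\<i> / of_real \<epsilon> * of_real A) *m sigma1)"
  by (simp add: skew_def matrix_vector_mult_add_rdistrib inner_vec2 sigma1_vec)
     (simp add: field_simps)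

section \<open>Discrete Fourier transform\<close>

definition omega :: "nat \<Rightarrow> int \<Rightarrow> complex" where
  "omega M k = cis (2 * pi * of_int k / of_nat M)"

definition trig_sum :: "nat \<Rightarrow> int set \<Rightarrow> (int \<Rightarrow> complex^2) \<Rightarrow> nat \<Rightarrow> complex^2" where
  "trig_sum N F c j = (\<Sum>l\<in>F. omega N (l * int j) *s c l)"

text \<open>Normalized so that a constant grid function has its own norm, which makes grids of
  different sizes comparable; multiplied by sqrt (b - a) it is the Riemann-sum version of the L2
  norm.\<close>

definition gnorm :: "nat \<Rightarrow> (nat \<Rightarrow> complex^2) \<Rightarrow> real" where
  "gnorm M U = L2_set (\<lambda>j. norm (U j)) {..<M} / sqrt (real M)"

text \<open>Exactly what makes the characters with frequencies in \<open>F\<close> orthogonal on a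
  grid of \<open>N\<close> points.\<close>

definition distinct_mod :: "nat \<Rightarrow> int set \<Rightarrow> bool" where
  "distinct_mod N F \<longleftrightarrow> finite F \<and> (\<forall>l\<in>F. \<forall>l'\<in>F. int N dvd l - l' \<longrightarrow> l = l')"

lemma norm_omega [simp]: "cmod (omega M k) = 1" by (simp add: omega_def)
lemma omega_0 [simp]: "omega M 0 = 1" by (simp add: omega_def)
lemma omega_add: "omega M (k + l) = omega M k * omega M l"
  by (simp add: omega_def cis_mult add_divide_distrib distrib_left)
lemma cnj_omega: "cnj (omega M k) = omega M (- k)" by (simp add: omega_def cis_cnj)
lemma omega_power: "omega M (k * int j) = omega M k ^ j"
proof -
  have "2 * pi * of_int (k * int j) / real M = real j * (2 * pi * of_int k / real M)" by simp
  then show ?thesis unfolding omega_def by (simp only: Complex.DeMoivre)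
qed

lemma omega_eq_1_iff:
  assumes "0 < M" shows "omega M k = 1 \<longleftrightarrow> int M dvd k"
proof
  assume "omega M k = 1"
  then obtain n :: int where "2 * pi * real_of_int k / real M = real_of_int (2 * n) * pi"
    by (auto simp: omega_def cis_conv_exp exp_eq_1)
  then have "real_of_int k = real_of_int (n * int M)" using assms by (simp add: field_simps)
  then show "int M dvd k" by (metis dvd_triv_right of_int_eq_iff)
next
  assume "int M dvd k"
  then obtain n where "k = int M * n" by (auto elim: dvdE)
  then show "omega M k = 1" using assms cis_multiple_2pi[of "of_int n"] by (simp add: omega_def mult.assoc)
qed

lemma omega_refine: "0 < K \<Longrightarrow> omega (K * M) (int K * k) = omega M k"
  by (simp add: omega_def mult.assoc)

lemma sum_omega:
  assumes "0 < M"
  shows "(\<Sum>j<M. omega M (k * int j)) = (if int M dvd k then of_nat M else 0)"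
proof (cases "int M dvd k")
  case True
  then have "omega M k = 1" using omega_eq_1_iff[OF assms] by simp
  then show ?thesis using True by (simp add: omega_power)
next
  case False
  have "omega M k \<noteq> 1" using omega_eq_1_iff[OF assms] False by simp
  moreover have "omega M k ^ M = 1"
    using omega_power[of M k M] omega_eq_1_iff[OF assms, of "k * int M"] by simp
  ultimately show ?thesis using False by (simp add: omega_power geometric_sum)
qed

text \<open>Orthogonality of the characters. The set \<open>F\<close> is kept general because the
  identity is needed for coarse modes on a fine grid and for shifted blocks of modes, besides the
  modes of the grid itself.\<close>

lemma scalar_parseval:
  assumes "0 < N" and F: "distinct_mod N F"
  shows "(\<Sum>j<N. cnj (\<Sum>l\<in>F. omega N (l * int j) * x l) * (\<Sum>l\<in>F. omega N (l * int j) * y l))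
    = of_nat N * (\<Sum>l\<in>F. cnj (x l) * y l)"
proof -
  have fin: "finite F" using F by (simp add: distinct_mod_def)
  have 1: "cnj (omega N (l * int j)) * omega N (l' * int j) = omega N ((l' - l) * int j)" for l l' j
    by (simp add: cnj_omega omega_add[symmetric] algebra_simps)
  have "(\<Sum>j<N. cnj (\<Sum>l\<in>F. omega N (l * int j) * x l) * (\<Sum>l\<in>F. omega N (l * int j) * y l))
    = (\<Sum>j<N. \<Sum>l\<in>F. \<Sum>l'\<in>F. omega N ((l' - l) * int j) * (cnj (x l) * y l'))"
    unfolding cnj_sum sum_product
    by (intro sum.cong refl) (simp add: 1[symmetric])
  also have "\<dots> = (\<Sum>l\<in>F. \<Sum>l'\<in>F. (\<Sum>j<N. omega N ((l' - l) * int j)) * (cnj (x l) * y l'))"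
    by (subst sum.swap, intro sum.cong refl, subst sum.swap) (simp add: sum_distrib_right)
  also have "\<dots> = (\<Sum>l\<in>F. \<Sum>l'\<in>F. if l' = l then of_nat N * (cnj (x l) * y l') else 0)"
  proof (intro sum.cong refl)
    fix l l' assume "l \<in> F" "l' \<in> F"
    then have "int N dvd l' - l \<longleftrightarrow> l' = l" using F by (auto simp: distinct_mod_def)
    then show "(\<Sum>j<N. omega N ((l' - l) * int j)) * (cnj (x l) * y l')
        = (if l' = l then of_nat N * (cnj (x l) * y l') else 0)"
      by (simp add: sum_omega[OF assms(1)])
  qed
  also have "\<dots> = of_nat N * (\<Sum>l\<in>F. cnj (x l) * y l)"
    using fin by (simp add: sum_distrib_left)
  finally show ?thesis .
qed

lemma trig_sum_nth: "trig_sum N F c j $ i = (\<Sum>l\<in>F. omega N (l * int j) * c l $ i)"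
  by (simp add: trig_sum_def)

lemma parseval_inner:
  assumes "0 < N" "distinct_mod N F"
  shows "(\<Sum>j<N. inner (trig_sum N F c j) (trig_sum N F d j)) = real N * (\<Sum>l\<in>F. inner (c l) (d l))"
proof -
  have eq: "inner (u::complex^2) v = (\<Sum>i\<in>UNIV. Re (cnj (u$i) * v$i))" for u v
    by (simp add: inner_vec2 sum_2)
  have "(\<Sum>j<N. inner (trig_sum N F c j) (trig_sum N F d j))
    = (\<Sum>i\<in>UNIV. Re (\<Sum>j<N. cnj (trig_sum N F c j $ i) * (trig_sum N F d j $ i)))"
    unfolding eq Re_sum by (rule sum.swap)
  also have "\<dots> = (\<Sum>i\<in>UNIV. Re (of_nat N * (\<Sum>l\<in>F. cnj (c l $ i) * d l $ i)))"
    unfolding trig_sum_nth by (simp only: scalar_parseval[OF assms])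
  also have "\<dots> = real N * (\<Sum>i\<in>UNIV. \<Sum>l\<in>F. Re (cnj (c l $ i) * d l $ i))"
    by (simp only: Re_sum times_complex.sel complex_Re_of_nat complex_Im_of_nat
        mult_zero_left diff_zero sum_distrib_left)
  also have "\<dots> = real N * (\<Sum>l\<in>F. inner (c l) (d l))"
    unfolding eq by (subst sum.swap) simp
  finally show ?thesis .
qed

lemma gnorm_trig_sum:
  assumes "0 < N" "distinct_mod N F"
  shows "gnorm N (trig_sum N F c) = L2_set (\<lambda>l. norm (c l)) F"
proof -
  have "(\<Sum>j<N. (norm (trig_sum N F c j))\<^sup>2) = real N * (\<Sum>l\<in>F. (norm (c l))\<^sup>2)"
    unfolding power2_norm_eq_inner by (rule parseval_inner[OF assms])
  then show ?thesis using assms(1) by (simp add: gnorm_def L2_set_def real_sqrt_mult)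
qed

section \<open>The normalized discrete L2 norm\<close>

lemma gnorm_cong: "(\<And>j. j < M \<Longrightarrow> U j = V j) \<Longrightarrow> gnorm M U = gnorm M V"
  unfolding gnorm_def by (intro arg_cong2[where f="(/)"] L2_set_cong refl) auto

lemma gnorm_nonneg [simp]: "0 \<le> gnorm M U"
  by (simp add: gnorm_def)

lemma gnorm_mono: "(\<And>j. j < M \<Longrightarrow> norm (U j) \<le> norm (V j)) \<Longrightarrow> gnorm M U \<le> gnorm M V"
  unfolding gnorm_def by (intro divide_right_mono L2_set_mono) auto

lemma gnorm_triangle: "gnorm M (\<lambda>j. U j + V j) \<le> gnorm M U + gnorm M V"
proof -
  have "L2_set (\<lambda>j. norm (U j + V j)) {..<M} \<le> L2_set (\<lambda>j. norm (U j) + norm (V j)) {..<M}"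
    by (intro L2_set_mono norm_triangle_ineq) auto
  also have "\<dots> \<le> L2_set (\<lambda>j. norm (U j)) {..<M} + L2_set (\<lambda>j. norm (V j)) {..<M}"
    by (rule L2_set_triangle_ineq)
  finally show ?thesis unfolding gnorm_def add_divide_distrib[symmetric]
    by (intro divide_right_mono) auto
qed

lemma gnorm_scaleR: "gnorm M (\<lambda>j. r *\<^sub>R U j) = \<bar>r\<bar> * gnorm M U"
  by (simp add: gnorm_def L2_set_right_distrib)

lemma gnorm_uminus: "gnorm M (\<lambda>j. - U j) = gnorm M U"
  by (simp add: gnorm_def)

lemma gnorm_minus: "gnorm M (\<lambda>j. U j - V j) = gnorm M (\<lambda>j. V j - U j)"
  by (simp add: gnorm_def norm_minus_commute)

lemma gnorm_triangle_minus: "gnorm M (\<lambda>j. U j - V j) \<le> gnorm M U + gnorm M V"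
  using gnorm_triangle[of M U "\<lambda>j. - V j"] by (simp add: gnorm_uminus)

lemma gnorm_const_le:
  assumes "0 < M" "\<And>j. j < M \<Longrightarrow> norm (U j) \<le> c"
  shows "gnorm M U \<le> c"
proof -
  have c: "0 \<le> c" using assms(2)[of 0] assms(1) norm_ge_zero order_trans by blast
  have "L2_set (\<lambda>j. norm (U j)) {..<M} \<le> L2_set (\<lambda>j. c) {..<M}"
    using assms(2) by (intro L2_set_mono) auto
  also have "\<dots> = sqrt (real M) * c" using c by (simp add: L2_set_def real_sqrt_mult)
  finally show ?thesis using assms(1) by (simp add: gnorm_def field_simps)
qed

lemma gnorm_le_mult: "0 \<le> c \<Longrightarrow> (\<And>j. j < M \<Longrightarrow> norm (U j) \<le> c * norm (V j)) \<Longrightarrow> gnorm M U \<le> c * gnorm M V"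
  using gnorm_mono[of M U "\<lambda>j. c *\<^sub>R V j"] by (simp add: gnorm_scaleR)

lemma gnorm_sum: "gnorm M (\<lambda>j. \<Sum>p\<in>P. U p j) \<le> (\<Sum>p\<in>P. gnorm M (U p))"
proof (induction P rule: infinite_finite_induct)
  case (insert p P)
  then show ?case using gnorm_triangle[of M "U p" "\<lambda>j. \<Sum>p\<in>P. U p j"] by simp
qed (simp_all add: gnorm_def L2_set_def)

lemma gnorm_power2: "0 < M \<Longrightarrow> (gnorm M U)\<^sup>2 = (\<Sum>j<M. (norm (U j))\<^sup>2) / real M"
  by (simp add: gnorm_def power_divide L2_set_def real_sqrt_pow2 sum_nonneg)

lemma gnorm_inner_le: "0 < M \<Longrightarrow> (\<Sum>j<M. inner (U j) (V j)) / real M \<le> gnorm M U * gnorm M V"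
proof -
  assume M: "0 < M"
  have "(\<Sum>j<M. inner (U j) (V j)) \<le> (\<Sum>j<M. \<bar>norm (U j)\<bar> * \<bar>norm (V j)\<bar>)"
    by (intro sum_mono) (simp add: norm_cauchy_schwarz)
  also have "\<dots> \<le> L2_set (\<lambda>j. norm (U j)) {..<M} * L2_set (\<lambda>j. norm (V j)) {..<M}"
    by (rule L2_set_mult_ineq)
  finally show ?thesis using M by (simp add: gnorm_def divide_right_mono)
qed

text \<open>Two elements of \<open>modes M\<close> differ by less than M, hence by less than N, and
  the shift \<open>p\<close> cancels in the difference.\<close>

lemma distinct_mod_modes:
  assumes "0 < M" "even M" "M \<le> N"
  shows "distinct_mod N ((\<lambda>l. l + p) ` modes M)"
proof -
  have "l = l'" if "l \<in> modes M" "l' \<in> modes M" "int N dvd (l + p) - (l' + p)" for l l'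
  proof (rule ccontr)
    assume "l \<noteq> l'"
    have "int N \<le> \<bar>l - l'\<bar>" using dvd_imp_le_int[of "l - l'" "int N"] that(3) \<open>l \<noteq> l'\<close> by simp
    moreover have "\<bar>l - l'\<bar> < int M"
      using that(1,2) assms(1,2) by (auto simp: modes_def elim!: evenE)
    ultimately show False using assms by simp
  qed
  moreover have "finite (modes M)" by (simp add: modes_def)
  ultimately show ?thesis unfolding distinct_mod_def by blast
qed

lemma distinct_mod_modes0: "0 < M \<Longrightarrow> even M \<Longrightarrow> M \<le> N \<Longrightarrow> distinct_mod N (modes M)"
  using distinct_mod_modes[of M N 0] by simp

section \<open>The transform, the interpolant and the free flow in terms of roots of unity\<close>

lemma mu_node:
  assumes "a < b" "0 < M"
  shows "mu a b l * (node a b M j - a) = 2 * pi * of_int (l * int j) / real M"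
  using assms by (simp add: mu_def node_def mesh_def field_simps)

lemma dft_omega:
  assumes "a < b" "0 < M"
  shows "dft a b M U l = (1 / of_nat M) *s (\<Sum>j<M. omega M (- (l * int j)) *s U j)"
proof -
  have "exp (- \<i> * of_real (mu a b l * (node a b M j - a))) = omega M (- (l * int j))" for j
    by (simp add: omega_def cis_conv_exp mu_node[OF assms])
  then show ?thesis by (simp add: dft_def)
qed

lemma exp_node_omega:
  assumes "a < b" "0 < M"
  shows "exp (\<i> * of_real (mu a b l * (node a b M j - a))) = omega M (l * int j)"
  by (simp add: omega_def cis_conv_exp mu_node[OF assms])

lemma interpolant_node:
  assumes "a < b" "0 < N"
  shows "interpolant a b M U (node a b N j) = trig_sum N (modes M) (dft a b M U) j"
  unfolding interpolant_def trig_sum_def by (simp only: exp_node_omega[OF assms])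

lemma free_flow_trig_sum:
  assumes "a < b" "0 < M"
  shows "free_flow \<epsilon> a b M s U = trig_sum M (modes M) (\<lambda>l.
    mexp (of_real s *m ((- \<i> * of_real (mu a b l)) *m sigma1 - (\<i> / of_real \<epsilon>) *m sigma3))
      *v dft a b M U l)"
  unfolding free_flow_def trig_sum_def by (intro ext) (simp only: exp_node_omega[OF assms])

lemma dft_nth:
  assumes "a < b" "0 < M"
  shows "dft a b M U l $ i = (\<Sum>j<M. omega M (- (l * int j)) * U j $ i) / of_nat M"
  unfolding dft_omega[OF assms] by simp

lemma dft_cong: "(\<And>j. j < M \<Longrightarrow> U j = V j) \<Longrightarrow> dft a b M U l = dft a b M V l"
  by (simp add: dft_def)

text \<open>A coefficient is the pairing of the sum with one character, and that character is itself
  a trigonometric sum whose coefficients are concentrated at \<open>l\<close>; Parseval then reads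
  off \<open>c l\<close>.\<close>

lemma dft_trig_sum:
  assumes "a < b" "0 < M" "distinct_mod M F" "l \<in> F"
  shows "dft a b M (trig_sum M F c) l = c l"
proof -
  have fin: "finite F" using assms by (simp add: distinct_mod_def)
  have "(\<Sum>j<M. omega M (- (l * int j)) * (\<Sum>l'\<in>F. omega M (l' * int j) * c l' $ i)) = of_nat M * c l $ i" for i
  proof -
    have "(\<Sum>j<M. omega M (- (l * int j)) * (\<Sum>l'\<in>F. omega M (l' * int j) * c l' $ i))
      = (\<Sum>j<M. cnj (\<Sum>l'\<in>F. omega M (l' * int j) * (if l' = l then 1 else 0))
          * (\<Sum>l'\<in>F. omega M (l' * int j) * c l' $ i))"
      using fin assms(4) by (simp add: cnj_omega if_distrib cong: if_cong)
    also have "\<dots> = of_nat M * (\<Sum>l'\<in>F. cnj (if l' = l then 1 else 0) * c l' $ i)"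
      by (rule scalar_parseval[OF assms(2,3)])
    also have "\<dots> = of_nat M * c l $ i"
      using fin assms(4) by (simp add: if_distrib if_distribR cong: if_cong)
    finally show ?thesis .
  qed
  then show ?thesis using assms(2) by (simp add: vec_eq_iff dft_nth[OF assms(1,2)] trig_sum_nth)
qed

text \<open>Shifting the centred modes by M / 2 gives a geometric sum over 0, ..., M - 1. The phase
  produced by the shift is 1 whenever that sum does not vanish.\<close>

lemma sum_modes_omega:
  assumes "0 < M" "even M"
  shows "(\<Sum>l\<in>modes M. omega M (l * k)) = (if int M dvd k then of_nat M else 0)"
proof -
  have "(\<Sum>l\<in>modes M. omega M (l * k)) = (\<Sum>j<M. omega M ((int j - int M div 2) * k))"
  proof (rule sum.reindex_bij_witness[where i="\<lambda>j. int j - int M div 2" and j="\<lambda>l. nat (l + int M div 2)"])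
    fix j assume "j \<in> {..<M}"
    then show "int j - int M div 2 \<in> modes M" using assms by (auto simp: modes_def elim!: evenE)
  qed (use assms in \<open>auto simp: modes_def elim!: evenE\<close>)
  also have "\<dots> = omega M (- (int M div 2) * k) * (\<Sum>j<M. omega M (k * int j))"
    unfolding sum_distrib_left omega_add[symmetric] by (simp add: algebra_simps)
  also have "\<dots> = (if int M dvd k then of_nat M else 0)"
  proof (cases "int M dvd k")
    case True
    then have "int M dvd - (int M div 2) * k" by simp
    then have "omega M (- (int M div 2) * k) = 1" using omega_eq_1_iff[OF assms(1)] by blast
    with True show ?thesis by (simp add: sum_omega[OF assms(1)])
  qed (simp add: sum_omega[OF assms(1)])
  finally show ?thesis .
qed

lemma dft_inversion:
  assumes "a < b" "0 < M" "even M" "j < M"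
  shows "trig_sum M (modes M) (dft a b M U) j = U j"
proof -
  have "(\<Sum>l\<in>modes M. omega M (l * int j) * (\<Sum>j'<M. omega M (- (l * int j')) * U j' $ i))
      = of_nat M * U j $ i" for i
  proof -
    have "(\<Sum>l\<in>modes M. omega M (l * int j) * (\<Sum>j'<M. omega M (- (l * int j')) * U j' $ i))
      = (\<Sum>j'<M. (\<Sum>l\<in>modes M. omega M (l * (int j - int j'))) * U j' $ i)"
    proof -
      have "omega M (l * int j) * (omega M (- (l * int j')) * U j' $ i)
          = omega M (l * (int j - int j')) * U j' $ i" for l j'
        using omega_add[of M "l * int j" "- (l * int j')"] by (simp add: right_diff_distrib)
      then show ?thesis
        unfolding sum_distrib_left sum_distrib_right by (subst sum.swap) (simp only:)
    qed
    also have "\<dots> = (\<Sum>j'<M. if j' = j then of_nat M * U j' $ i else 0)"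
    proof (intro sum.cong refl)
      fix j' assume "j' \<in> {..<M}"
      have "int M dvd int j - int j' \<longleftrightarrow> j' = j"
      proof
        assume d: "int M dvd int j - int j'"
        show "j' = j"
        proof (rule ccontr)
          assume "j' \<noteq> j"
          then have "int M \<le> \<bar>int j - int j'\<bar>" using dvd_imp_le_int[of "int j - int j'" "int M"] d by simp
          then show False using \<open>j' \<in> {..<M}\<close> assms(4) by simp
        qed
      qed simp
      then show "(\<Sum>l\<in>modes M. omega M (l * (int j - int j'))) * U j' $ i
          = (if j' = j then of_nat M * U j' $ i else 0)"
        by (simp add: sum_modes_omega[OF assms(2,3)])
    qed
    also have "\<dots> = of_nat M * U j $ i" using assms(4) by simp
    finally show ?thesis .
  qed
  then show ?thesis using assms(2)
    by (simp add: vec_eq_iff dft_nth[OF assms(1,2)] trig_sum_nth sum_divide_distrib[symmetric])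
qed

lemma gnorm_dft:
  assumes "a < b" "0 < M" "even M"
  shows "gnorm M U = L2_set (\<lambda>l. norm (dft a b M U l)) (modes M)"
proof -
  have "gnorm M U = gnorm M (trig_sum M (modes M) (dft a b M U))"
    by (rule gnorm_cong) (simp add: dft_inversion[OF assms])
  also have "\<dots> = L2_set (\<lambda>l. norm (dft a b M U l)) (modes M)"
    by (rule gnorm_trig_sum) (use assms distinct_mod_modes0 in auto)
  finally show ?thesis .
qed

section \<open>Size of the symbol of the forward difference\<close>

lemma half_le_sin:
  fixes x :: real
  assumes "0 \<le> x" "x \<le> pi / 2"
  shows "x / 2 \<le> sin x"
proof (cases "x \<le> pi / 3")
  case True
  have "sin 0 - 0 / 2 \<le> sin x - x / 2"
  proof (rule DERIV_nonneg_imp_nondecreasing[OF assms(1)])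
    fix y assume y: "0 \<le> y" "y \<le> x"
    have "((\<lambda>x. sin x - x / 2) has_real_derivative cos y - 1 / 2) (at y)"
      by (auto intro!: derivative_eq_intros)
    moreover have "cos (pi / 3) \<le> cos y" using y True by (intro cos_monotone_0_pi_le) auto
    ultimately show "\<exists>z. ((\<lambda>x. sin x - x / 2) has_real_derivative z) (at y) \<and> 0 \<le> z"
      by (intro exI[of _ "cos y - 1 / 2"]) (simp add: cos_60)
  qed
  then show ?thesis by simp
next
  case False
  \<comment> \<open>Beyond pi / 3 monotonicity is enough: there the sine is at least sqrt 3 / 2, and
    4 / 5 separates this from pi / 4.\<close>
  have "x / 2 \<le> pi / 4" using assms by simp
  also have "\<dots> \<le> 4 / 5" using pi_less_4 pi_approx by simp
  also have "\<dots> \<le> sqrt 3 / 2" by (rule power2_le_imp_le) (auto simp: power_divide power2_eq_square)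
  also have "\<dots> = sin (pi / 3)" by (simp add: sin_60)
  also have "\<dots> \<le> sin x" using False assms by (intro sin_monotone_2pi_le) auto
  finally show ?thesis .
qed

lemma norm_cis_minus_1: "cmod (cis \<theta> - 1) = 2 * \<bar>sin (\<theta> / 2)\<bar>"
proof -
  have "(cmod (cis \<theta> - 1))\<^sup>2 = (cos \<theta> - 1)\<^sup>2 + (sin \<theta>)\<^sup>2"
    by (simp add: cmod_def)
  also have "\<dots> = 2 - 2 * cos \<theta>"
    using sin_cos_squared_add[of \<theta>] by (simp add: power2_eq_square algebra_simps)
  also have "\<dots> = (2 * \<bar>sin (\<theta> / 2)\<bar>)\<^sup>2"
    using cos_double_sin[of "\<theta> / 2"] by (simp add: power_mult_distrib)
  finally show ?thesis by (rule power2_eq_imp_eq) auto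
qed

lemma omega_minus_1_le: "cmod (omega N l - 1) \<le> 2 * pi * \<bar>of_int l\<bar> / real N"
  using abs_sin_x_le_abs_x[of "pi * of_int l / real N"]
  by (simp add: omega_def norm_cis_minus_1 abs_mult)

text \<open>The condition on \<open>l\<close> keeps the half angle pi l / N within a quarter turn,
  where sin x >= x / 2. The result is half of the upper bound \<open>omega_minus_1_le\<close>; this
  quotient is the source of the factors 2 in \<open>projection_smooth\<close> and
  \<open>sobolev_Aop\<close>.\<close>

lemma omega_minus_1_ge:
  assumes "0 < N" "2 * \<bar>l\<bar> \<le> int N"
  shows "pi * \<bar>of_int l\<bar> / real N \<le> cmod (omega N l - 1)"
proof -
  have "2 * real_of_int \<bar>l\<bar> \<le> real N" using assms(2) by linarith
  then have "pi * real_of_int \<bar>l\<bar> / real N / 2 \<le> sin (pi * real_of_int \<bar>l\<bar> / real N)"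
    using assms(1) by (intro half_le_sin) (auto simp: field_simps)
  also have "\<dots> \<le> \<bar>sin (pi * of_int l / real N)\<bar>"
    by (cases "0 \<le> l") (auto simp: abs_if)
  finally show ?thesis by (simp add: omega_def norm_cis_minus_1)
qed

section \<open>Truncation of the Fourier modes\<close>

definition gdiff :: "(nat \<Rightarrow> 'a::ab_group_add) \<Rightarrow> nat \<Rightarrow> 'a" where
  "gdiff U j = U (Suc j) - U j"

definition gperiodic :: "nat \<Rightarrow> (nat \<Rightarrow> 'a) \<Rightarrow> bool" where
  "gperiodic N U \<longleftrightarrow> (\<forall>j. U (j + N) = U j)"

lemma gperiodic_gdiff: "gperiodic N U \<Longrightarrow> gperiodic N (gdiff U)"
  by (simp add: gperiodic_def gdiff_def) (metis add_Suc)

lemma gperiodic_gdiff_pow: "gperiodic N U \<Longrightarrow> gperiodic N ((gdiff ^^ k) U)"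
  by (induction k) (simp_all add: gperiodic_gdiff)

lemma sum_shift_periodic:
  fixes U :: "nat \<Rightarrow> 'a::ab_group_add"
  assumes "gperiodic N U" shows "(\<Sum>j<N. U (Suc j)) = (\<Sum>j<N. U j)"
proof -
  have "(\<Sum>j<N. U (Suc j)) - (\<Sum>j<N. U j) = U N - U 0"
    unfolding sum_subtractf[symmetric] by (rule sum_lessThan_telescope)
  then show ?thesis using assms by (simp add: gperiodic_def) (metis add_0 diff_self eq_iff_diff_eq_0)
qed

lemma omega_periodic: "0 < N \<Longrightarrow> omega N (l * int (j + N)) = omega N (l * int j)"
  using omega_eq_1_iff[of N "l * int N"] by (simp add: omega_add distrib_left)

lemma gperiodic_trig_sum: "0 < N \<Longrightarrow> gperiodic N (trig_sum N F c)"
  by (simp add: gperiodic_def trig_sum_def omega_periodic del: of_nat_add)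

lemma gnorm_shift:
  assumes "gperiodic N U" shows "gnorm N (\<lambda>j. U (Suc j)) = gnorm N U"
proof -
  have "(\<Sum>j<N. (norm (U (Suc j)))\<^sup>2) = (\<Sum>j<N. (norm (U j))\<^sup>2)"
    using assms by (intro sum_shift_periodic) (simp add: gperiodic_def)
  then show ?thesis by (simp add: gnorm_def L2_set_def)
qed

text \<open>Periodicity allows the summation index to be shifted by one, which multiplies the
  coefficient by \<open>omega N l\<close>.\<close>

lemma dft_gdiff:
  assumes "a < b" "0 < N" "gperiodic N U"
  shows "dft a b N (gdiff U) l = (omega N l - 1) *s dft a b N U l"
proof -
  have "(\<Sum>j<N. omega N (- (l * int j)) * gdiff U j $ i) = (omega N l - 1) * (\<Sum>j<N. omega N (- (l * int j)) * U j $ i)" for i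
  proof -
    have "(\<Sum>j<N. omega N (- (l * int (Suc j))) * U (Suc j) $ i) = (\<Sum>j<N. omega N (- (l * int j)) * U j $ i)"
    proof (rule sum_shift_periodic)
      show "gperiodic N (\<lambda>j. omega N (- (l * int j)) * U j $ i)"
        using assms(3) omega_periodic[OF assms(2), of "- l"] by (simp add: gperiodic_def del: of_nat_add)
    qed
    moreover have shift: "omega N (- (l * int j)) = omega N l * omega N (- (l * int (Suc j)))" for j
      by (simp add: omega_add[symmetric] algebra_simps)
    have "(\<Sum>j<N. omega N (- (l * int j)) * U (Suc j) $ i)
        = omega N l * (\<Sum>j<N. omega N (- (l * int (Suc j))) * U (Suc j) $ i)"
      unfolding sum_distrib_left by (intro sum.cong refl, subst shift) (rule mult.assoc)
    ultimately show ?thesis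
      by (simp add: gdiff_def right_diff_distrib sum_subtractf left_diff_distrib)
  qed
  then show ?thesis unfolding vec_eq_iff vector_smult_component dft_nth[OF assms(1,2)] by simp
qed

lemma dft_gdiff_pow:
  assumes "a < b" "0 < N" "gperiodic N U"
  shows "dft a b N ((gdiff ^^ k) U) l = (omega N l - 1) ^ k *s dft a b N U l"
  by (induction k)
     (simp_all add: dft_gdiff[OF assms(1,2) gperiodic_gdiff_pow[OF assms(3)]] vec_eq_iff algebra_simps)

lemma gnorm_gdiff_pow:
  assumes "a < b" "0 < N" "even N" "gperiodic N U"
  shows "gnorm N ((gdiff ^^ k) U) = L2_set (\<lambda>l. cmod (omega N l - 1) ^ k * norm (dft a b N U l)) (modes N)"
  by (simp add: gnorm_dft[OF assms(1-3)] dft_gdiff_pow[OF assms(1,2,4)] norm_power)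

text \<open>For odd K the modes of the fine grid are centred like those of the coarse one and split
  into the translates of \<open>modes M\<close> by p M with p from -Q to Q. Block and position of a
  frequency are the quotient and the remainder of its shift by M / 2 on division by M.\<close>

lemma sum_modes_blocks:
  assumes "even M" "0 < M" and K: "K = 2 * Q + 1"
  shows "(\<Sum>l\<in>modes (K * M). g l) = (\<Sum>p\<in>{- int Q..int Q}. \<Sum>l\<in>modes M. g (l + p * int M))"
proof -
  obtain m where M: "M = 2 * m" using assms(1) by (auto elim: evenE)
  have m: "0 < int m" and M2: "int M = 2 * int m" using M assms(2) by simp_all
  have KM: "int (K * M) div 2 = int K * int m" by (simp add: M)
  have in_modes: "l \<in> modes M \<longleftrightarrow> - int m \<le> l \<and> l < int m" for l by (auto simp: modes_def M)
  have in_modesK: "l \<in> modes (K * M) \<longleftrightarrow> - (int K * int m) \<le> l \<and> l < int K * int m" for l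
    unfolding modes_def KM by auto
  have "(\<Sum>(p, l)\<in>{- int Q..int Q} \<times> modes M. g (l + p * int M)) = (\<Sum>l\<in>modes (K * M). g l)"
  proof (rule sum.reindex_bij_witness[where j="\<lambda>(p, l). l + p * int M"
        and i="\<lambda>l. ((l + int m) div int M, (l + int m) mod int M - int m)"])
    fix x :: "int \<times> int" assume "x \<in> {- int Q..int Q} \<times> modes M"
    then obtain p l where x: "x = (p, l)" "- int Q \<le> p" "p \<le> int Q" "- int m \<le> l" "l < int m"
      by (auto simp: in_modes)
    have dm: "(l + p * int M + int m) div int M = p" "(l + p * int M + int m) mod int M = l + int m"
      using x(4,5) m int_div_pos_eq[of "l + p * int M + int m" "int M" p "l + int m"]
        int_mod_pos_eq[of "l + p * int M + int m" "int M" p "l + int m"]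
      by (simp_all add: M)
    show "(\<lambda>l. ((l + int m) div int M, (l + int m) mod int M - int m)) ((\<lambda>(p, l). l + p * int M) x) = x"
      by (simp add: x dm)
    have "p * int m \<le> int Q * int m" "- int Q * int m \<le> p * int m"
      using x by (intro mult_right_mono; simp)+
    moreover have "p * int M = 2 * (p * int m)" "int K * int m = 2 * (int Q * int m) + int m"
      by (simp_all add: K M algebra_simps)
    ultimately show "(case x of (p, l) \<Rightarrow> l + p * int M) \<in> modes (K * M)"
      using x(4,5) unfolding x(1) prod.case in_modesK by linarith
  next
    fix l assume "l \<in> modes (K * M)"
    then have l: "- (int K * int m) \<le> l" "l < int K * int m" by (simp_all add: in_modesK)
    have 1: "- int Q \<le> (l + int m) div int M"
    proof -
      have "(- int Q * int M) div int M \<le> (l + int m) div int M"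
        using l m by (intro zdiv_mono1) (auto simp: K M algebra_simps)
      moreover have "(- int Q * int M) div int M = - int Q"
        by (rule nonzero_mult_div_cancel_right) (use assms(2) in simp)
      ultimately show ?thesis by simp
    qed
    have 2: "(l + int m) div int M < int Q + 1"
    proof (rule ccontr)
      assume "\<not> (l + int m) div int M < int Q + 1"
      then have "(int Q + 1) * int M \<le> (l + int m) div int M * int M"
        by (intro mult_right_mono) auto
      also have "\<dots> \<le> l + int m"
        using div_mult_mod_eq[of "l + int m" "int M"] pos_mod_sign[of "int M" "l + int m"] assms(2)
        by linarith
      finally have "(int Q + 1) * int M \<le> l + int m" .
      moreover have "(int Q + 1) * int M = int K * int m + int m" by (simp add: K M algebra_simps)
      ultimately show False using l(2) by linarith
    qed
    have "0 \<le> (l + int m) mod int M" "(l + int m) mod int M < int M" using m M by auto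
    then show "((l + int m) div int M, (l + int m) mod int M - int m) \<in> {- int Q..int Q} \<times> modes M"
      using 1 2 M2 by (intro SigmaI; simp only: atLeastAtMost_iff in_modes) linarith+
    show "(\<lambda>(p, l). l + p * int M) ((l + int m) div int M, (l + int m) mod int M - int m) = l"
      unfolding prod.case using div_mult_mod_eq[of "l + int m" "int M"] by linarith
  qed auto
  then show ?thesis by (simp add: sum.cartesian_product)
qed

lemma block_subset:
  assumes "even M" "0 < M" "K = 2 * Q + 1" "p \<in> {- int Q..int Q}" "l \<in> modes M"
  shows "l + p * int M \<in> modes (K * M)"
proof -
  obtain m where M: "M = 2 * m" using assms(1) by (auto elim: evenE)
  have "p * int m \<le> int Q * int m" "- int Q * int m \<le> p * int m"
    using assms(4) by (intro mult_right_mono; simp)+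
  moreover have "p * int M = 2 * (p * int m)" "int K * int m = 2 * (int Q * int m) + int m"
    by (simp_all add: assms(3) M algebra_simps)
  moreover have "int (K * M) div 2 = int K * int m" "int M div 2 = int m" by (simp_all add: M)
  ultimately show ?thesis using assms(5) unfolding modes_def atLeastAtMost_iff by linarith
qed

text \<open>The induction carries the sharper bound 4 - 2 / (Q + 1), since 1 / (q + 1)^2 <= 1 / q -
  1 / (q + 1) telescopes.\<close>

lemma sum_inverse_squares_le: "(\<Sum>p\<in>{- int Q..int Q} - {0}. 1 / (of_int p)\<^sup>2 :: real) \<le> 4"
proof -
  have "(\<Sum>p\<in>{- int (Suc Q)..int (Suc Q)} - {0}. 1 / (of_int p)\<^sup>2 :: real) \<le> 4 - 2 / real (Suc Q)" for Q
  proof (induction Q)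
    case 0
    have "{- int (Suc 0)..int (Suc 0)} - {0} = {-1, 1}" by auto
    then show ?case by simp
  next
    case (Suc Q)
    have *: "{- int (Suc (Suc Q))..int (Suc (Suc Q))} - {0}
        = insert (int (Suc (Suc Q))) (insert (- int (Suc (Suc Q))) ({- int (Suc Q)..int (Suc Q)} - {0}))"
      by auto
    have "(\<Sum>p\<in>{- int (Suc (Suc Q))..int (Suc (Suc Q))} - {0}. 1 / (of_int p)\<^sup>2 :: real)
      = 2 / (real (Suc (Suc Q)))\<^sup>2 + (\<Sum>p\<in>{- int (Suc Q)..int (Suc Q)} - {0}. 1 / (of_int p)\<^sup>2)"
      unfolding * by (subst sum.insert, simp, simp, subst sum.insert) (auto simp: power2_eq_square algebra_simps)
    also have "\<dots> \<le> 2 / (real (Suc (Suc Q)))\<^sup>2 + (4 - 2 / real (Suc Q))" using Suc by simp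
    also have "\<dots> \<le> 4 - 2 / real (Suc (Suc Q))"
    proof -
      have "2 / (real (Suc (Suc Q)))\<^sup>2 \<le> 2 / (real (Suc Q) * real (Suc (Suc Q)))"
        unfolding power2_eq_square by (intro divide_left_mono mult_right_mono) auto
      also have "\<dots> = 2 / real (Suc Q) - 2 / real (Suc (Suc Q))" by (simp add: field_simps)
      finally show ?thesis by simp
    qed
    finally show ?case .
  qed
  then have "(\<Sum>p\<in>{- int (Suc Q)..int (Suc Q)} - {0}. 1 / (of_int p)\<^sup>2 :: real) \<le> 4" for Q
    by (smt (verit) divide_nonneg_nonneg of_nat_0_le_iff)
  then show ?thesis by (cases Q) auto
qed

text \<open>Frequencies in block p have size at least |p| M / 2, so there the symbol of the fine
  difference is at least |p| / K. Dividing by its m-th power gains (K / |p|)^m, and m >= 2 makes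
  this at most K^m / p^2, which can be summed over the blocks.\<close>

lemma block_bound:
  assumes "a < b" "even M" "0 < M" "K = 2 * Q + 1" "gperiodic (K * M) U" "2 \<le> m"
    and p: "p \<in> {- int Q..int Q} - {0}"
  shows "L2_set (\<lambda>l. norm (dft a b (K * M) U (l + p * int M))) (modes M)
    \<le> 1 / (of_int p)\<^sup>2 * (real K ^ m * gnorm (K * M) ((gdiff ^^ m) U))"
proof -
  let ?N = "K * M"
  let ?u = "dft a b ?N U"
  let ?g = "\<lambda>l. cmod (omega ?N l - 1) ^ m * norm (?u l)"
  have K: "0 < K" and N: "0 < ?N" "even ?N" using assms by auto
  have p1: "1 \<le> \<bar>real_of_int p\<bar>" using p by (simp add: abs_if)
  have "norm (?u (l + p * int M)) \<le> (real K / \<bar>of_int p\<bar>) ^ m * ?g (l + p * int M)"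
    if l: "l \<in> modes M" for l
  proof -
    let ?l = "l + p * int M"
    have "?l \<in> modes ?N" using block_subset[OF assms(2-4)] p l by auto
    then have "2 * \<bar>?l\<bar> \<le> int ?N" unfolding modes_def using N(2) by auto
    then have "pi * \<bar>of_int ?l\<bar> / real ?N \<le> cmod (omega ?N ?l - 1)" by (rule omega_minus_1_ge[OF N(1)])
    moreover have "\<bar>real_of_int p\<bar> / real K \<le> pi * \<bar>of_int ?l\<bar> / real ?N"
    proof -
      have "2 * \<bar>l\<bar> \<le> int M" using l assms(2) unfolding modes_def by auto
      then have "2 * \<bar>l\<bar> \<le> \<bar>p\<bar> * int M" using mult_right_mono[of 1 "\<bar>p\<bar>" "int M"] p by force
      moreover have "\<bar>p\<bar> * int M \<le> \<bar>?l\<bar> + \<bar>l\<bar>" using abs_triangle_ineq4[of ?l l] by (simp add: abs_mult)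
      moreover have "A \<le> 2 * x" if "2 * y \<le> A" "A \<le> x + y" for A x y :: int
        using that by linarith
      ultimately have "\<bar>p\<bar> * int M \<le> 2 * \<bar>?l\<bar>" by blast
      then have "real_of_int (\<bar>p\<bar> * int M) \<le> real_of_int (2 * \<bar>?l\<bar>)" by (simp only: of_int_le_iff)
      then have "\<bar>real_of_int p\<bar> * real M \<le> 2 * \<bar>of_int ?l\<bar>" by simp
      also have "\<dots> \<le> pi * \<bar>of_int ?l\<bar>" using pi_ge_two by (intro mult_right_mono) auto
      finally show ?thesis using K assms(3) by (simp add: field_simps)
    qed
    ultimately have "\<bar>real_of_int p\<bar> / real K \<le> cmod (omega ?N ?l - 1)" by (rule order_trans[rotated])
    then have "1 \<le> real K / \<bar>of_int p\<bar> * cmod (omega ?N ?l - 1)"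
      using K p1 by (simp add: field_simps)
    then have "1 \<le> (real K / \<bar>of_int p\<bar> * cmod (omega ?N ?l - 1)) ^ m" by (rule one_le_power)
    from mult_right_mono[OF this norm_ge_zero[of "?u ?l"]] show ?thesis
      by (simp add: power_mult_distrib power_divide mult_ac)
  qed
  then have "L2_set (\<lambda>l. norm (?u (l + p * int M))) (modes M)
      \<le> L2_set (\<lambda>l. (real K / \<bar>of_int p\<bar>) ^ m * ?g (l + p * int M)) (modes M)"
    by (intro L2_set_mono) auto
  also have "\<dots> = (real K / \<bar>of_int p\<bar>) ^ m * L2_set (\<lambda>l. ?g (l + p * int M)) (modes M)"
    by (simp add: L2_set_right_distrib)
  also have "L2_set (\<lambda>l. ?g (l + p * int M)) (modes M) \<le> L2_set ?g (modes ?N)"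
  proof -
    have "(\<Sum>l\<in>modes M. (?g (l + p * int M))\<^sup>2) = (\<Sum>l\<in>(\<lambda>l. l + p * int M) ` modes M. (?g l)\<^sup>2)"
      by (subst sum.reindex) (auto simp: inj_on_def)
    also have "\<dots> \<le> (\<Sum>l\<in>modes ?N. (?g l)\<^sup>2)"
      using block_subset[OF assms(2-4)] p by (intro sum_mono2) (auto simp: modes_def[of "K*M"])
    finally show ?thesis unfolding L2_set_def by simp
  qed
  also have "L2_set ?g (modes ?N) = gnorm ?N ((gdiff ^^ m) U)"
    by (rule gnorm_gdiff_pow[OF assms(1) N assms(5), symmetric])
  also have "(real K / \<bar>of_int p\<bar>) ^ m * gnorm ?N ((gdiff ^^ m) U)
      \<le> real K ^ m / (of_int p)\<^sup>2 * gnorm ?N ((gdiff ^^ m) U)"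
  proof (intro mult_right_mono)
    have "\<bar>real_of_int p\<bar>\<^sup>2 \<le> \<bar>of_int p\<bar> ^ m" using p1 assms(6) by (intro power_increasing) auto
    then show "(real K / \<bar>of_int p\<bar>) ^ m \<le> real K ^ m / (of_int p)\<^sup>2"
      unfolding power_divide using p1 by (intro divide_left_mono) auto
  qed auto
  finally show ?thesis by (simp add: mult_left_mono)
qed

text \<open>Inversion on the fine grid shows that the remainder is the sum of all blocks except p =
  0. On either grid one block has the norm of its coefficients: on the fine grid because shifted
  frequencies stay distinct, on the coarse grid because the block aliases onto
  \<open>modes M\<close>. Blocks aliasing onto the same modes are not orthogonal to each other, so
  they are added by the triangle inequality; the constant 4 bounds the sum of 1 / p^2.\<close>

lemma truncation:
  assumes "a < b" "even M" "0 < M" "K = 2 * Q + 1" "gperiodic (K * M) U" "2 \<le> m"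
  shows truncation_fine: "gnorm (K * M) (\<lambda>i. U i - trig_sum (K * M) (modes M) (dft a b (K * M) U) i)
      \<le> 4 * (real K ^ m * gnorm (K * M) ((gdiff ^^ m) U))"
    and truncation_coarse: "gnorm M (\<lambda>j. U (K * j) - trig_sum M (modes M) (dft a b (K * M) U) j)
      \<le> 4 * (real K ^ m * gnorm (K * M) ((gdiff ^^ m) U))"
proof -
  let ?N = "K * M"
  let ?u = "dft a b ?N U"
  let ?P = "{- int Q..int Q}"
  let ?B = "real K ^ m * gnorm ?N ((gdiff ^^ m) U)"
  have K: "0 < K" and N: "0 < ?N" "even ?N" "M \<le> ?N" using assms by auto
  let ?V = "\<lambda>p. trig_sum ?N ((\<lambda>l. l + p * int M) ` modes M) ?u"
  have V: "?V p i = (\<Sum>l\<in>modes M. omega ?N ((l + p * int M) * int i) *s ?u (l + p * int M))" for p i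
    unfolding trig_sum_def by (subst sum.reindex) (auto simp: inj_on_def)
  have V0: "?V 0 i = trig_sum ?N (modes M) ?u i" for i by simp
  have U: "U i - trig_sum ?N (modes M) ?u i = (\<Sum>p\<in>?P - {0}. ?V p i)" if "i < ?N" for i
  proof -
    have "U i = trig_sum ?N (modes ?N) ?u i" using dft_inversion[OF assms(1) N(1,2) that] by simp
    also have "\<dots> = (\<Sum>p\<in>?P. ?V p i)"
      unfolding V unfolding trig_sum_def by (rule sum_modes_blocks[OF assms(2-4)])
    also have "\<dots> = ?V 0 i + (\<Sum>p\<in>?P - {0}. ?V p i)" by (rule sum.remove) auto
    finally show ?thesis unfolding V0 by simp
  qed
  have sum_le: "(\<Sum>p\<in>?P - {0}. L2_set (\<lambda>l. norm (?u (l + p * int M))) (modes M)) \<le> 4 * ?B"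
  proof -
    have "(\<Sum>p\<in>?P - {0}. L2_set (\<lambda>l. norm (?u (l + p * int M))) (modes M))
        \<le> (\<Sum>p\<in>?P - {0}. 1 / (of_int p)\<^sup>2 * ?B)"
      by (intro sum_mono block_bound[OF assms])
    also have "\<dots> \<le> 4 * ?B" unfolding sum_distrib_right[symmetric]
      by (intro mult_right_mono sum_inverse_squares_le) auto
    finally show ?thesis .
  qed
  have "gnorm ?N (\<lambda>i. U i - trig_sum ?N (modes M) ?u i) = gnorm ?N (\<lambda>i. \<Sum>p\<in>?P - {0}. ?V p i)"
    by (rule gnorm_cong) (rule U)
  also have "\<dots> \<le> (\<Sum>p\<in>?P - {0}. gnorm ?N (?V p))" by (rule gnorm_sum)
  also have "\<dots> = (\<Sum>p\<in>?P - {0}. L2_set (\<lambda>l. norm (?u (l + p * int M))) (modes M))"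
  proof (rule sum.cong[OF refl])
    fix p
    have "gnorm ?N (?V p) = L2_set (\<lambda>l. norm (?u l)) ((\<lambda>l. l + p * int M) ` modes M)"
      by (intro gnorm_trig_sum distinct_mod_modes N assms)
    also have "\<dots> = L2_set (\<lambda>l. norm (?u (l + p * int M))) (modes M)"
      unfolding L2_set_def by (subst sum.reindex) (auto simp: inj_on_def)
    finally show "gnorm ?N (?V p) = L2_set (\<lambda>l. norm (?u (l + p * int M))) (modes M)" .
  qed
  finally show "gnorm ?N (\<lambda>i. U i - trig_sum ?N (modes M) ?u i) \<le> 4 * ?B" using sum_le by simp
  \<comment> \<open>Aliasing: at the nodes shared with the coarse grid a shift of the frequency by p
    M is invisible.\<close>
  have omK: "omega ?N ((l + p * int M) * int (K * j)) = omega M (l * int j)" for l p j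
  proof -
    have "omega ?N ((l + p * int M) * int (K * j)) = omega ?N (int K * ((l + p * int M) * int j))"
      by (simp add: mult_ac)
    also have "\<dots> = omega M ((l + p * int M) * int j)" by (rule omega_refine[OF K])
    also have "\<dots> = omega M (l * int j) * omega M (p * int j * int M)"
      unfolding omega_add[symmetric] by (simp add: algebra_simps)
    also have "omega M (p * int j * int M) = 1" using omega_eq_1_iff[OF assms(3)] by simp
    finally show ?thesis by simp
  qed
  have VK: "?V p (K * j) = trig_sum M (modes M) (\<lambda>l. ?u (l + p * int M)) j" for p j
    unfolding V omK unfolding trig_sum_def ..
  have "gnorm M (\<lambda>j. U (K * j) - trig_sum M (modes M) ?u j)
      = gnorm M (\<lambda>j. \<Sum>p\<in>?P - {0}. trig_sum M (modes M) (\<lambda>l. ?u (l + p * int M)) j)"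
  proof (rule gnorm_cong)
    fix j assume "j < M"
    then have "K * j < ?N" using K by simp
    from U[OF this] show "U (K * j) - trig_sum M (modes M) ?u j
        = (\<Sum>p\<in>?P - {0}. trig_sum M (modes M) (\<lambda>l. ?u (l + p * int M)) j)"
      unfolding VK[symmetric] V0[symmetric] using VK[of 0 j] by simp
  qed
  also have "\<dots> \<le> (\<Sum>p\<in>?P - {0}. gnorm M (trig_sum M (modes M) (\<lambda>l. ?u (l + p * int M))))"
    by (rule gnorm_sum)
  also have "\<dots> = (\<Sum>p\<in>?P - {0}. L2_set (\<lambda>l. norm (?u (l + p * int M))) (modes M))"
    using assms by (intro sum.cong refl gnorm_trig_sum distinct_mod_modes0) auto
  finally show "gnorm M (\<lambda>j. U (K * j) - trig_sum M (modes M) ?u j) \<le> 4 * ?B" using sum_le by simp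
qed

lemma gdiff_trig_sum: "gdiff (trig_sum M F c) = trig_sum M F (\<lambda>l. (omega M l - 1) *s c l)"
  by (rule ext) (simp add: gdiff_def trig_sum_def sum_subtractf[symmetric] vec_eq_iff distrib_left
      omega_add left_diff_distrib algebra_simps)

lemma gdiff_pow_trig_sum: "(gdiff ^^ k) (trig_sum M F c) = trig_sum M F (\<lambda>l. (omega M l - 1) ^ k *s c l)"
  by (induction k) (simp_all add: gdiff_trig_sum vec_eq_iff mult.assoc)

text \<open>Differences with the coarse and the fine step are Fourier multipliers whose symbols are
  both comparable to frequency times step. The steps have ratio K, and the comparison constants lose
  a factor 2 per difference.\<close>

lemma projection_smooth:
  assumes "a < b" "even M" "0 < M" "0 < K" "odd K" "gperiodic (K * M) U"
  shows "gnorm M ((gdiff ^^ k) (trig_sum M (modes M) (dft a b (K * M) U)))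
    \<le> (2 * real K) ^ k * gnorm (K * M) ((gdiff ^^ k) U)"
proof -
  let ?N = "K * M"
  let ?u = "dft a b ?N U"
  obtain Q where Q: "K = 2 * Q + 1" using assms(5) by (auto elim: oddE)
  have N: "0 < ?N" "even ?N" using assms by auto
  let ?g = "\<lambda>l. cmod (omega ?N l - 1) ^ k * norm (?u l)"
  have sub: "modes M \<subseteq> modes ?N" using block_subset[OF assms(2,3) Q, of 0] by auto
  have "gnorm M ((gdiff ^^ k) (trig_sum M (modes M) ?u)) = L2_set (\<lambda>l. cmod (omega M l - 1) ^ k * norm (?u l)) (modes M)"
    unfolding gdiff_pow_trig_sum using assms by (subst gnorm_trig_sum) (auto simp: norm_power distinct_mod_modes0)
  also have "\<dots> \<le> L2_set (\<lambda>l. (2 * real K) ^ k * ?g l) (modes M)"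
  proof (rule L2_set_mono)
    fix l assume "l \<in> modes M"
    then have "2 * \<bar>l\<bar> \<le> int ?N" using sub N(2) unfolding modes_def by auto
    then have "pi * \<bar>of_int l\<bar> / real ?N \<le> cmod (omega ?N l - 1)" by (rule omega_minus_1_ge[OF N(1)])
    then have "2 * pi * \<bar>of_int l\<bar> / real M \<le> 2 * real K * cmod (omega ?N l - 1)"
      using assms(3,4) by (simp add: field_simps)
    with omega_minus_1_le[of M l] have "cmod (omega M l - 1) \<le> 2 * real K * cmod (omega ?N l - 1)" by simp
    then have "cmod (omega M l - 1) ^ k \<le> (2 * real K * cmod (omega ?N l - 1)) ^ k" by (rule power_mono) simp
    then show "cmod (omega M l - 1) ^ k * norm (?u l) \<le> (2 * real K) ^ k * ?g l"
      using mult_right_mono[of _ _ "norm (?u l)"] by (simp add: power_mult_distrib mult.assoc[symmetric])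
  qed auto
  also have "\<dots> = (2 * real K) ^ k * L2_set ?g (modes M)" by (simp add: L2_set_right_distrib)
  also have "L2_set ?g (modes M) \<le> L2_set ?g (modes ?N)"
    unfolding L2_set_def using sub by (intro real_sqrt_le_mono sum_mono2) (auto simp: modes_def[of "K*M"])
  also have "L2_set ?g (modes ?N) = gnorm ?N ((gdiff ^^ k) U)"
    by (rule gnorm_gdiff_pow[OF assms(1) N assms(6), symmetric])
  finally show ?thesis by (simp add: mult_left_mono)
qed

section \<open>Discrete Sobolev norms\<close>

lemma smult_scaleR: "c *s (r *\<^sub>R (x::complex^2)) = r *\<^sub>R (c *s x)"
  by (simp add: vec2_eq_iff)

lemma dft_add: "dft a b M (\<lambda>j. U j + V j) l = dft a b M U l + dft a b M V l"
  by (simp add: dft_def sum.distrib vector_add_ldistrib)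

lemma dft_scaleR: "dft a b M (\<lambda>j. r *\<^sub>R U j) l = r *\<^sub>R dft a b M U l"
  by (simp add: dft_def smult_scaleR scaleR_sum_right[symmetric])

lemma dft_smult: "dft a b M (\<lambda>j. c *s U j) l = c *s dft a b M U l"
  by (simp add: vec_eq_iff dft_def sum_distrib_left mult_ac)

lemma trig_sum_add: "trig_sum M F (\<lambda>l. c l + d l) j = trig_sum M F c j + trig_sum M F d j"
  by (simp add: trig_sum_def sum.distrib vector_add_ldistrib)

lemma trig_sum_scaleR: "trig_sum M F (\<lambda>l. r *\<^sub>R c l) j = r *\<^sub>R trig_sum M F c j"
  by (simp add: trig_sum_def smult_scaleR scaleR_sum_right)

lemma gdiff_smult: "gdiff (\<lambda>j. c *s (U j :: complex^2)) = (\<lambda>j. c *s gdiff U j)"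
  by (rule ext) (simp add: gdiff_def vec2_eq_iff algebra_simps)

lemma gdiff_add: "gdiff (\<lambda>j. U j + V j) = (\<lambda>j. gdiff U j + gdiff V j)"
  by (rule ext) (simp add: gdiff_def)

lemma gdiff_sigma1: "gdiff (\<lambda>j. sigma1 *v U j) = (\<lambda>j. sigma1 *v gdiff U j)"
  by (rule ext) (simp add: gdiff_def matrix_vector_mult_diff_distrib)

text \<open>Grid analogue of the Sobolev norms in which each derivative is weighted by \<open>\<epsilon>\<close>:
  the parameter \<open>\<rho>\<close> stands for \<open>\<epsilon> / h\<close>.\<close>

primrec sobolev :: "real \<Rightarrow> nat \<Rightarrow> nat \<Rightarrow> (nat \<Rightarrow> complex^2) \<Rightarrow> real" where
  "sobolev \<rho> M 0 U = gnorm M U"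
| "sobolev \<rho> M (Suc k) U = sobolev \<rho> M k U + \<rho> * sobolev \<rho> M k (gdiff U)"

lemma sobolev_nonneg: "0 \<le> \<rho> \<Longrightarrow> 0 \<le> sobolev \<rho> M k U"
  by (induction k arbitrary: U) auto

lemma sobolev_mono_Suc: "0 \<le> \<rho> \<Longrightarrow> sobolev \<rho> M k U \<le> sobolev \<rho> M (Suc k) U"
  by (simp add: sobolev_nonneg)

lemma sobolev_triangle: "0 \<le> \<rho> \<Longrightarrow> sobolev \<rho> M k (\<lambda>j. U j + V j) \<le> sobolev \<rho> M k U + sobolev \<rho> M k V"
proof (induction k arbitrary: U V)
  case (Suc k)
  have "\<rho> * sobolev \<rho> M k (gdiff (\<lambda>j. U j + V j)) \<le> \<rho> * (sobolev \<rho> M k (gdiff U) + sobolev \<rho> M k (gdiff V))"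
    unfolding gdiff_add using Suc by (intro mult_left_mono) auto
  with Suc.IH[OF Suc.prems, of U V] show ?case by (simp add: distrib_left)
qed (simp add: gnorm_triangle)

lemma sobolev_smult: "sobolev \<rho> M k (\<lambda>j. c *s U j) = cmod c * sobolev \<rho> M k U"
proof (induction k arbitrary: U)
  case 0
  show ?case by (simp add: gnorm_def L2_set_right_distrib)
qed (simp add: gdiff_smult algebra_simps)

lemma sobolev_sigma1: "sobolev \<rho> M k (\<lambda>j. sigma1 *v U j) = sobolev \<rho> M k U"
  by (induction k arbitrary: U) (simp_all add: gnorm_def gdiff_sigma1)

lemma sobolev_shift: "gperiodic M U \<Longrightarrow> sobolev \<rho> M k (\<lambda>j. U (Suc j)) = sobolev \<rho> M k U"
proof (induction k arbitrary: U)
  case (Suc k)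
  have "gdiff (\<lambda>j. U (Suc j)) = (\<lambda>j. gdiff U (Suc j))" by (rule ext) (simp add: gdiff_def)
  then show ?case using Suc gperiodic_gdiff[of M U] by simp
qed (simp add: gnorm_shift)

text \<open>Discrete Leibniz rule: the difference of a product is the difference of \<open>u\<close>
  times the shifted \<open>U\<close> plus \<open>u\<close> times the difference of \<open>U\<close>,
  and the norms are invariant under shifts. Two terms per order give 2^k; the weight \<rho> in front
  of the difference of \<open>u\<close> cancels against its bound \<beta> / \<rho>.\<close>

lemma sobolev_mult:
  fixes u :: "nat \<Rightarrow> real"
  assumes "0 \<le> \<rho>" "0 < M"
  shows "gperiodic M U \<Longrightarrow> (\<And>i j. i \<le> k \<Longrightarrow> \<rho> ^ i * \<bar>(gdiff ^^ i) u j\<bar> \<le> \<beta>)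
    \<Longrightarrow> sobolev \<rho> M k (\<lambda>j. u j *\<^sub>R U j) \<le> 2 ^ k * \<beta> * sobolev \<rho> M k U"
proof (induction k arbitrary: U u \<beta>)
  case 0
  have "\<bar>u j\<bar> \<le> \<beta>" for j using 0(2)[of 0 j] by simp
  moreover from this[of 0] have "0 \<le> \<beta>" by simp
  ultimately show ?case
    by (simp add: gnorm_le_mult mult_right_mono)
next
  case (Suc k)
  have b0: "\<bar>u j\<bar> \<le> \<beta>" for j using Suc.prems(2)[of 0 j] by simp
  then have \<beta>: "0 \<le> \<beta>" using order_trans[OF abs_ge_zero b0[of 0]] by simp
  have split: "gdiff (\<lambda>j. u j *\<^sub>R U j) = (\<lambda>j. gdiff u j *\<^sub>R U (Suc j) + u j *\<^sub>R gdiff U j)"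
    by (rule ext) (simp add: gdiff_def algebra_simps)
  have IH1: "sobolev \<rho> M k (\<lambda>j. u j *\<^sub>R U j) \<le> 2 ^ k * \<beta> * sobolev \<rho> M k U"
    using Suc.prems by (intro Suc.IH) auto
  have IH2: "sobolev \<rho> M k (\<lambda>j. u j *\<^sub>R gdiff U j) \<le> 2 ^ k * \<beta> * sobolev \<rho> M k (gdiff U)"
    using Suc.prems gperiodic_gdiff by (intro Suc.IH) auto
  have IH3: "\<rho> * sobolev \<rho> M k (\<lambda>j. gdiff u j *\<^sub>R U (Suc j)) \<le> 2 ^ k * \<beta> * sobolev \<rho> M k U"
  proof (cases "\<rho> = 0")
    case True
    then show ?thesis using \<beta> by (simp add: sobolev_nonneg)
  next
    case False
    with assms have \<rho>: "0 < \<rho>" by simp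
    have "sobolev \<rho> M k (\<lambda>j. gdiff u j *\<^sub>R U (Suc j)) \<le> 2 ^ k * (\<beta> / \<rho>) * sobolev \<rho> M k (\<lambda>j. U (Suc j))"
    proof (rule Suc.IH)
      show "gperiodic M (\<lambda>j. U (Suc j))" using Suc.prems(1) unfolding gperiodic_def by (metis add_Suc)
      fix i j assume "i \<le> k"
      then have "\<rho> ^ Suc i * \<bar>(gdiff ^^ Suc i) u j\<bar> \<le> \<beta>" by (intro Suc.prems) auto
      then show "\<rho> ^ i * \<bar>(gdiff ^^ i) (gdiff u) j\<bar> \<le> \<beta> / \<rho>"
        using \<rho> by (simp add: funpow_swap1 field_simps)
    qed
    then have "\<rho> * sobolev \<rho> M k (\<lambda>j. gdiff u j *\<^sub>R U (Suc j)) \<le> \<rho> * (2 ^ k * (\<beta> / \<rho>) * sobolev \<rho> M k U)"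
      using \<rho> sobolev_shift[OF Suc.prems(1)] by (intro mult_left_mono) auto
    then show ?thesis using \<rho> by simp
  qed
  have "sobolev \<rho> M (Suc k) (\<lambda>j. u j *\<^sub>R U j)
      \<le> sobolev \<rho> M k (\<lambda>j. u j *\<^sub>R U j)
        + \<rho> * (sobolev \<rho> M k (\<lambda>j. gdiff u j *\<^sub>R U (Suc j)) + sobolev \<rho> M k (\<lambda>j. u j *\<^sub>R gdiff U j))"
    unfolding sobolev.simps split using sobolev_triangle[OF assms(1)] assms(1)
    by (intro add_left_mono mult_left_mono)
  also have "\<dots> \<le> 2 ^ k * \<beta> * sobolev \<rho> M k U + 2 ^ k * \<beta> * sobolev \<rho> M k U
      + \<rho> * (2 ^ k * \<beta> * sobolev \<rho> M k (gdiff U))"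
    using IH1 IH3 mult_left_mono[OF IH2 assms(1)] unfolding distrib_left by linarith
  also have "\<dots> \<le> 2 ^ Suc k * \<beta> * sobolev \<rho> M (Suc k) U"
  proof -
    have "0 \<le> \<rho> * (2 ^ k * \<beta> * sobolev \<rho> M k (gdiff U))" using assms(1) \<beta> by (simp add: sobolev_nonneg)
    then show ?thesis unfolding sobolev.simps power_Suc distrib_left
      by (simp only: mult.assoc mult.left_commute[of \<rho>])
  qed
  finally show ?case .
qed

text \<open>Only the inner product of \<open>q\<close> with its derivative is bounded, so a skew
  generator acting on \<open>q\<close> drops out however large it is, and no exponential growth
  factor arises. The norm need not be differentiable where it vanishes, for instance at time 0, and
  is therefore regularized to sqrt (N + e^2) with e tending to 0. Here \<rho> is the size of the
  forcing, not the weight of the Sobolev norms.\<close>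

lemma energy_bound:
  fixes q :: "real \<Rightarrow> nat \<Rightarrow> complex^2"
  assumes M: "0 < M" and "0 \<le> \<tau>" and q0: "\<And>j. j < M \<Longrightarrow> q 0 j = 0"
    and q: "\<And>s j. 0 \<le> s \<Longrightarrow> s \<le> \<tau> \<Longrightarrow> j < M \<Longrightarrow>
      ((\<lambda>s. q s j) has_vector_derivative q' s j) (at s within {0..\<tau>})"
    and le: "\<And>s. 0 \<le> s \<Longrightarrow> s \<le> \<tau> \<Longrightarrow> (\<Sum>j<M. inner (q s j) (q' s j)) / real M \<le> gnorm M (q s) * \<rho>"
    and \<rho>: "0 \<le> \<rho>"
  shows "gnorm M (q \<tau>) \<le> \<rho> * \<tau>"
proof (rule field_le_epsilon)
  fix e :: real assume e: "0 < e"
  define N where "N s = (gnorm M (q s))\<^sup>2" for s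
  define N' where "N' s = 2 * ((\<Sum>j<M. inner (q s j) (q' s j)) / real M)" for s
  have D: "(N has_real_derivative N' s) (at s within {0..\<tau>})" if "s \<in> {0..\<tau>}" for s
  proof -
    have "((\<lambda>s. inner (q s j) (q s j)) has_real_derivative 2 * inner (q s j) (q' s j)) (at s within {0..\<tau>})"
      if "j < M" for j
    proof -
      have "((\<lambda>s. inner (q s j) (q s j)) has_vector_derivative
          (inner (q s j) (q' s j) + inner (q' s j) (q s j))) (at s within {0..\<tau>})"
        using \<open>s \<in> {0..\<tau>}\<close> that q
        by (intro bounded_bilinear.has_vector_derivative[OF bounded_bilinear_inner]) auto
      then show ?thesis
        by (simp add: inner_commute has_real_derivative_iff_has_vector_derivative)
    qed
    then have "((\<lambda>s. (\<Sum>j<M. inner (q s j) (q s j)) / real M) has_real_derivative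
        (\<Sum>j<M. 2 * inner (q s j) (q' s j)) / real M) (at s within {0..\<tau>})"
      by (intro DERIV_cdivide DERIV_sum) auto
    moreover have "(\<lambda>s. (\<Sum>j<M. inner (q s j) (q s j)) / real M) = N"
      by (rule ext) (simp add: N_def gnorm_power2[OF M] power2_norm_eq_inner)
    moreover have "(\<Sum>j<M. 2 * inner (q s j) (q' s j)) / real M = N' s"
      by (simp add: N'_def sum_distrib_left)
    ultimately show ?thesis by simp
  qed
  have Npos: "0 \<le> N s" for s by (simp add: N_def)
  define f where "f s = sqrt (N s + e\<^sup>2) - \<rho> * s" for s
  have pos: "0 < N s + e\<^sup>2" for s using Npos[of s] e by (simp add: add_nonneg_pos)
  have Df: "(f has_real_derivative (N' s / (2 * sqrt (N s + e\<^sup>2)) - \<rho>)) (at s within {0..\<tau>})"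
    if "s \<in> {0..\<tau>}" for s
  proof -
    have "((\<lambda>s. sqrt (N s + e\<^sup>2)) has_real_derivative
        (inverse (sqrt (N s + e\<^sup>2)) / 2) * N' s) (at s within {0..\<tau>})"
      using DERIV_chain2[OF DERIV_real_sqrt[OF pos[of s]] DERIV_add[OF D[OF that] DERIV_const[of "e\<^sup>2"]]]
      by simp
    from DERIV_diff[OF this DERIV_cmult[OF DERIV_ident, of \<rho>]]
    have "(f has_real_derivative (inverse (sqrt (N s + e\<^sup>2)) / 2 * N' s - \<rho> * 1)) (at s within {0..\<tau>})"
      unfolding f_def .
    moreover have "inverse r / 2 * x - y * 1 = x / (2 * r) - y" for r x y :: real
      by (simp add: field_simps)
    ultimately show ?thesis by (simp only:)
  qed
  have neg: "N' s / (2 * sqrt (N s + e\<^sup>2)) - \<rho> \<le> 0" if "s \<in> {0..\<tau>}" for s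
  proof -
    have "N' s \<le> 2 * (gnorm M (q s) * \<rho>)" using le[of s] that by (simp add: N'_def)
    also have "gnorm M (q s) \<le> sqrt (N s + e\<^sup>2)" by (rule real_le_rsqrt) (simp add: N_def)
    finally have "N' s \<le> 2 * (sqrt (N s + e\<^sup>2) * \<rho>)" using \<rho> by (simp add: mult_right_mono)
    then show ?thesis using pos[of s] by (simp add: field_simps)
  qed
  have "f \<tau> \<le> f 0"
  proof (cases "\<tau> = 0")
    case False
    with \<open>0 \<le> \<tau>\<close> have "0 < \<tau>" by simp
    have "\<exists>z\<in>{0<..<\<tau>}. f \<tau> - f 0 = (N' z / (2 * sqrt (N z + e\<^sup>2)) - \<rho>) * (\<tau> - 0)"
      by (rule mvt_simple[OF \<open>0 < \<tau>\<close>]) (use Df in \<open>simp add: has_field_derivative_def\<close>)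
    then obtain z where "0 < z" "z < \<tau>" "f \<tau> - f 0 = \<tau> * (N' z / (2 * sqrt (N z + e\<^sup>2)) - \<rho>)"
      by auto
    moreover have "\<tau> * (N' z / (2 * sqrt (N z + e\<^sup>2)) - \<rho>) \<le> 0"
      using neg[of z] calculation(1,2) by (intro mult_nonneg_nonpos) auto
    ultimately show ?thesis by simp
  qed simp
  moreover have "N 0 = 0" using gnorm_power2[OF M, of "q 0"] q0 by (simp add: N_def)
  ultimately have "sqrt (N \<tau> + e\<^sup>2) \<le> e + \<rho> * \<tau>" using e by (simp add: f_def)
  moreover have "gnorm M (q \<tau>) \<le> sqrt (N \<tau> + e\<^sup>2)" by (rule real_le_rsqrt) (simp add: N_def)
  ultimately show "gnorm M (q \<tau>) \<le> \<rho> * \<tau> + e" by simp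
qed

section \<open>Local error of Strang splitting\<close>

definition free_gen :: "real \<Rightarrow> real \<Rightarrow> complex^2^2" where
  "free_gen \<epsilon> \<mu> = (- \<i> * of_real \<mu>) *m sigma1 - (\<i> / of_real \<epsilon>) *m sigma3"

definition pot_gen :: "real \<Rightarrow> real \<Rightarrow> real \<Rightarrow> complex^2^2" where
  "pot_gen \<epsilon> v \<alpha> = (- \<i> / of_real \<epsilon> * of_real v) *m mat 1 + (\<i> / of_real \<epsilon> * of_real \<alpha>) *m sigma1"

lemma free_gen_vec: "free_gen \<epsilon> \<mu> *v x = (- \<i> * of_real \<mu>) *s (sigma1 *v x) - (\<i> / of_real \<epsilon>) *s (sigma3 *v x)"
  by (simp add: free_gen_def matrix_vector_mult_diff_rdistrib)

lemma pot_gen_vec: "pot_gen \<epsilon> v \<alpha> *v x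
    = (- \<i> / of_real \<epsilon>) *s (v *\<^sub>R x) + (\<i> / of_real \<epsilon>) *s (\<alpha> *\<^sub>R (sigma1 *v x))"
  by (simp add: pot_gen_def matrix_vector_mult_add_rdistrib vec2_eq_iff scaleR_conv_of_real[where 'a=complex]
      mult.assoc)

lemma matrix_vector_smult: "(A::complex^2^2) *v (c *s x) = c *s (A *v x)"
  by (simp add: vec2_eq_iff matrix_vector_mult_2 algebra_simps)

locale grid_dirac =
  fixes a b \<epsilon> :: real and M :: nat and v \<alpha> :: "nat \<Rightarrow> real"
  assumes ab: "a < b" and M: "0 < M" "even M" and eps: "0 < \<epsilon>"
    and per: "gperiodic M v" "gperiodic M \<alpha>"
begin

definition \<rho> where "\<rho> = \<epsilon> / mesh a b M"

definition Aop :: "(nat \<Rightarrow> complex^2) \<Rightarrow> nat \<Rightarrow> complex^2" where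
  "Aop U = trig_sum M (modes M) (\<lambda>l. free_gen \<epsilon> (mu a b l) *v dft a b M U l)"

definition Bop :: "(nat \<Rightarrow> complex^2) \<Rightarrow> nat \<Rightarrow> complex^2" where
  "Bop U j = pot_gen \<epsilon> (v j) (\<alpha> j) *v U j"

definition EA :: "real \<Rightarrow> (nat \<Rightarrow> complex^2) \<Rightarrow> nat \<Rightarrow> complex^2" where
  "EA s U = trig_sum M (modes M) (\<lambda>l. mexp (of_real s *m free_gen \<epsilon> (mu a b l)) *v dft a b M U l)"

definition EB :: "real \<Rightarrow> (nat \<Rightarrow> complex^2) \<Rightarrow> nat \<Rightarrow> complex^2" where
  "EB s U j = mexp (of_real s *m pot_gen \<epsilon> (v j) (\<alpha> j)) *v U j"

lemma dist: "distinct_mod M (modes M)" using M by (simp add: distinct_mod_modes0)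

lemma mesh_pos: "0 < mesh a b M" using ab M by (simp add: mesh_def)

lemma rho_pos: "0 < \<rho>" using mesh_pos eps by (simp add: \<rho>_def)

lemma skewA: "skew (free_gen \<epsilon> \<mu>)" unfolding free_gen_def by (rule skew_free)
lemma skewB: "skew (pot_gen \<epsilon> x y)" unfolding pot_gen_def by (rule skew_potential)

lemma dft_Aop: "l \<in> modes M \<Longrightarrow> dft a b M (Aop U) l = free_gen \<epsilon> (mu a b l) *v dft a b M U l"
  unfolding Aop_def by (rule dft_trig_sum[OF ab M(1) dist])

lemma dft_EA: "l \<in> modes M \<Longrightarrow> dft a b M (EA s U) l = mexp (of_real s *m free_gen \<epsilon> (mu a b l)) *v dft a b M U l"
  unfolding EA_def by (rule dft_trig_sum[OF ab M(1) dist])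

lemma trig_sum_cong: "(\<And>l. l \<in> modes M \<Longrightarrow> c l = d l) \<Longrightarrow> trig_sum M (modes M) c = trig_sum M (modes M) d"
  by (rule ext) (simp add: trig_sum_def)

lemma gperiodic_Aop: "gperiodic M (Aop U)" unfolding Aop_def by (rule gperiodic_trig_sum[OF M(1)])

lemma gperiodic_Bop: "gperiodic M U \<Longrightarrow> gperiodic M (Bop U)"
  using per by (simp add: gperiodic_def Bop_def)

lemma Aop_add: "Aop (\<lambda>j. U j + V j) j = Aop U j + Aop V j"
  unfolding Aop_def dft_add matrix_vector_right_distrib by (rule trig_sum_add)
lemma Aop_scaleR: "Aop (\<lambda>j. r *\<^sub>R U j) j = r *\<^sub>R Aop U j"
  unfolding Aop_def dft_scaleR matrix_vector_scaleR by (rule trig_sum_scaleR)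
lemma Bop_add: "Bop (\<lambda>j. U j + V j) j = Bop U j + Bop V j"
  unfolding Bop_def by (rule matrix_vector_right_distrib)
lemma Bop_scaleR: "Bop (\<lambda>j. r *\<^sub>R U j) j = r *\<^sub>R Bop U j"
  unfolding Bop_def by (rule matrix_vector_scaleR)
lemma EA_add: "EA s (\<lambda>j. U j + V j) j = EA s U j + EA s V j"
  unfolding EA_def dft_add matrix_vector_right_distrib by (rule trig_sum_add)
lemma EA_scaleR: "EA s (\<lambda>j. r *\<^sub>R U j) j = r *\<^sub>R EA s U j"
  unfolding EA_def dft_scaleR matrix_vector_scaleR by (rule trig_sum_scaleR)
lemma EB_add: "EB s (\<lambda>j. U j + V j) j = EB s U j + EB s V j"
  unfolding EB_def by (rule matrix_vector_right_distrib)
lemma EB_scaleR: "EB s (\<lambda>j. r *\<^sub>R U j) j = r *\<^sub>R EB s U j"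
  unfolding EB_def by (rule matrix_vector_scaleR)

lemma gnorm_EB: "gnorm M (EB s U) = gnorm M U"
  by (simp add: gnorm_def EB_def skew_norm_mexp[OF skewB])

lemma gnorm_EA: "gnorm M (EA s U) = gnorm M U"
  unfolding gnorm_dft[OF ab M] by (rule L2_set_cong) (simp_all add: dft_EA skew_norm_mexp[OF skewA])

text \<open>Parseval moves the pairing to the frequency side, where every single mode contributes
  zero by skewness.\<close>

lemma inner_Aop: "(\<Sum>j<M. inner (U j) (Aop U j)) = 0"
proof -
  have "(\<Sum>j<M. inner (U j) (Aop U j)) = (\<Sum>j<M. inner (trig_sum M (modes M) (dft a b M U) j) (Aop U j))"
    by (intro sum.cong refl) (simp add: dft_inversion[OF ab M])
  also have "\<dots> = real M * (\<Sum>l\<in>modes M. inner (dft a b M U l) (free_gen \<epsilon> (mu a b l) *v dft a b M U l))"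
    unfolding Aop_def by (rule parseval_inner[OF M(1) dist])
  also have "\<dots> = 0" using skewA by (simp add: skew_def)
  finally show ?thesis .
qed

lemma inner_Bop: "inner (U j) (Bop U j) = 0"
  using skewB by (simp add: Bop_def skew_def)

text \<open>Parseval reduces each bound to the Taylor bounds of the matrix exponential, mode by
  mode.\<close>

lemma EA_taylor:
  assumes "0 \<le> s"
  shows EA_taylor1: "gnorm M (\<lambda>j. EA s U j - U j) \<le> s * gnorm M (Aop U)"
    and EA_taylor2: "gnorm M (\<lambda>j. EA s U j - U j - s *\<^sub>R Aop U j) \<le> s\<^sup>2 * gnorm M (Aop (Aop U))"
    and EA_taylor3: "gnorm M (\<lambda>j. EA s U j - U j - s *\<^sub>R Aop U j - (s\<^sup>2 / 2) *\<^sub>R Aop (Aop U) j)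
      \<le> s ^ 3 * gnorm M (Aop (Aop (Aop U)))"
proof -
  have dft_minus: "dft a b M (\<lambda>j. X j - Y j) l = dft a b M X l - dft a b M Y l" for X Y l
    using dft_add[of a b M X "\<lambda>j. (-1) *\<^sub>R Y j" l] dft_scaleR[of a b M "-1" Y l] by simp
  have L2: "gnorm M X \<le> c * gnorm M Y"
    if "0 \<le> c" "\<And>l. l \<in> modes M \<Longrightarrow> norm (dft a b M X l) \<le> c * norm (dft a b M Y l)" for X Y c
    unfolding gnorm_dft[OF ab M] L2_set_right_distrib[OF that(1)] using that(2) by (intro L2_set_mono) auto
  show "gnorm M (\<lambda>j. EA s U j - U j) \<le> s * gnorm M (Aop U)"
    by (rule L2) (simp_all add: assms dft_minus dft_EA dft_Aop mexp_taylor1[OF skewA])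
  show "gnorm M (\<lambda>j. EA s U j - U j - s *\<^sub>R Aop U j) \<le> s\<^sup>2 * gnorm M (Aop (Aop U))"
    by (rule L2) (simp_all only: zero_le_power2 dft_scaleR dft_minus dft_EA dft_Aop mexp_taylor2[OF skewA assms])
  show "gnorm M (\<lambda>j. EA s U j - U j - s *\<^sub>R Aop U j - (s\<^sup>2 / 2) *\<^sub>R Aop (Aop U) j)
      \<le> s ^ 3 * gnorm M (Aop (Aop (Aop U)))"
    by (rule L2) (simp_all only: zero_le_power[OF assms] dft_scaleR dft_minus dft_EA dft_Aop mexp_taylor3[OF skewA assms])
qed

lemma EB_taylor:
  assumes "0 \<le> s"
  shows EB_taylor1: "gnorm M (\<lambda>j. EB s U j - U j) \<le> s * gnorm M (Bop U)"
    and EB_taylor2: "gnorm M (\<lambda>j. EB s U j - U j - s *\<^sub>R Bop U j) \<le> s\<^sup>2 * gnorm M (Bop (Bop U))"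
    and EB_taylor3: "gnorm M (\<lambda>j. EB s U j - U j - s *\<^sub>R Bop U j - (s\<^sup>2 / 2) *\<^sub>R Bop (Bop U) j)
      \<le> s ^ 3 * gnorm M (Bop (Bop (Bop U)))"
  unfolding EB_def Bop_def
  by (rule gnorm_le_mult; simp add: assms mexp_taylor1[OF skewB] mexp_taylor2[OF skewB] mexp_taylor3[OF skewB])+

text \<open>The innermost letter of a word of length three is measured in the Sobolev norm of order
  two and the outer ones in lower orders, hence two differences. The weights are powers of
  \<epsilon> / h, so each derivative of the potential may cost a factor 1 / \<epsilon>.\<close>

definition potential_bounded :: "real \<Rightarrow> bool" where
  "potential_bounded \<beta> \<longleftrightarrow> (\<forall>i\<le>2. \<forall>j. \<rho> ^ i * \<bar>(gdiff ^^ i) v j\<bar> \<le> \<beta> \<and> \<rho> ^ i * \<bar>(gdiff ^^ i) \<alpha> j\<bar> \<le> \<beta>)"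

section \<open>The cost of one letter in the weighted norms\<close>

lemma gdiff_Aop: assumes "gperiodic M U" shows "gdiff (Aop U) = Aop (gdiff U)"
  unfolding Aop_def gdiff_trig_sum unfolding dft_gdiff[OF ab M(1) assms] matrix_vector_smult ..

text \<open>The frequency is at most 2 / h times the symbol of the difference, so applying the free
  part costs one difference, and the weight \<epsilon> / h turns 2 / h into 2 / \<epsilon>. Higher
  orders follow because the operator commutes with differences.\<close>

lemma sobolev_Aop: "gperiodic M U \<Longrightarrow> sobolev \<rho> M k (Aop U) \<le> (2 / \<epsilon>) * sobolev \<rho> M (Suc k) U"
proof (induction k arbitrary: U)
  case 0
  let ?u = "dft a b M U"
  have "gnorm M (Aop U) = L2_set (\<lambda>l. norm (free_gen \<epsilon> (mu a b l) *v ?u l)) (modes M)"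
    unfolding gnorm_dft[OF ab M] by (rule L2_set_cong) (simp_all add: dft_Aop)
  also have "\<dots> \<le> L2_set (\<lambda>l. (2 / mesh a b M) * (cmod (omega M l - 1) * norm (?u l)) + (1 / \<epsilon>) * norm (?u l)) (modes M)"
  proof (rule L2_set_mono)
    fix l assume l: "l \<in> modes M"
    have "2 * \<bar>l\<bar> \<le> int M" using l M(2) unfolding modes_def by auto
    then have "pi * \<bar>of_int l\<bar> / real M \<le> cmod (omega M l - 1)" by (rule omega_minus_1_ge[OF M(1)])
    moreover have "\<bar>mu a b l\<bar> = (2 / mesh a b M) * (pi * \<bar>of_int l\<bar> / real M)"
      using ab M(1) by (simp add: mu_def mesh_def abs_mult)
    ultimately have mu: "\<bar>mu a b l\<bar> \<le> (2 / mesh a b M) * cmod (omega M l - 1)"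
      using mesh_pos by (simp only:) (intro mult_left_mono; simp)
    have "norm (free_gen \<epsilon> (mu a b l) *v ?u l) \<le> \<bar>mu a b l\<bar> * norm (?u l) + (1 / \<epsilon>) * norm (?u l)"
      unfolding free_gen_vec using eps
      by (rule_tac order_trans[OF norm_triangle_ineq4]) (simp add: norm_mult norm_divide)
    also have "\<dots> \<le> (2 / mesh a b M) * (cmod (omega M l - 1) * norm (?u l)) + (1 / \<epsilon>) * norm (?u l)"
      using mult_right_mono[OF mu norm_ge_zero[of "?u l"]] by (simp add: mult.assoc)
    finally show "norm (free_gen \<epsilon> (mu a b l) *v ?u l)
      \<le> (2 / mesh a b M) * (cmod (omega M l - 1) * norm (?u l)) + (1 / \<epsilon>) * norm (?u l)" .
  qed auto
  also have "\<dots> \<le> L2_set (\<lambda>l. (2 / mesh a b M) * (cmod (omega M l - 1) * norm (?u l))) (modes M)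
      + L2_set (\<lambda>l. (1 / \<epsilon>) * norm (?u l)) (modes M)" by (rule L2_set_triangle_ineq)
  also have "\<dots> = (2 / mesh a b M) * L2_set (\<lambda>l. cmod (omega M l - 1) * norm (?u l)) (modes M)
      + (1 / \<epsilon>) * L2_set (\<lambda>l. norm (?u l)) (modes M)"
  proof -
    have "L2_set (\<lambda>l. c * f l) F = c * L2_set f F" if "0 \<le> c" for c f and F :: "int set"
      using that by (simp add: L2_set_right_distrib)
    from this[of "2 / mesh a b M"] this[of "1 / \<epsilon>"] show ?thesis
      using mesh_pos eps by (simp only: divide_nonneg_pos zero_le_numeral zero_le_one)
  qed
  also have "L2_set (\<lambda>l. cmod (omega M l - 1) * norm (?u l)) (modes M) = gnorm M (gdiff U)"
    using gnorm_gdiff_pow[OF ab M 0, of 1] by simp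
  also have "L2_set (\<lambda>l. norm (?u l)) (modes M) = gnorm M U" by (simp add: gnorm_dft[OF ab M])
  also have "(2 / mesh a b M) * gnorm M (gdiff U) + (1 / \<epsilon>) * gnorm M U
      \<le> (2 / \<epsilon>) * (gnorm M U + \<rho> * gnorm M (gdiff U))"
    using eps mesh_pos by (simp add: \<rho>_def field_simps)
  finally show ?case by simp
next
  case (Suc k)
  have "sobolev \<rho> M (Suc k) (Aop U) = sobolev \<rho> M k (Aop U) + \<rho> * sobolev \<rho> M k (Aop (gdiff U))"
    using gdiff_Aop[OF Suc.prems] by simp
  also have "\<dots> \<le> (2 / \<epsilon>) * sobolev \<rho> M (Suc k) U + \<rho> * ((2 / \<epsilon>) * sobolev \<rho> M (Suc k) (gdiff U))"
    using Suc.IH[OF Suc.prems] Suc.IH[OF gperiodic_gdiff[OF Suc.prems]] rho_pos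
    by (intro add_mono mult_left_mono) auto
  also have "\<dots> = (2 / \<epsilon>) * sobolev \<rho> M (Suc (Suc k)) U"
    unfolding sobolev.simps(2)[of \<rho> M "Suc k"] by (simp only: distrib_left mult.left_commute[of \<rho>])
  finally show ?case .
qed

text \<open>The operator has order zero; the right-hand side is weakened by one order so that both
  letters obey estimates of the same form. The constant is 8 = 2 * 2^2, from two potentials and the
  Leibniz factor at order at most two.\<close>

lemma sobolev_Bop:
  assumes "potential_bounded \<beta>" "gperiodic M U" "k \<le> 2"
  shows "sobolev \<rho> M k (Bop U) \<le> (8 * \<beta> / \<epsilon>) * sobolev \<rho> M (Suc k) U"
proof -
  have \<rho>: "0 \<le> \<rho>" using rho_pos by simp
  have "\<rho> ^ 0 * \<bar>(gdiff ^^ 0) v 0\<bar> \<le> \<beta>" using assms(1) unfolding potential_bounded_def by blast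
  then have \<beta>: "0 \<le> \<beta>" by simp
  have eq: "Bop U = (\<lambda>j. (- \<i> / of_real \<epsilon>) *s (v j *\<^sub>R U j) + (\<i> / of_real \<epsilon>) *s (sigma1 *v (\<alpha> j *\<^sub>R U j)))"
    by (rule ext) (simp add: Bop_def pot_gen_vec matrix_vector_scaleR)
  have "sobolev \<rho> M k (Bop U) \<le> sobolev \<rho> M k (\<lambda>j. (- \<i> / of_real \<epsilon>) *s (v j *\<^sub>R U j))
      + sobolev \<rho> M k (\<lambda>j. (\<i> / of_real \<epsilon>) *s (sigma1 *v (\<alpha> j *\<^sub>R U j)))"
    unfolding eq by (rule sobolev_triangle[OF \<rho>])
  also have "\<dots> = (1 / \<epsilon>) * (sobolev \<rho> M k (\<lambda>j. v j *\<^sub>R U j) + sobolev \<rho> M k (\<lambda>j. \<alpha> j *\<^sub>R U j))"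
    unfolding sobolev_smult sobolev_sigma1 using eps by (simp add: norm_divide distrib_left)
  also have "\<dots> \<le> (1 / \<epsilon>) * (2 ^ k * \<beta> * sobolev \<rho> M k U + 2 ^ k * \<beta> * sobolev \<rho> M k U)"
    using assms eps \<rho> M unfolding potential_bounded_def
    by (intro mult_left_mono add_mono sobolev_mult) auto
  also have "\<dots> = (2 * 2 ^ k * \<beta> / \<epsilon>) * sobolev \<rho> M k U" by simp
  also have "\<dots> \<le> (8 * \<beta> / \<epsilon>) * sobolev \<rho> M (Suc k) U"
  proof (rule mult_mono)
    have "(2::real) ^ k \<le> 2 ^ 2" using assms(3) by (intro power_increasing) auto
    then show "2 * 2 ^ k * \<beta> / \<epsilon> \<le> 8 * \<beta> / \<epsilon>"
      using \<beta> eps by (intro divide_right_mono mult_right_mono) auto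
  qed (use \<beta> eps \<rho> in \<open>auto simp: sobolev_nonneg simp del: sobolev.simps intro: sobolev_mono_Suc\<close>)
  finally show ?thesis .
qed

text \<open>Each letter costs one factor of size 1 / \<epsilon> and raises the order of the norm
  needed on its argument by one, uniformly in h.\<close>

lemma words_bound:
  assumes \<beta>: "potential_bounded \<beta>" and U: "gperiodic M U" and X: "X \<in> {Aop, Bop}" "Y \<in> {Aop, Bop}" "Z \<in> {Aop, Bop}"
  shows "gnorm M (X (Y (Z U))) \<le> ((2 + 8 * \<beta>) / \<epsilon>) ^ 3 * sobolev \<rho> M 3 U"
proof -
  let ?\<kappa> = "(2 + 8 * \<beta>) / \<epsilon>"
  have \<rho>: "0 \<le> \<rho>" using rho_pos by simp
  have "\<rho> ^ 0 * \<bar>(gdiff ^^ 0) v 0\<bar> \<le> \<beta>" using \<beta> unfolding potential_bounded_def by blast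
  then have b: "0 \<le> \<beta>" by simp
  then have \<kappa>: "0 \<le> ?\<kappa>" using eps by simp
  have step: "sobolev \<rho> M k (X U) \<le> ?\<kappa> * sobolev \<rho> M (Suc k) U" if "X \<in> {Aop, Bop}" "gperiodic M U" "k \<le> 2" for X U k
  proof -
    have "sobolev \<rho> M k (X U) \<le> (2 / \<epsilon>) * sobolev \<rho> M (Suc k) U \<or> sobolev \<rho> M k (X U) \<le> (8 * \<beta> / \<epsilon>) * sobolev \<rho> M (Suc k) U"
      using that sobolev_Aop sobolev_Bop[OF \<beta>] by blast
    moreover have "(2 / \<epsilon>) * sobolev \<rho> M (Suc k) U \<le> ?\<kappa> * sobolev \<rho> M (Suc k) U"
      "(8 * \<beta> / \<epsilon>) * sobolev \<rho> M (Suc k) U \<le> ?\<kappa> * sobolev \<rho> M (Suc k) U"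
      using b eps sobolev_nonneg[OF \<rho>] by (intro mult_right_mono divide_right_mono; simp del: sobolev.simps)+
    ultimately show ?thesis by linarith
  qed
  have p: "gperiodic M (X U)" if "X \<in> {Aop, Bop}" "gperiodic M U" for X U
    using that gperiodic_Aop gperiodic_Bop by auto
  have "gnorm M (X (Y (Z U))) \<le> ?\<kappa> * sobolev \<rho> M 1 (Y (Z U))"
    using step[OF X(1) p[OF X(2) p[OF X(3) U]], of 0] by simp
  also have "\<dots> \<le> ?\<kappa> * (?\<kappa> * sobolev \<rho> M 2 (Z U))"
    using step[OF X(2) p[OF X(3) U], of 1] \<kappa> by (intro mult_left_mono) (auto simp: numeral_2_eq_2)
  also have "\<dots> \<le> ?\<kappa> * (?\<kappa> * (?\<kappa> * sobolev \<rho> M 3 U))"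
    using step[OF X(3) U, of 2] \<kappa> by (intro mult_left_mono) (auto simp: numeral_2_eq_2 numeral_3_eq_3)
  finally show ?thesis by (simp only: power3_eq_cube mult.assoc)
qed


text \<open>Both flows are expanded to second order from the right to the left; every remainder is
  controlled by a word of length three in \<^const>\<open>Aop\<close> and \<^const>\<open>Bop\<close> applied to \<open>U\<close>,
  because the flows themselves are isometric.\<close>

lemma strang_expansion:
  assumes w: "\<And>X Y Z. X \<in> {Aop, Bop} \<Longrightarrow> Y \<in> {Aop, Bop} \<Longrightarrow> Z \<in> {Aop, Bop} \<Longrightarrow> gnorm M (X (Y (Z U))) \<le> w"
    and \<tau>: "0 \<le> \<tau>"
  shows "gnorm M (\<lambda>j. EB (\<tau> / 2) (EA \<tau> (EB (\<tau> / 2) U)) j - (U j + \<tau> *\<^sub>R (Aop U j + Bop U j)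
    + (\<tau>\<^sup>2 / 2) *\<^sub>R (Aop (Aop U) j + Aop (Bop U) j + Bop (Aop U) j + Bop (Bop U) j))) \<le> 7 * (\<tau> ^ 3 * w)"
proof -
  let ?E = "EB (\<tau> / 2)" and ?F = "EA \<tau>"
  let ?\<tau>3 = "\<tau> ^ 3 * w"
  have ws: "gnorm M (Aop (Aop (Aop U))) \<le> w" "gnorm M (Aop (Aop (Bop U))) \<le> w"
    "gnorm M (Aop (Bop (Aop U))) \<le> w" "gnorm M (Aop (Bop (Bop U))) \<le> w"
    "gnorm M (Bop (Aop (Aop U))) \<le> w" "gnorm M (Bop (Aop (Bop U))) \<le> w"
    "gnorm M (Bop (Bop (Aop U))) \<le> w" "gnorm M (Bop (Bop (Bop U))) \<le> w"
    using w[of Aop Aop Aop] w[of Aop Aop Bop] w[of Aop Bop Aop] w[of Aop Bop Bop]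
      w[of Bop Aop Aop] w[of Bop Aop Bop] w[of Bop Bop Aop] w[of Bop Bop Bop] by simp_all
  have w0: "0 \<le> w" using order_trans[OF gnorm_nonneg ws(1)] .
  have t2: "0 \<le> \<tau> / 2" using \<tau> by simp
  note E1 = EB_taylor1[OF t2] and E2 = EB_taylor2[OF t2] and E3 = EB_taylor3[OF t2]
  note F1 = EA_taylor1[OF \<tau>] and F2 = EA_taylor2[OF \<tau>] and F3 = EA_taylor3[OF \<tau>]
  \<comment> \<open>Each flow is expanded only as far as its prefactor requires: in front of a word
    of length j stands a factor \<tau>^j, so 3 - j orders remain, and every remainder is of size
    \<tau>^3 times a word of length three.\<close>
  define r1 where "r1 j = ?E U j - U j - (\<tau>/2) *\<^sub>R Bop U j - ((\<tau>/2)\<^sup>2 / 2) *\<^sub>R Bop (Bop U) j" for j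
  define r2 where "r2 j = ?F U j - U j - \<tau> *\<^sub>R Aop U j - (\<tau>\<^sup>2 / 2) *\<^sub>R Aop (Aop U) j" for j
  define r3 where "r3 j = ?F (Bop U) j - Bop U j - \<tau> *\<^sub>R Aop (Bop U) j" for j
  define r4 where "r4 j = ?F (Bop (Bop U)) j - Bop (Bop U) j" for j
  define r5 where "r5 j = r2 j + (\<tau>/2) *\<^sub>R r3 j + (\<tau>\<^sup>2/8) *\<^sub>R r4 j + ?F r1 j" for j
  define r6 where "r6 j = ?E (Aop U) j - Aop U j - (\<tau>/2) *\<^sub>R Bop (Aop U) j" for j
  define r7 where "r7 j = ?E (Bop U) j - Bop U j - (\<tau>/2) *\<^sub>R Bop (Bop U) j" for j
  define r8 where "r8 j = ?E (Aop (Aop U)) j - Aop (Aop U) j" for j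
  define r9 where "r9 j = ?E (Aop (Bop U)) j - Aop (Bop U) j" for j
  define r10 where "r10 j = ?E (Bop (Bop U)) j - Bop (Bop U) j" for j
  have n1: "gnorm M r1 \<le> ?\<tau>3"
  proof -
    have "gnorm M r1 \<le> (\<tau>/2) ^ 3 * gnorm M (Bop (Bop (Bop U)))" unfolding r1_def by (rule E3)
    also have "\<dots> \<le> \<tau> ^ 3 * w" using \<tau> by (intro mult_mono ws power_mono) auto
    finally show ?thesis .
  qed
  have n2: "gnorm M r2 \<le> ?\<tau>3"
    unfolding r2_def using \<tau> by (intro order_trans[OF F3] mult_left_mono ws) auto
  have sc: "gnorm M (\<lambda>j. c *\<^sub>R r j) \<le> d * ?\<tau>3"
    if "gnorm M r \<le> e * w'" "w' \<le> w" "0 \<le> c" "0 \<le> e" "c * e = d * \<tau> ^ 3" for c d e r w'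
  proof -
    have "gnorm M r \<le> e * w" using that(1) mult_left_mono[OF that(2,4)] by linarith
    then have "c * gnorm M r \<le> c * (e * w)" using that(3) by (rule mult_left_mono)
    then show ?thesis using that(3,5) by (simp add: gnorm_scaleR mult.assoc[symmetric])
  qed
  have n3: "gnorm M (\<lambda>j. (\<tau>/2) *\<^sub>R r3 j) \<le> (1/2) * ?\<tau>3"
    using \<tau> by (intro sc[OF F2[of "Bop U", folded r3_def] ws(2)]) (auto simp: power2_eq_square power3_eq_cube)
  have n4: "gnorm M (\<lambda>j. (\<tau>\<^sup>2/8) *\<^sub>R r4 j) \<le> (1/8) * ?\<tau>3"
    using \<tau> by (intro sc[OF F1[of "Bop (Bop U)", folded r4_def] ws(4)]) (auto simp: power2_eq_square power3_eq_cube)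
  have n6: "gnorm M (\<lambda>j. \<tau> *\<^sub>R r6 j) \<le> (1/4) * ?\<tau>3"
    using \<tau> by (intro sc[OF E2[of "Aop U", folded r6_def] ws(7)]) (auto simp: power2_eq_square power3_eq_cube)
  have n7: "gnorm M (\<lambda>j. (\<tau>/2) *\<^sub>R r7 j) \<le> (1/8) * ?\<tau>3"
    using \<tau> by (intro sc[OF E2[of "Bop U", folded r7_def] ws(8)]) (auto simp: power2_eq_square power3_eq_cube)
  have n8: "gnorm M (\<lambda>j. (\<tau>\<^sup>2/2) *\<^sub>R r8 j) \<le> (1/4) * ?\<tau>3"
    using \<tau> by (intro sc[OF E1[of "Aop (Aop U)", folded r8_def] ws(5)]) (auto simp: power2_eq_square power3_eq_cube)
  have n9: "gnorm M (\<lambda>j. (\<tau>\<^sup>2/2) *\<^sub>R r9 j) \<le> (1/4) * ?\<tau>3"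
    using \<tau> by (intro sc[OF E1[of "Aop (Bop U)", folded r9_def] ws(6)]) (auto simp: power2_eq_square power3_eq_cube)
  have n10: "gnorm M (\<lambda>j. (\<tau>\<^sup>2/8) *\<^sub>R r10 j) \<le> (1/16) * ?\<tau>3"
    using \<tau> by (intro sc[OF E1[of "Bop (Bop U)", folded r10_def] ws(8)]) (auto simp: power2_eq_square power3_eq_cube)
  have add: "gnorm M (\<lambda>j. r j + s j) \<le> c + d" if "gnorm M r \<le> c" "gnorm M s \<le> d" for r s c d
    using gnorm_triangle[of M r s] that by linarith
  have "gnorm M r5 \<le> ?\<tau>3 + (1/2) * ?\<tau>3 + (1/8) * ?\<tau>3 + ?\<tau>3"
    unfolding r5_def by (intro add n2 n3 n4) (simp add: gnorm_EA n1)
  moreover have t3: "0 \<le> ?\<tau>3" using w0 \<tau> by simp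
  ultimately have n5: "gnorm M (?E r5) \<le> 3 * ?\<tau>3" unfolding gnorm_EB by linarith
  have EU: "?E U = (\<lambda>j. U j + (\<tau>/2) *\<^sub>R Bop U j + (\<tau>\<^sup>2/8) *\<^sub>R Bop (Bop U) j + r1 j)"
    by (rule ext) (simp add: r1_def power_divide)
  have FEU: "?F (?E U) = (\<lambda>j. U j + \<tau> *\<^sub>R Aop U j + (\<tau>/2) *\<^sub>R Bop U j + (\<tau>\<^sup>2/2) *\<^sub>R Aop (Aop U) j
      + (\<tau>\<^sup>2/2) *\<^sub>R Aop (Bop U) j + (\<tau>\<^sup>2/8) *\<^sub>R Bop (Bop U) j + r5 j)"
  proof
    fix j
    have half: "(\<tau>\<^sup>2/2) *\<^sub>R x = (\<tau>/2) *\<^sub>R (\<tau> *\<^sub>R x)" for x :: "complex^2"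
      by (simp add: power2_eq_square)
    show "?F (?E U) j = U j + \<tau> *\<^sub>R Aop U j + (\<tau>/2) *\<^sub>R Bop U j + (\<tau>\<^sup>2/2) *\<^sub>R Aop (Aop U) j
      + (\<tau>\<^sup>2/2) *\<^sub>R Aop (Bop U) j + (\<tau>\<^sup>2/8) *\<^sub>R Bop (Bop U) j + r5 j"
      unfolding EU EA_add EA_scaleR
      unfolding r5_def r2_def r3_def r4_def half[of "Aop (Bop U) j"]
      by (simp add: scaleR_right_diff_distrib scaleR_right_distrib del: scaleR_scaleR)
  qed
  define D where "D j = r1 j + \<tau> *\<^sub>R r6 j + (\<tau>/2) *\<^sub>R r7 j + (\<tau>\<^sup>2/2) *\<^sub>R r8 j + (\<tau>\<^sup>2/2) *\<^sub>R r9 j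
      + (\<tau>\<^sup>2/8) *\<^sub>R r10 j + ?E r5 j" for j
  have DE: "?E (?F (?E U)) j - (U j + \<tau> *\<^sub>R (Aop U j + Bop U j)
    + (\<tau>\<^sup>2 / 2) *\<^sub>R (Aop (Aop U) j + Aop (Bop U) j + Bop (Aop U) j + Bop (Bop U) j)) = D j" for j
  proof -
    have sc: "\<tau> *\<^sub>R ((\<tau>/2) *\<^sub>R x) = (\<tau>\<^sup>2/2) *\<^sub>R x" "(\<tau>/2) *\<^sub>R ((\<tau>/2) *\<^sub>R x) = (\<tau>\<^sup>2/4) *\<^sub>R x"
      "((\<tau>/2)\<^sup>2 / 2) *\<^sub>R x = (\<tau>\<^sup>2/8) *\<^sub>R x" for x :: "complex^2"
      by (simp_all add: power2_eq_square)
    \<comment> \<open>The coefficient 1 / 2 of the square of \<open>Bop\<close> is assembled from 1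
      / 8 in each of the two half steps and 1 / 4 from their product.\<close>
    have q: "(\<tau>\<^sup>2/2) *\<^sub>R x = (\<tau>\<^sup>2/8) *\<^sub>R x + (\<tau>\<^sup>2/4) *\<^sub>R x + (\<tau>\<^sup>2/8) *\<^sub>R x"
      "\<tau> *\<^sub>R x = (\<tau>/2) *\<^sub>R x + (\<tau>/2) *\<^sub>R x" for x :: "complex^2"
      by (simp_all add: scaleR_left_distrib[symmetric])
    show ?thesis
      unfolding FEU EB_add EB_scaleR
      unfolding D_def r1_def r6_def r7_def r8_def r9_def r10_def scaleR_right_diff_distrib
        scaleR_right_distrib sc q(1)[of "Bop (Bop U) j"] q(2)[of "Bop U j"]
      by (simp add: algebra_simps)
  qed
  have "gnorm M D \<le> ?\<tau>3 + (1/4) * ?\<tau>3 + (1/8) * ?\<tau>3 + (1/4) * ?\<tau>3 + (1/4) * ?\<tau>3 + (1/16) * ?\<tau>3 + 3 * ?\<tau>3"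
    unfolding D_def by (intro add n1 n5 n6 n7 n8 n9 n10)
  \<comment> \<open>The contributions add up to 79 / 16, generously rounded up.\<close>
  also have "\<dots> \<le> 7 * ?\<tau>3" using w0 \<tau> by simp
  finally show ?thesis unfolding DE .
qed

text \<open>The difference \<open>q\<close> between \<open>p\<close> and the second Taylor
  polynomial of the undisturbed flow satisfies q' = X q + (s^2 / 2) X^3 U + \<delta>, where X is the
  sum of both operators. As X is skew, \<open>energy_bound\<close> sees the two forcing terms only:
  the defect \<delta> enters through its size and is never differentiated. The cube of X consists of
  eight words, whence the constant 4 = 8 / 2.\<close>

lemma exact_expansion:
  fixes p \<delta> :: "real \<Rightarrow> nat \<Rightarrow> complex^2"
  assumes w: "\<And>X Y Z. X \<in> {Aop, Bop} \<Longrightarrow> Y \<in> {Aop, Bop} \<Longrightarrow> Z \<in> {Aop, Bop} \<Longrightarrow> gnorm M (X (Y (Z (p 0)))) \<le> w"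
    and \<tau>: "0 \<le> \<tau>"
    and p: "\<And>s j. 0 \<le> s \<Longrightarrow> s \<le> \<tau> \<Longrightarrow> j < M \<Longrightarrow>
      ((\<lambda>s. p s j) has_vector_derivative (Aop (p s) j + Bop (p s) j + \<delta> s j)) (at s within {0..\<tau>})"
    and \<delta>: "\<And>s. 0 \<le> s \<Longrightarrow> s \<le> \<tau> \<Longrightarrow> gnorm M (\<delta> s) \<le> d"
  shows "gnorm M (\<lambda>j. p \<tau> j - (p 0 j + \<tau> *\<^sub>R (Aop (p 0) j + Bop (p 0) j)
    + (\<tau>\<^sup>2 / 2) *\<^sub>R (Aop (Aop (p 0)) j + Aop (Bop (p 0)) j + Bop (Aop (p 0)) j + Bop (Bop (p 0)) j)))
    \<le> 4 * (\<tau> ^ 3 * w) + \<tau> * d"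
proof -
  define U where "U = p 0"
  define X where "X V j = Aop V j + Bop V j" for V :: "nat \<Rightarrow> complex^2" and j
  have X_add: "X (\<lambda>j. V j + W j) j = X V j + X W j" for V W j
    by (simp add: X_def Aop_add Bop_add)
  have X_scaleR: "X (\<lambda>j. r *\<^sub>R V j) j = r *\<^sub>R X V j" for V r j
    by (simp add: X_def Aop_scaleR Bop_scaleR scaleR_right_distrib)
  have Xl: "X V = (\<lambda>j. Aop V j + Bop V j)" for V by (rule ext) (simp add: X_def)
  have X2: "X (X U) j = Aop (Aop U) j + Aop (Bop U) j + Bop (Aop U) j + Bop (Bop U) j" for j
    unfolding Xl[of U] X_add by (simp add: X_def)
  define q where "q s j = p s j - (U j + s *\<^sub>R X U j + (s\<^sup>2 / 2) *\<^sub>R X (X U) j)" for s j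
  define q' where "q' s j = X (q s) j + (s\<^sup>2 / 2) *\<^sub>R X (X (X U)) j + \<delta> s j" for s j
  have w8: "gnorm M (X (X (X U))) \<le> 8 * w"
  proof -
    have add: "gnorm M (\<lambda>j. r j + s j) \<le> c + d" if "gnorm M r \<le> c" "gnorm M s \<le> d" for r s c d
      using gnorm_triangle[of M r s] that by linarith
    have ws: "gnorm M (Aop (Aop (Aop U))) \<le> w" "gnorm M (Aop (Aop (Bop U))) \<le> w"
    "gnorm M (Aop (Bop (Aop U))) \<le> w" "gnorm M (Aop (Bop (Bop U))) \<le> w"
    "gnorm M (Bop (Aop (Aop U))) \<le> w" "gnorm M (Bop (Aop (Bop U))) \<le> w"
    "gnorm M (Bop (Bop (Aop U))) \<le> w" "gnorm M (Bop (Bop (Bop U))) \<le> w"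
    using w[of Aop Aop Aop] w[of Aop Aop Bop] w[of Aop Bop Aop] w[of Aop Bop Bop]
      w[of Bop Aop Aop] w[of Bop Aop Bop] w[of Bop Bop Aop] w[of Bop Bop Bop] by (simp_all add: U_def)
    have X2': "X (X U) = (\<lambda>j. Aop (Aop U) j + Aop (Bop U) j + Bop (Aop U) j + Bop (Bop U) j)"
      by (rule ext) (rule X2)
    have "gnorm M (X (X (X U))) \<le> (w + w) + (w + w) + (w + w) + (w + w)"
      unfolding X2' X_add unfolding Xl X_add
      unfolding X_def Aop_add Bop_add
      by (rule order_trans[OF eq_refl[OF gnorm_cong] add[OF add[OF add[OF ws(1) ws(2)] add[OF ws(3) ws(4)]]
              add[OF add[OF ws(5) ws(6)] add[OF ws(7) ws(8)]]], THEN order_trans]) simp_all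
    then show ?thesis by simp
  qed
  have d0: "0 \<le> d" using order_trans[OF gnorm_nonneg \<delta>[of 0]] \<tau> by simp
  have w0: "0 \<le> w" using order_trans[OF gnorm_nonneg w8] by simp
  have "gnorm M (q \<tau>) \<le> (4 * (\<tau>\<^sup>2 * w) + d) * \<tau>"
  proof (rule energy_bound[OF M(1) \<tau>, where q'=q'])
    show "q 0 j = 0" for j by (simp add: q_def U_def)
    show "((\<lambda>s. q s j) has_vector_derivative q' s j) (at s within {0..\<tau>})"
      if "0 \<le> s" "s \<le> \<tau>" "j < M" for s j
    proof -
      have "((\<lambda>s. q s j) has_vector_derivative
          (Aop (p s) j + Bop (p s) j + \<delta> s j) - (X U j + s *\<^sub>R X (X U) j)) (at s within {0..\<tau>})"
        unfolding q_def by (auto intro!: derivative_eq_intros p[OF that])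
      moreover have "(Aop (p s) j + Bop (p s) j + \<delta> s j) - (X U j + s *\<^sub>R X (X U) j) = q' s j"
      proof -
        have "p s = (\<lambda>j. q s j + (U j + s *\<^sub>R X U j + (s\<^sup>2 / 2) *\<^sub>R X (X U) j))"
          by (rule ext) (simp add: q_def)
        then have "X (p s) j = X (q s) j + (X U j + s *\<^sub>R X (X U) j + (s\<^sup>2 / 2) *\<^sub>R X (X (X U)) j)"
          by (simp only: X_add X_scaleR)
        then show ?thesis by (simp add: q'_def X_def)
      qed
      ultimately show ?thesis by simp
    qed
    show "(\<Sum>j<M. inner (q s j) (q' s j)) / real M \<le> gnorm M (q s) * (4 * (\<tau>\<^sup>2 * w) + d)"
      if "0 \<le> s" "s \<le> \<tau>" for s
    proof -
      define r where "r j = (s\<^sup>2 / 2) *\<^sub>R X (X (X U)) j + \<delta> s j" for j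
      have "(\<Sum>j<M. inner (q s j) (q' s j)) = (\<Sum>j<M. inner (q s j) (r j))"
        by (simp add: q'_def r_def X_def inner_add_right sum.distrib inner_Aop inner_Bop)
      then have "(\<Sum>j<M. inner (q s j) (q' s j)) / real M \<le> gnorm M (q s) * gnorm M r"
        using gnorm_inner_le[OF M(1), of "q s" r] by simp
      also have "gnorm M r \<le> 4 * (\<tau>\<^sup>2 * w) + d"
      proof -
        have "gnorm M r \<le> (s\<^sup>2 / 2) * gnorm M (X (X (X U))) + gnorm M (\<delta> s)"
          unfolding r_def by (rule order_trans[OF gnorm_triangle]) (simp add: gnorm_scaleR)
        also have "\<dots> \<le> (\<tau>\<^sup>2 / 2) * (8 * w) + d"
          using that w8 \<delta>[OF that] w0 by (intro add_mono mult_mono divide_right_mono power_mono) auto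
        finally show ?thesis by (simp add: mult.commute)
      qed
      finally show ?thesis by (simp add: mult_left_mono)
    qed
  qed (use d0 w0 in auto)
  also have "(4 * (\<tau>\<^sup>2 * w) + d) * \<tau> = 4 * (\<tau> ^ 3 * w) + \<tau> * d"
    by (simp add: algebra_simps power2_eq_square power3_eq_cube)
  finally show ?thesis unfolding q_def X2 unfolding X_def U_def by simp
qed

text \<open>Both flows have the same second Taylor polynomial at \<open>p 0\<close>; 11 = 4 + 7 adds
  the remainder constants of the exact and of the split flow.\<close>

lemma local_error:
  fixes p \<delta> :: "real \<Rightarrow> nat \<Rightarrow> complex^2"
  assumes \<beta>: "potential_bounded \<beta>" and p0: "gperiodic M (p 0)"
    and \<tau>: "0 \<le> \<tau>"
    and p: "\<And>s j. 0 \<le> s \<Longrightarrow> s \<le> \<tau> \<Longrightarrow> j < M \<Longrightarrow>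
      ((\<lambda>s. p s j) has_vector_derivative (Aop (p s) j + Bop (p s) j + \<delta> s j)) (at s within {0..\<tau>})"
    and \<delta>: "\<And>s. 0 \<le> s \<Longrightarrow> s \<le> \<tau> \<Longrightarrow> gnorm M (\<delta> s) \<le> d"
  shows "gnorm M (\<lambda>j. p \<tau> j - EB (\<tau> / 2) (EA \<tau> (EB (\<tau> / 2) (p 0))) j)
    \<le> 11 * (\<tau> ^ 3 * (((2 + 8 * \<beta>) / \<epsilon>) ^ 3 * sobolev \<rho> M 3 (p 0))) + \<tau> * d"
proof -
  let ?T = "\<lambda>j. p 0 j + \<tau> *\<^sub>R (Aop (p 0) j + Bop (p 0) j)
    + (\<tau>\<^sup>2 / 2) *\<^sub>R (Aop (Aop (p 0)) j + Aop (Bop (p 0)) j + Bop (Aop (p 0)) j + Bop (Bop (p 0)) j)"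
  let ?S = "EB (\<tau> / 2) (EA \<tau> (EB (\<tau> / 2) (p 0)))"
  note w = words_bound[OF \<beta> p0]
  have "gnorm M (\<lambda>j. p \<tau> j - ?S j) = gnorm M (\<lambda>j. (p \<tau> j - ?T j) - (?S j - ?T j))" by simp
  also have "\<dots> \<le> gnorm M (\<lambda>j. p \<tau> j - ?T j) + gnorm M (\<lambda>j. ?S j - ?T j)"
    by (rule gnorm_triangle_minus)
  also have "gnorm M (\<lambda>j. p \<tau> j - ?T j) \<le> 4 * (\<tau> ^ 3 * (((2 + 8 * \<beta>) / \<epsilon>) ^ 3 * sobolev \<rho> M 3 (p 0))) + \<tau> * d"
    by (rule exact_expansion[where p=p and \<delta>=\<delta>, OF _ \<tau> p \<delta>]) (rule w)
  also have "gnorm M (\<lambda>j. ?S j - ?T j) \<le> 7 * (\<tau> ^ 3 * (((2 + 8 * \<beta>) / \<epsilon>) ^ 3 * sobolev \<rho> M 3 (p 0)))"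
    by (rule strang_expansion[where U="p 0", OF _ \<tau>]) (rule w)
  finally show ?thesis by (simp add: mult.commute)
qed

end

section \<open>The projected solution\<close>

definition fdiff :: "real \<Rightarrow> (real \<Rightarrow> 'a::ab_group_add) \<Rightarrow> real \<Rightarrow> 'a" where
  "fdiff s f x = f (x + s) - f x"

text \<open>Substitute for bounds of the k-th derivatives by \<beta> / \<epsilon>^k: in the
  applications \<open>q\<close> is s / \<epsilon>. No derivative has to exist, so the condition
  makes sense for periodic extensions and passes to pointwise limits.\<close>

definition fdiff_bounded :: "real \<Rightarrow> real \<Rightarrow> nat \<Rightarrow> real \<Rightarrow> (real \<Rightarrow> 'a::real_normed_vector) \<Rightarrow> bool" where
  "fdiff_bounded s q m \<beta> f \<longleftrightarrow> (\<forall>k\<le>m. \<forall>x. norm ((fdiff s ^^ k) f x) \<le> \<beta> * q ^ k)"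

lemma fdiff_bounded_0: "fdiff_bounded s q m \<beta> f \<Longrightarrow> norm (f x) \<le> \<beta>"
  unfolding fdiff_bounded_def by (elim allE[of _ 0]) simp

lemma fdiff_bounded_nonneg: "fdiff_bounded s q m \<beta> f \<Longrightarrow> 0 \<le> \<beta>"
  using fdiff_bounded_0[of s q m \<beta> f 0] norm_ge_zero order_trans by blast

lemma fdiff_add: "fdiff s (\<lambda>x. f x + g x) = (\<lambda>x. fdiff s f x + fdiff s g x)"
  by (rule ext) (simp add: fdiff_def)

lemma fdiff_pow_add: "(fdiff s ^^ k) (\<lambda>x. f x + g x) = (\<lambda>x. (fdiff s ^^ k) f x + (fdiff s ^^ k) g x)"
  by (induction k) (simp_all add: fdiff_add)

lemma fdiff_pow_linear:
  assumes "\<And>x y. T (x - y) = T x - T y"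
  shows "(fdiff s ^^ k) (\<lambda>x. T (f x)) = (\<lambda>x. T ((fdiff s ^^ k) f x))"
  by (induction k) (simp_all add: fdiff_def fun_eq_iff assms)

lemma fdiff_pow_shift: "(fdiff s ^^ k) (\<lambda>x. f (x + r)) = (\<lambda>x. (fdiff s ^^ k) f (x + r))"
  by (induction k) (simp_all add: fdiff_def fun_eq_iff add.assoc add.commute add.left_commute)

text \<open>The Leibniz rule again: both terms carry one more factor \<open>q\<close>, and their
  number doubles with every order.\<close>

lemma fdiff_pow_mult_le:
  fixes u :: "real \<Rightarrow> real" and f :: "real \<Rightarrow> 'a::real_normed_vector"
  assumes "0 \<le> q"
  shows "fdiff_bounded s q k \<beta>1 u \<Longrightarrow> fdiff_bounded s q k \<beta>2 f \<Longrightarrow> norm ((fdiff s ^^ k) (\<lambda>x. u x *\<^sub>R f x) x) \<le> 2 ^ k * (\<beta>1 * \<beta>2) * q ^ k"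
proof (induction k arbitrary: u f \<beta>1 \<beta>2 x)
  case 0
  show ?case using fdiff_bounded_0[OF 0(1)] fdiff_bounded_0[OF 0(2)] by (simp add: mult_mono')
next
  case (Suc k)
  have split: "fdiff s (\<lambda>x. u x *\<^sub>R f x) = (\<lambda>x. fdiff s u x *\<^sub>R f (x + s) + u x *\<^sub>R fdiff s f x)"
    by (rule ext) (simp add: fdiff_def algebra_simps)
  have down: "fdiff_bounded s q k \<beta> g" if "fdiff_bounded s q (Suc k) \<beta> g" for \<beta> and g :: "real \<Rightarrow> 'b::real_normed_vector"
    using that by (simp add: fdiff_bounded_def)
  have diff: "fdiff_bounded s q k (\<beta> * q) (fdiff s g)" if "fdiff_bounded s q (Suc k) \<beta> g" for \<beta> and g :: "real \<Rightarrow> 'b::real_normed_vector"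
    unfolding fdiff_bounded_def
  proof (intro allI impI)
    fix i x assume "i \<le> k"
    then have "norm ((fdiff s ^^ Suc i) g x) \<le> \<beta> * q ^ Suc i" using that unfolding fdiff_bounded_def by blast
    then show "norm ((fdiff s ^^ i) (fdiff s g) x) \<le> \<beta> * q * q ^ i"
      by (simp add: funpow_swap1 mult.assoc)
  qed
  have shift: "fdiff_bounded s q k \<beta>2 (\<lambda>x. f (x + s))"
    using down[OF Suc.prems(2)] by (simp add: fdiff_bounded_def fdiff_pow_shift)
  have "(fdiff s ^^ Suc k) (\<lambda>x. u x *\<^sub>R f x) x
      = (fdiff s ^^ k) (\<lambda>x. fdiff s u x *\<^sub>R f (x + s)) x + (fdiff s ^^ k) (\<lambda>x. u x *\<^sub>R fdiff s f x) x"
    unfolding funpow_Suc_right o_def split fdiff_pow_add ..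
  also have "norm \<dots> \<le> 2 ^ k * ((\<beta>1 * q) * \<beta>2) * q ^ k + 2 ^ k * (\<beta>1 * (\<beta>2 * q)) * q ^ k"
    by (intro order_trans[OF norm_triangle_ineq] add_mono Suc.IH shift diff down Suc.prems)
  also have "\<dots> = 2 ^ Suc k * (\<beta>1 * \<beta>2) * q ^ Suc k" by simp
  finally show ?case .
qed

lemma node_Suc: "node a b N (Suc j) = node a b N j + mesh a b N"
  by (simp add: node_def algebra_simps)

lemma gdiff_pow_sample: "(gdiff ^^ k) (\<lambda>j. f (node a b N j)) = (\<lambda>j. (fdiff (mesh a b N) ^^ k) f (node a b N j))"
  by (induction k) (simp_all add: gdiff_def fdiff_def node_Suc fun_eq_iff)

lemma gperiodic_sample:
  assumes "0 < N" "\<And>x. f (x + (b - a)) = f x"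
  shows "gperiodic N (\<lambda>j. f (node a b N j))"
proof -
  have "node a b N (j + N) = node a b N j + (b - a)" for j
    using assms(1) by (simp add: node_def mesh_def field_simps)
  then show ?thesis using assms(2) by (simp add: gperiodic_def)
qed

lemma gnorm_sample_fdiff_bounded:
  assumes "0 < N" "fdiff_bounded (mesh a b N) q m \<beta> f" "k \<le> m"
  shows "gnorm N ((gdiff ^^ k) (\<lambda>j. f (node a b N j))) \<le> \<beta> * q ^ k"
  using assms unfolding gdiff_pow_sample fdiff_bounded_def by (intro gnorm_const_le) auto

lemma norm_dft_le:
  assumes "a < b" "0 < N" "\<And>j. j < N \<Longrightarrow> norm (U j) \<le> c"
  shows "norm (dft a b N U l) \<le> c"
proof -
  have "norm (dft a b N U l) \<le> (\<Sum>j<N. norm (U j)) / real N"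
    unfolding dft_omega[OF assms(1,2)]
    by (simp add: norm_divide divide_right_mono order_trans[OF norm_sum])
  also have "\<dots> \<le> (\<Sum>j<N. c) / real N"
    using assms(3) by (intro divide_right_mono sum_mono) auto
  finally show ?thesis using assms(2) by simp
qed

text \<open>The symbol of the fine difference agrees with its linearization up to a quadratic error;
  this is used for |l| <= M while N tends to infinity.\<close>

lemma omega_minus_1_approx: "cmod (omega N l - 1 - \<i> * of_real (2 * pi * of_int l / real N)) \<le> (2 * pi * of_int l / real N)\<^sup>2"
proof -
  have "cmod (iexp x - (\<Sum>k\<le>1. (\<i> * x) ^ k / fact k)) \<le> \<bar>x\<bar> ^ Suc 1 / fact (Suc 1)" for x
    by (rule iexp_approx1)
  from this[of "2 * pi * of_int l / real N"]
  have "cmod (omega N l - 1 - \<i> * of_real (2 * pi * of_int l / real N)) \<le> (2 * pi * of_int l / real N)\<^sup>2 / 2"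
    by (simp add: omega_def cis_conv_exp diff_diff_eq numeral_2_eq_2 abs_mult)
  also have "\<dots> \<le> (2 * pi * of_int l / real N)\<^sup>2" by simp
  finally show ?thesis .
qed

lemma has_vector_derivative_smult:
  assumes "(f has_vector_derivative f') F"
  shows "((\<lambda>x. c *s (f x :: complex^2)) has_vector_derivative c *s f') F"
proof -
  have "linear (\<lambda>x::complex^2. c *s x)"
    by (rule linearI) (simp_all add: vector_add_ldistrib smult_scaleR)
  then show ?thesis
    using bounded_linear.has_vector_derivative[OF _ assms] by (simp add: linear_conv_bounded_linear)
qed

text \<open>\<open>F t\<close>, \<open>V\<close> and \<open>A\<close> are the periodic extensions of the solution and of the potentials, and
  \<open>X t\<close> plays the role of \<open>\<partial>\<^sub>x\<Phi>(t)\<close>.\<close>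

locale dirac_fdiff =
  fixes a b \<epsilon> T c d :: real and m :: nat
    and V A :: "real \<Rightarrow> real" and F X :: "real \<Rightarrow> real \<Rightarrow> complex^2"
  assumes ab: "a < b" and eps: "0 < \<epsilon>" and m: "3 \<le> m"
    and V_per: "\<And>x. V (x + (b - a)) = V x"
    and A_per: "\<And>x. A (x + (b - a)) = A x"
    and F_per: "\<And>t x. F t (x + (b - a)) = F t x"
    and V_fdiff_bounded: "\<And>s. 0 < s \<Longrightarrow> s \<le> b - a \<Longrightarrow> fdiff_bounded s (s / \<epsilon>) m d V"
    and A_fdiff_bounded: "\<And>s. 0 < s \<Longrightarrow> s \<le> b - a \<Longrightarrow> fdiff_bounded s (s / \<epsilon>) m d A"
    and F_fdiff_bounded: "\<And>t s. 0 \<le> t \<Longrightarrow> t \<le> T \<Longrightarrow> 0 < s \<Longrightarrow> s \<le> b - a \<Longrightarrow> fdiff_bounded s (s / \<epsilon>) m c (F t)"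
    and X: "\<And>t x s. 0 \<le> t \<Longrightarrow> t \<le> T \<Longrightarrow> a \<le> x \<Longrightarrow> 0 < s \<Longrightarrow> x + s \<le> b \<Longrightarrow>
      norm (F t (x + s) - F t x - s *\<^sub>R X t x) \<le> c * (s / \<epsilon>)\<^sup>2"
    and pde: "\<And>t x. 0 \<le> t \<Longrightarrow> t \<le> T \<Longrightarrow> a \<le> x \<Longrightarrow> x < b \<Longrightarrow>
      ((\<lambda>s. F s x) has_vector_derivative
        (pot_gen \<epsilon> (V x) (A x) *v F t x - (\<i> / of_real \<epsilon>) *s (sigma3 *v F t x) - sigma1 *v X t x))
        (at t within {0..T})"
begin

definition WF :: "real \<Rightarrow> real \<Rightarrow> complex^2" where
  "WF t x = pot_gen \<epsilon> (V x) (A x) *v F t x"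

lemma WF_per: "WF t (x + (b - a)) = WF t x"
  by (simp add: WF_def V_per A_per F_per)

lemma WF_fdiff:
  assumes "0 \<le> t" "t \<le> T" "0 < s" "s \<le> b - a"
  shows "norm ((fdiff s ^^ m) (WF t) x) \<le> 2 * 2 ^ m * (d * c) / \<epsilon> * (s / \<epsilon>) ^ m"
proof -
  have eq: "WF t = (\<lambda>x. (- \<i> / of_real \<epsilon>) *s (V x *\<^sub>R F t x) + (\<i> / of_real \<epsilon>) *s (sigma1 *v (A x *\<^sub>R F t x)))"
    by (rule ext) (simp add: WF_def pot_gen_vec matrix_vector_scaleR)
  have lin: "(\<i> / of_real \<epsilon>) *s (sigma1 *v (x - y)) = (\<i> / of_real \<epsilon>) *s (sigma1 *v x) - (\<i> / of_real \<epsilon>) *s (sigma1 *v y)"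
    "(- \<i> / of_real \<epsilon>) *s (x - y) = (- \<i> / of_real \<epsilon>) *s x - (- \<i> / of_real \<epsilon>) *s y" for x y :: "complex^2"
    by (simp_all add: matrix_vector_mult_diff_distrib vec2_eq_iff algebra_simps)
  have "(fdiff s ^^ m) (WF t) x = (- \<i> / of_real \<epsilon>) *s (fdiff s ^^ m) (\<lambda>x. V x *\<^sub>R F t x) x
      + (\<i> / of_real \<epsilon>) *s (sigma1 *v (fdiff s ^^ m) (\<lambda>x. A x *\<^sub>R F t x) x)"
    unfolding eq fdiff_pow_add
      fdiff_pow_linear[of "\<lambda>x. (- \<i> / of_real \<epsilon>) *s x", OF lin(2)]
      fdiff_pow_linear[of "\<lambda>x. (\<i> / of_real \<epsilon>) *s (sigma1 *v x)", OF lin(1)] ..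
  then have "norm ((fdiff s ^^ m) (WF t) x) \<le> norm ((- \<i> / of_real \<epsilon>) *s (fdiff s ^^ m) (\<lambda>x. V x *\<^sub>R F t x) x)
      + norm ((\<i> / of_real \<epsilon>) *s (sigma1 *v (fdiff s ^^ m) (\<lambda>x. A x *\<^sub>R F t x) x))"
    by (simp only: norm_triangle_ineq)
  also have "\<dots> = (1 / \<epsilon>) * norm ((fdiff s ^^ m) (\<lambda>x. V x *\<^sub>R F t x) x)
      + (1 / \<epsilon>) * norm ((fdiff s ^^ m) (\<lambda>x. A x *\<^sub>R F t x) x)"
    using eps by (simp add: norm_divide)
  also have "\<dots> \<le> (1 / \<epsilon>) * (2 ^ m * (d * c) * (s / \<epsilon>) ^ m) + (1 / \<epsilon>) * (2 ^ m * (d * c) * (s / \<epsilon>) ^ m)"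
    using assms eps
    by (intro add_mono mult_left_mono fdiff_pow_mult_le V_fdiff_bounded A_fdiff_bounded F_fdiff_bounded) auto
  also have "\<dots> = 2 * 2 ^ m * (d * c) / \<epsilon> * (s / \<epsilon>) ^ m" by simp
  finally show ?thesis .
qed

end

locale dirac_grid = dirac_fdiff +
  fixes M Q :: nat
  assumes M: "0 < M" "even M"
begin

text \<open>Odd, so that the fine modes split into symmetric blocks of coarse ones.\<close>

definition K where "K = 2 * Q + 1"
definition N where "N = K * M"
definition h where "h = mesh a b M"
definition h' where "h' = mesh a b N"

lemma K: "0 < K" "odd K" by (simp_all add: K_def)
lemma N: "0 < N" "even N" using K M by (simp_all add: N_def)

lemma h_pos: "0 < h" "h \<le> b - a" "0 < h'" "h' \<le> b - a" and Kh: "real K * h' = h"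
proof -
  have le: "(b - a) / real n \<le> b - a" if "0 < n" for n
    using that ab by (simp add: divide_le_eq)
  show "0 < h" "h \<le> b - a" "0 < h'" "h' \<le> b - a"
    using ab M N le by (simp_all add: h_def h'_def mesh_def)
  show "real K * h' = h" using K M by (simp add: h_def h'_def mesh_def N_def)
qed

lemma node_fine: "node a b N (K * j) = node a b M j"
  using Kh by (simp add: node_def h_def h'_def mult.commute mult.left_commute)

sublocale G: grid_dirac a b \<epsilon> M "\<lambda>j. V (node a b M j)" "\<lambda>j. A (node a b M j)"
  by unfold_locales (use ab eps M gperiodic_sample V_per A_per in auto)

text \<open>Plays the role of the Fourier coefficients of the solution at time t. They are taken on
  the fine grid, where restricting the frequencies to \<open>modes M\<close> is a genuine
  projection; on the coarse grid the same formula would give interpolation.\<close>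

definition P :: "real \<Rightarrow> int \<Rightarrow> complex^2" where
  "P t = dft a b N (\<lambda>i. F t (node a b N i))"

definition p :: "real \<Rightarrow> nat \<Rightarrow> complex^2" where
  "p t = trig_sum M (modes M) (P t)"

definition \<theta> where "\<theta> = (h / \<epsilon>) ^ m"

lemma theta_nonneg: "0 \<le> \<theta>" using h_pos eps by (simp add: \<theta>_def)

lemma Kq: "real K * (h' / \<epsilon>) = h / \<epsilon>" using Kh by simp

lemma dft_p: "l \<in> modes M \<Longrightarrow> dft a b M (p t) l = P t l"
  unfolding p_def by (rule dft_trig_sum[OF ab M(1) G.dist])

lemma F_gperiodic: "gperiodic N (\<lambda>i. F t (node a b N i))"
  using N F_per by (intro gperiodic_sample)

text \<open>K times the fine step is the coarse step, so the factor K^m from the truncation turns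
  the bound of the m-th fine difference into (h / \<epsilon>)^m.\<close>

lemma trunc_bound:
  assumes "0 \<le> t" "t \<le> T"
  shows "4 * (real K ^ m * gnorm N ((gdiff ^^ m) (\<lambda>i. F t (node a b N i)))) \<le> 4 * c * \<theta>"
proof -
  have "gnorm N ((gdiff ^^ m) (\<lambda>i. F t (node a b N i))) \<le> c * (h' / \<epsilon>) ^ m"
    using assms h_pos N F_fdiff_bounded by (intro gnorm_sample_fdiff_bounded[where m=m]) (auto simp: h'_def)
  then have "real K ^ m * gnorm N ((gdiff ^^ m) (\<lambda>i. F t (node a b N i))) \<le> real K ^ m * (c * (h' / \<epsilon>) ^ m)"
    by (intro mult_left_mono) auto
  also have "\<dots> = c * (real K * (h' / \<epsilon>)) ^ m" by (simp add: power_mult_distrib power_divide)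
  finally show ?thesis unfolding Kq \<theta>_def by simp
qed

lemma F_minus_p:
  assumes "0 \<le> t" "t \<le> T"
  shows "gnorm M (\<lambda>j. F t (node a b M j) - p t j) \<le> 4 * c * \<theta>"
  using order_trans[OF truncation_coarse[OF ab M(2,1) K_def F_gperiodic[unfolded N_def]] trunc_bound[OF assms, unfolded N_def]] m
  by (simp add: p_def P_def node_fine[unfolded N_def] N_def)

lemma F_minus_p_fine:
  assumes "0 \<le> t" "t \<le> T"
  shows "gnorm N (\<lambda>i. F t (node a b N i) - trig_sum N (modes M) (P t) i) \<le> 4 * c * \<theta>"
  using order_trans[OF truncation_fine[OF ab M(2,1) K_def F_gperiodic[unfolded N_def]] trunc_bound[OF assms, unfolded N_def]] m
  by (simp add: P_def N_def)

lemma WF_trunc: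
  assumes "0 \<le> t" "t \<le> T"
  shows "gnorm M (\<lambda>j. WF t (node a b M j) - trig_sum M (modes M) (dft a b N (\<lambda>i. WF t (node a b N i))) j)
    \<le> 8 * 2 ^ m * (d * c) / \<epsilon> * \<theta>"
proof -
  let ?U = "\<lambda>i. WF t (node a b N i)"
  have per: "gperiodic N ?U" using N WF_per by (intro gperiodic_sample)
  have "gnorm N ((gdiff ^^ m) ?U) \<le> 2 * 2 ^ m * (d * c) / \<epsilon> * (h' / \<epsilon>) ^ m"
    unfolding gdiff_pow_sample using assms h_pos N WF_fdiff unfolding h'_def by (intro gnorm_const_le) auto
  then have "real K ^ m * gnorm N ((gdiff ^^ m) ?U) \<le> real K ^ m * (2 * 2 ^ m * (d * c) / \<epsilon> * (h' / \<epsilon>) ^ m)"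
    by (intro mult_left_mono) auto
  also have "\<dots> = 2 * 2 ^ m * (d * c) / \<epsilon> * (real K * (h' / \<epsilon>)) ^ m" by (simp add: power_mult_distrib power_divide)
  also have "\<dots> = 2 * 2 ^ m * (d * c) / \<epsilon> * \<theta>" unfolding Kq \<theta>_def ..
  finally have "4 * (real K ^ m * gnorm N ((gdiff ^^ m) ?U)) \<le> 8 * 2 ^ m * (d * c) / \<epsilon> * \<theta>" by simp
  with truncation_coarse[OF ab M(2,1) K_def per[unfolded N_def], of m] m
  show ?thesis by (simp add: N_def node_fine[unfolded N_def])
qed

text \<open>27 = (1 + 2)^3: the norm of order three weights the differences binomially, and the k-th
  difference of the projection costs 2^k.\<close>

lemma sobolev_p:
  assumes "0 \<le> t" "t \<le> T"
  shows "sobolev G.\<rho> M 3 (p t) \<le> 27 * c"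
proof -
  have \<rho>: "G.\<rho> = \<epsilon> / h" by (simp add: G.\<rho>_def h_def)
  have g: "G.\<rho> ^ k * gnorm M ((gdiff ^^ k) (p t)) \<le> 2 ^ k * c" if "k \<le> 3" for k
  proof -
    have "gnorm M ((gdiff ^^ k) (p t)) \<le> (2 * real K) ^ k * gnorm N ((gdiff ^^ k) (\<lambda>i. F t (node a b N i)))"
      unfolding p_def P_def N_def
      by (rule projection_smooth[OF ab M(2,1) K F_gperiodic[unfolded N_def]])
    also have "\<dots> \<le> (2 * real K) ^ k * (c * (h' / \<epsilon>) ^ k)"
      using that assms h_pos N F_fdiff_bounded m by (intro mult_left_mono gnorm_sample_fdiff_bounded[where m=m]) (auto simp: h'_def)
    also have "\<dots> = 2 ^ k * c * (real K * (h' / \<epsilon>)) ^ k" by (simp add: power_mult_distrib power_divide)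
    finally have "gnorm M ((gdiff ^^ k) (p t)) \<le> 2 ^ k * c * (h / \<epsilon>) ^ k" unfolding Kq .
    then have "G.\<rho> ^ k * gnorm M ((gdiff ^^ k) (p t)) \<le> G.\<rho> ^ k * (2 ^ k * c * (h / \<epsilon>) ^ k)"
      using G.rho_pos by (intro mult_left_mono) auto
    also have "\<dots> = 2 ^ k * c * (G.\<rho> * (h / \<epsilon>)) ^ k" by (simp only: power_mult_distrib mult_ac)
    also have "G.\<rho> * (h / \<epsilon>) = 1" using h_pos eps by (simp add: \<rho>)
    finally show ?thesis by simp
  qed
  have "sobolev G.\<rho> M 3 (p t) = gnorm M (p t) + 3 * (G.\<rho> ^ 1 * gnorm M ((gdiff ^^ 1) (p t)))
      + 3 * (G.\<rho> ^ 2 * gnorm M ((gdiff ^^ 2) (p t))) + G.\<rho> ^ 3 * gnorm M ((gdiff ^^ 3) (p t))"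
    by (simp add: numeral_2_eq_2 numeral_3_eq_3 algebra_simps)
  also have "\<dots> \<le> c + 3 * (2 ^ 1 * c) + 3 * (2 ^ 2 * c) + 2 ^ 3 * c"
    using g[of 0] g[of 1] g[of 2] g[of 3] by simp
  finally show ?thesis by simp
qed

lemma potential_bounded_d: "G.potential_bounded d"
proof -
  have "fdiff_bounded h (h / \<epsilon>) m d V" "fdiff_bounded h (h / \<epsilon>) m d A" using h_pos V_fdiff_bounded A_fdiff_bounded by auto
  moreover have "G.\<rho> ^ i * y \<le> d" if "y \<le> d * (h / \<epsilon>) ^ i" for y i
  proof -
    have "G.\<rho> ^ i * y \<le> G.\<rho> ^ i * (d * (h / \<epsilon>) ^ i)" using that G.rho_pos by (intro mult_left_mono) auto
    also have "\<dots> = d * (G.\<rho> * (h / \<epsilon>)) ^ i" by (simp only: power_mult_distrib mult_ac)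
    also have "G.\<rho> * (h / \<epsilon>) = 1" using h_pos eps by (simp add: G.\<rho>_def h_def)
    finally show ?thesis by simp
  qed
  ultimately show ?thesis
    unfolding G.potential_bounded_def gdiff_pow_sample fdiff_bounded_def h_def using m by auto
qed

section \<open>Defect of the projected equation\<close>

definition derivative_defect where "derivative_defect = (c / \<epsilon>\<^sup>2 + (2 * pi * real M / (b - a))\<^sup>2 * c) * h'"

definition dtF :: "real \<Rightarrow> real \<Rightarrow> complex^2" where
  "dtF t x = WF t x - (\<i> / of_real \<epsilon>) *s (sigma3 *v F t x) - sigma1 *v X t x"

text \<open>The error made by treating the x-derivative as multiplication by the frequency. The
  potential term is kept as sampled on the fine grid and contributes nothing here.\<close>

definition r :: "real \<Rightarrow> int \<Rightarrow> complex^2" where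
  "r t l = dft a b N (\<lambda>i. dtF t (node a b N i)) l
     - (free_gen \<epsilon> (mu a b l) *v P t l + dft a b N (\<lambda>i. WF t (node a b N i)) l)"

lemma node_bounds: "i < N \<Longrightarrow> a \<le> node a b N i \<and> node a b N i + h' \<le> b"
proof -
  assume "i < N"
  then have "real (Suc i) * h' \<le> real N * h'" using h_pos by (intro mult_right_mono) auto
  also have "\<dots> = b - a" using N by (simp add: h'_def mesh_def)
  finally have "(real i + 1) * h' \<le> b - a" by (simp add: add.commute)
  then show ?thesis using h_pos by (simp add: node_def h'_def[symmetric] algebra_simps)
qed

text \<open>Two errors of first order in \<open>h'\<close>: the difference quotient against the
  derivative, with constant c / \<epsilon>^2, and the difference symbol against the frequency,
  quadratic in |l| <= M. The dependence on M is harmless because M is fixed when the fine grid is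
  refined.\<close>

lemma norm_r:
  assumes t: "0 \<le> t" "t \<le> T" and l: "l \<in> modes M"
  shows "norm (r t l) \<le> derivative_defect"
proof -
  let ?z = "node a b N"
  define e where "e i = (1 / h') *\<^sub>R gdiff (\<lambda>i. F t (?z i)) i - X t (?z i)" for i
  have c: "0 \<le> c" using fdiff_bounded_nonneg[OF F_fdiff_bounded[OF t h_pos(1,2)]] .
  have e: "norm (e i) \<le> c * h' / \<epsilon>\<^sup>2" if "i < N" for i
  proof -
    have "norm (F t (?z i + h') - F t (?z i) - h' *\<^sub>R X t (?z i)) \<le> c * (h' / \<epsilon>)\<^sup>2"
      using node_bounds[OF that] h_pos t by (intro X) auto
    moreover have "e i = (1 / h') *\<^sub>R (F t (?z i + h') - F t (?z i) - h' *\<^sub>R X t (?z i))"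
      using h_pos by (simp add: e_def gdiff_def node_Suc h'_def[symmetric] scaleR_right_diff_distrib)
    ultimately have "norm (e i) \<le> (1 / h') * (c * (h' / \<epsilon>)\<^sup>2)"
      using h_pos by (simp add: divide_right_mono)
    also have "\<dots> = c * h' / \<epsilon>\<^sup>2" using h_pos by (simp add: power2_eq_square)
    finally show ?thesis .
  qed
  have Pl: "norm (P t l) \<le> c"
    unfolding P_def using fdiff_bounded_0[OF F_fdiff_bounded[OF t h_pos(1,2)]] by (intro norm_dft_le ab N) auto
  define x where "x = 2 * pi * of_int l / real N"
  have mu: "mu a b l = x / h'" using ab N by (simp add: mu_def x_def h'_def mesh_def)
  \<comment> \<open>\<open>X\<close> is written as the difference quotient minus the error
    \<open>e\<close>, since differences are what the transform turns into multiplication.\<close>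
  have dtF: "dtF t (?z i) = WF t (?z i) + (- (\<i> / of_real \<epsilon>)) *s (sigma3 *v F t (?z i))
      + (-1) *\<^sub>R (sigma1 *v ((1 / h') *\<^sub>R gdiff (\<lambda>i. F t (?z i)) i)) + sigma1 *v e i" for i
    by (simp add: dtF_def e_def matrix_vector_mult_diff_distrib vec2_eq_iff)
  have dft_sig: "dft a b N (\<lambda>i. S *v U i) l = S *v dft a b N U l" for S :: "complex^2^2" and U
    unfolding dft_omega[OF ab N(1)]
    by (simp add: vec2_eq_iff matrix_vector_mult_2 sum.distrib sum_distrib_left algebra_simps)
  have dgd: "dft a b N (gdiff (\<lambda>i. F t (?z i))) l = (omega N l - 1) *s P t l"
    unfolding P_def by (rule dft_gdiff[OF ab N(1) F_gperiodic])
  have D: "dft a b N (\<lambda>i. dtF t (?z i)) l = dft a b N (\<lambda>i. WF t (?z i)) l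
      + (- (\<i> / of_real \<epsilon>)) *s (sigma3 *v P t l)
      + (-1) *\<^sub>R (sigma1 *v ((1 / h') *\<^sub>R ((omega N l - 1) *s P t l))) + sigma1 *v dft a b N e l"
    unfolding dtF dft_add dft_smult dft_sig dft_scaleR dgd P_def[symmetric] ..
  have "sigma1 *v ((1 / h') *\<^sub>R ((omega N l - 1 - \<i> * of_real x) *s P t l))
      = sigma1 *v ((1 / h') *\<^sub>R ((omega N l - 1) *s P t l)) + (- \<i> * of_real (x / h')) *s (sigma1 *v P t l)"
    by (simp add: vec2_eq_iff sigma1_vec scaleR_conv_of_real[where 'a=complex] divide_inverse algebra_simps)
  then have "r t l = sigma1 *v (dft a b N e l - (1 / h') *\<^sub>R ((omega N l - 1 - \<i> * of_real x) *s P t l))"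
    unfolding r_def D free_gen_vec mu matrix_vector_mult_diff_distrib by (simp add: vec2_eq_iff)
  then have "norm (r t l) \<le> norm (dft a b N e l)
      + norm ((1 / h') *\<^sub>R ((omega N l - 1 - \<i> * of_real x) *s P t l))"
    by (simp only: norm_sigma1 norm_triangle_ineq4)
  also have "\<dots> = norm (dft a b N e l) + (1 / h') * (cmod (omega N l - 1 - \<i> * of_real x) * norm (P t l))"
    using h_pos by (simp only: norm_scaleR norm_smult_vec abs_of_nonneg zero_le_divide_1_iff less_imp_le)
  also have "\<dots> \<le> c * h' / \<epsilon>\<^sup>2 + (1 / h') * (x\<^sup>2 * c)"
    using e h_pos Pl omega_minus_1_approx[of N l]
    by (intro add_mono mult_left_mono mult_mono norm_dft_le ab N) (auto simp: x_def)
  also have "\<dots> \<le> derivative_defect"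
  proof -
    have "2 * \<bar>l\<bar> \<le> int M" using l M(2) unfolding modes_def by auto
    then have "\<bar>of_int l\<bar> \<le> real M" by linarith
    then have "\<bar>x\<bar> \<le> 2 * pi * real M / real N"
      by (simp add: x_def abs_mult divide_right_mono)
    also have "\<dots> = (2 * pi * real M / (b - a)) * h'" using ab N by (simp add: h'_def mesh_def)
    finally have "\<bar>x\<bar>\<^sup>2 \<le> ((2 * pi * real M / (b - a)) * h')\<^sup>2" by (intro power_mono) auto
    then have "(1 / h') * (x\<^sup>2 * c) \<le> (1 / h') * (((2 * pi * real M / (b - a)) * h')\<^sup>2 * c)"
      using c h_pos by (intro mult_left_mono mult_right_mono) auto
    also have "\<dots> = (2 * pi * real M / (b - a))\<^sup>2 * c * h'"
      using h_pos by (simp add: power_mult_distrib power2_eq_square)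
    finally show ?thesis by (simp add: derivative_defect_def algebra_simps)
  qed
  finally show ?thesis .
qed

lemma P_deriv:
  assumes "0 \<le> t" "t \<le> T"
  shows "((\<lambda>t. P t l) has_vector_derivative
    (free_gen \<epsilon> (mu a b l) *v P t l + dft a b N (\<lambda>i. WF t (node a b N i)) l + r t l)) (at t within {0..T})"
proof -
  have "((\<lambda>t. F t (node a b N i)) has_vector_derivative dtF t (node a b N i)) (at t within {0..T})" if "i < N" for i
    using pde[of t "node a b N i"] node_bounds[OF that] assms h_pos by (simp add: dtF_def WF_def)
  then have "((\<lambda>t. P t l) has_vector_derivative dft a b N (\<lambda>i. dtF t (node a b N i)) l) (at t within {0..T})"
    unfolding P_def dft_def
    by (intro has_vector_derivative_smult has_vector_derivative_sum) auto
  then show ?thesis by (simp add: r_def)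
qed

text \<open>Multiplication by the potential does not commute with the projection, and the first two
  terms measure this mismatch. The free part acts mode by mode, hence commutes and leaves only
  \<open>r\<close>.\<close>

definition \<delta> :: "real \<Rightarrow> nat \<Rightarrow> complex^2" where
  "\<delta> t j = trig_sum M (modes M) (dft a b N (\<lambda>i. WF t (node a b N i))) j - G.Bop (p t) j + trig_sum M (modes M) (r t) j"

definition defect_bound where "defect_bound = 16 * 2 ^ m * (d * c) / \<epsilon> * \<theta> + sqrt (real M) * derivative_defect"

lemma p_deriv:
  assumes "0 \<le> t" "t \<le> T"
  shows "((\<lambda>t. p t j) has_vector_derivative (G.Aop (p t) j + G.Bop (p t) j + \<delta> t j)) (at t within {0..T})"
proof -
  have "((\<lambda>t. p t j) has_vector_derivative trig_sum M (modes M)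
    (\<lambda>l. free_gen \<epsilon> (mu a b l) *v P t l + dft a b N (\<lambda>i. WF t (node a b N i)) l + r t l) j) (at t within {0..T})"
    unfolding p_def trig_sum_def
    by (intro has_vector_derivative_sum has_vector_derivative_smult P_deriv assms)
  moreover have "G.Aop (p t) = trig_sum M (modes M) (\<lambda>l. free_gen \<epsilon> (mu a b l) *v P t l)"
    unfolding G.Aop_def by (rule G.trig_sum_cong) (simp add: dft_p)
  ultimately show ?thesis by (simp add: \<delta>_def trig_sum_add add.assoc)
qed

lemma norm_pot: "norm (pot_gen \<epsilon> (V x) (A x) *v y) \<le> 2 * d / \<epsilon> * norm y"
proof -
  have V: "\<bar>V x\<bar> \<le> d" "\<bar>A x\<bar> \<le> d"
    using fdiff_bounded_0[OF V_fdiff_bounded[OF h_pos(1,2)]] fdiff_bounded_0[OF A_fdiff_bounded[OF h_pos(1,2)]] by auto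
  have "norm (pot_gen \<epsilon> (V x) (A x) *v y) \<le> (1 / \<epsilon>) * (\<bar>V x\<bar> * norm y) + (1 / \<epsilon>) * (\<bar>A x\<bar> * norm y)"
    unfolding pot_gen_vec using eps by (intro order_trans[OF norm_triangle_ineq]) (simp add: norm_divide)
  also have "\<dots> \<le> (1 / \<epsilon>) * (d * norm y) + (1 / \<epsilon>) * (d * norm y)"
    using V eps by (intro add_mono mult_left_mono mult_right_mono) auto
  finally show ?thesis by simp
qed

text \<open>The defect splits into the truncation error of the potential term, the potential applied
  to the truncated part of the solution, and \<open>r\<close>. The first two have the same bound,
  whence 16 = 8 + 8.\<close>

lemma gnorm_delta:
  assumes "0 \<le> t" "t \<le> T"
  shows "gnorm M (\<delta> t) \<le> defect_bound"
proof -
  let ?W = "\<lambda>j. WF t (node a b M j)"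
  let ?PW = "trig_sum M (modes M) (dft a b N (\<lambda>i. WF t (node a b N i)))"
  have d: "0 \<le> d" "0 \<le> c"
    using fdiff_bounded_nonneg[OF V_fdiff_bounded[OF h_pos(1,2)]] fdiff_bounded_nonneg[OF F_fdiff_bounded[OF assms h_pos(1,2)]] by auto
  have "\<delta> t = (\<lambda>j. ((?PW j - ?W j) + (?W j - G.Bop (p t) j)) + trig_sum M (modes M) (r t) j)"
    by (rule ext) (simp add: \<delta>_def)
  then have "gnorm M (\<delta> t) \<le> gnorm M (\<lambda>j. ?PW j - ?W j) + gnorm M (\<lambda>j. ?W j - G.Bop (p t) j)
      + gnorm M (trig_sum M (modes M) (r t))"
    using gnorm_triangle[of M "\<lambda>j. (?PW j - ?W j) + (?W j - G.Bop (p t) j)" "trig_sum M (modes M) (r t)"]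
      gnorm_triangle[of M "\<lambda>j. ?PW j - ?W j" "\<lambda>j. ?W j - G.Bop (p t) j"] by simp
  moreover have "gnorm M (\<lambda>j. ?PW j - ?W j) \<le> 8 * 2 ^ m * (d * c) / \<epsilon> * \<theta>"
    using WF_trunc[OF assms] by (simp add: gnorm_minus)
  moreover have "gnorm M (\<lambda>j. ?W j - G.Bop (p t) j) \<le> 8 * 2 ^ m * (d * c) / \<epsilon> * \<theta>"
  proof -
    have "gnorm M (\<lambda>j. ?W j - G.Bop (p t) j) \<le> 2 * d / \<epsilon> * gnorm M (\<lambda>j. F t (node a b M j) - p t j)"
      using d eps norm_pot
      by (intro gnorm_le_mult) (simp_all only: WF_def G.Bop_def matrix_vector_mult_diff_distrib[symmetric] mult_nonneg_nonneg divide_nonneg_pos zero_le_numeral)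
    also have "\<dots> \<le> 2 * d / \<epsilon> * (4 * c * \<theta>)"
      using d eps by (intro mult_left_mono F_minus_p assms) auto
    also have "\<dots> = 8 * 1 * (d * c) / \<epsilon> * \<theta>" by simp
    also have "\<dots> \<le> 8 * 2 ^ m * (d * c) / \<epsilon> * \<theta>"
      using d eps theta_nonneg by (intro mult_right_mono divide_right_mono mult_left_mono) auto
    finally show ?thesis .
  qed
  moreover have "gnorm M (trig_sum M (modes M) (r t)) \<le> sqrt (real M) * derivative_defect"
  proof -
    \<comment> \<open>Each of the M modes contributes at most \<open>derivative_defect\<close>; the
      resulting factor sqrt M disappears together with it in the limit of the fine grid.\<close>
    have "card (modes M) = M" using M by (auto simp: modes_def elim!: evenE)
    moreover have R0: "0 \<le> derivative_defect" using d h_pos by (simp add: derivative_defect_def)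
    moreover have "L2_set (\<lambda>l. norm (r t l)) (modes M) \<le> L2_set (\<lambda>l. derivative_defect) (modes M)"
      using norm_r[OF assms] by (intro L2_set_mono) auto
    ultimately show ?thesis
      by (simp add: gnorm_trig_sum[OF M(1) G.dist] L2_set_def real_sqrt_mult)
  qed
  moreover have "16 * 2 ^ m * (d * c) / \<epsilon> * \<theta> = 8 * 2 ^ m * (d * c) / \<epsilon> * \<theta> + 8 * 2 ^ m * (d * c) / \<epsilon> * \<theta>"
    by simp
  moreover have "g \<le> z + y" if "g \<le> x1 + x2 + x3" "x1 \<le> x" "x2 \<le> x" "x3 \<le> y" "z = x + x"
    for g x1 x2 x3 x y z :: real
    using that by linarith
  ultimately show ?thesis unfolding defect_bound_def by blast
qed

section \<open>Accumulation of the local errors\<close>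

lemma EA_diff: "G.EA s U j - G.EA s W j = G.EA s (\<lambda>j. U j - W j) j"
  using G.EA_add[of s "\<lambda>j. U j - W j" W j] by simp

lemma EB_diff: "G.EB s U j - G.EB s W j = G.EB s (\<lambda>j. U j - W j) j"
  using G.EB_add[of s "\<lambda>j. U j - W j" W j] by simp

definition strang_step :: "real \<Rightarrow> (nat \<Rightarrow> complex^2) \<Rightarrow> nat \<Rightarrow> complex^2" where
  "strang_step \<tau> U = G.EB (\<tau> / 2) (G.EA \<tau> (G.EB (\<tau> / 2) U))"

lemma gnorm_St_diff: "gnorm M (\<lambda>j. strang_step \<tau> U j - strang_step \<tau> W j) = gnorm M (\<lambda>j. U j - W j)"
  unfolding strang_step_def EB_diff EA_diff G.gnorm_EB G.gnorm_EA ..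

text \<open>The local error estimate restarted at time t; 297 = 11 * 27 combines its constant with
  the one of \<open>sobolev_p\<close>.\<close>

lemma p_step:
  assumes "0 \<le> t" "0 \<le> \<tau>" "t + \<tau> \<le> T"
  shows "gnorm M (\<lambda>j. p (t + \<tau>) j - strang_step \<tau> (p t) j) \<le> \<tau> * (297 * c * (2 + 8 * d) ^ 3 * (\<tau>\<^sup>2 / \<epsilon> ^ 3) + defect_bound)"
proof -
  have d: "0 \<le> d" "0 \<le> c"
    using fdiff_bounded_nonneg[OF V_fdiff_bounded[OF h_pos(1,2)]] fdiff_bounded_nonneg[OF F_fdiff_bounded[of t, OF _ _ h_pos(1,2)]] assms by auto
  have "gnorm M (\<lambda>j. p (t + \<tau>) j - G.EB (\<tau> / 2) (G.EA \<tau> (G.EB (\<tau> / 2) (p (t + 0)))) j)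
      \<le> 11 * (\<tau> ^ 3 * (((2 + 8 * d) / \<epsilon>) ^ 3 * sobolev G.\<rho> M 3 (p (t + 0)))) + \<tau> * defect_bound"
  proof (rule G.local_error[OF potential_bounded_d, where p="\<lambda>s. p (t + s)" and \<delta>="\<lambda>s. \<delta> (t + s)"])
    show "gperiodic M (p (t + 0))" unfolding p_def by (rule gperiodic_trig_sum[OF M(1)])
    show "gnorm M (\<delta> (t + s)) \<le> defect_bound" if "0 \<le> s" "s \<le> \<tau>" for s
      using that assms by (intro gnorm_delta) auto
    show "((\<lambda>s. p (t + s) j) has_vector_derivative
        (G.Aop (p (t + s)) j + G.Bop (p (t + s)) j + \<delta> (t + s) j)) (at s within {0..\<tau>})"
      if "0 \<le> s" "s \<le> \<tau>" for s j
    proof -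
      let ?D = "G.Aop (p (t + s)) j + G.Bop (p (t + s)) j + \<delta> (t + s) j"
      have "((\<lambda>t. p t j) has_vector_derivative ?D) (at (t + s) within (\<lambda>s. t + s) ` {0..\<tau>})"
        using that assms by (intro has_vector_derivative_within_subset[OF p_deriv]) auto
      moreover have "((\<lambda>s. t + s) has_vector_derivative 1) (at s within {0..\<tau>})"
        by (auto intro!: derivative_eq_intros)
      ultimately show ?thesis
        using vector_diff_chain_within[of "\<lambda>s. t + s" 1 s "{0..\<tau>}" "\<lambda>t. p t j" ?D] by (simp add: o_def)
    qed
  qed (use assms in auto)
  also have "\<dots> \<le> 11 * (\<tau> ^ 3 * (((2 + 8 * d) / \<epsilon>) ^ 3 * (27 * c))) + \<tau> * defect_bound"
    using assms d eps sobolev_p[of t] by (intro add_mono mult_left_mono) auto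
  also have "\<dots> = \<tau> * (297 * c * (2 + 8 * d) ^ 3 * (\<tau>\<^sup>2 / \<epsilon> ^ 3) + defect_bound)"
  proof -
    have "\<tau> ^ 3 = \<tau> * \<tau>\<^sup>2" by (simp add: power3_eq_cube power2_eq_square)
    then show ?thesis unfolding power_divide distrib_left by simp
  qed
  finally show ?thesis by (simp add: strang_step_def)
qed

text \<open>The numerical step preserves distances, so the local errors simply add. The start
  contributes 4 c \<theta>, because the scheme begins with samples of the solution and
  \<open>p\<close> with its projection. The data of the scheme enter through their node values,
  which lets periodic extensions take their place in the analysis.\<close>

lemma scheme_error:
  assumes V0: "\<And>j. j < M \<Longrightarrow> V0 (node a b M j) = V (node a b M j)"
    and A0: "\<And>j. j < M \<Longrightarrow> A0 (node a b M j) = A (node a b M j)"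
    and \<Phi>0: "\<And>j. j < M \<Longrightarrow> \<Phi>0 (node a b M j) = F 0 (node a b M j)"
    and "0 \<le> \<tau>"
  shows "real n * \<tau> \<le> T \<Longrightarrow> gnorm M (\<lambda>j. p (real n * \<tau>) j - S2 \<epsilon> a b M \<tau> V0 A0 \<Phi>0 n j)
    \<le> 4 * c * \<theta> + real n * \<tau> * (297 * c * (2 + 8 * d) ^ 3 * (\<tau>\<^sup>2 / \<epsilon> ^ 3) + defect_bound)"
proof (induction n)
  case 0
  have "gnorm M (\<lambda>j. p 0 j - \<Phi>0 (node a b M j)) = gnorm M (\<lambda>j. p 0 j - F 0 (node a b M j))"
    by (rule gnorm_cong) (simp add: \<Phi>0)
  with F_minus_p[of 0] 0 show ?case by (simp add: gnorm_minus)
next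
  case (Suc n)
  let ?t = "real n * \<tau>" and ?S = "S2 \<epsilon> a b M \<tau> V0 A0 \<Phi>0"
  let ?c = "297 * c * (2 + 8 * d) ^ 3 * (\<tau>\<^sup>2 / \<epsilon> ^ 3) + defect_bound"
  have t: "0 \<le> ?t" "?t + \<tau> \<le> T" using Suc.prems \<open>0 \<le> \<tau>\<close> by (simp_all add: algebra_simps)
  have pf: "potential_flow \<epsilon> a b M V0 A0 s U j = G.EB s U j" if "j < M" for s U j
    using V0[OF that] A0[OF that] by (simp add: potential_flow_def G.EB_def pot_gen_def Let_def)
  have ff: "free_flow \<epsilon> a b M s U = G.EA s U" for s U
    unfolding free_flow_trig_sum[OF ab M(1)] G.EA_def free_gen_def ..
  have EA_cong: "G.EA s U = G.EA s W" if "\<And>j. j < M \<Longrightarrow> U j = W j" for s U W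
  proof -
    have "dft a b M U l = dft a b M W l" for l by (rule dft_cong) (rule that)
    then show ?thesis by (simp add: G.EA_def)
  qed
  have S_Suc: "?S (Suc n) j = strang_step \<tau> (?S n) j" if "j < M" for j
  proof -
    have "?S (Suc n) j = G.EB (\<tau> / 2) (G.EA \<tau> (potential_flow \<epsilon> a b M V0 A0 (\<tau> / 2) (?S n))) j"
      using that by (simp add: pf ff)
    also have "G.EA \<tau> (potential_flow \<epsilon> a b M V0 A0 (\<tau> / 2) (?S n)) = G.EA \<tau> (G.EB (\<tau> / 2) (?S n))"
      by (rule EA_cong) (rule pf)
    finally show ?thesis by (simp add: strang_step_def)
  qed
  have "gnorm M (\<lambda>j. p (?t + \<tau>) j - ?S (Suc n) j)
      = gnorm M (\<lambda>j. (p (?t + \<tau>) j - strang_step \<tau> (p ?t) j) + (strang_step \<tau> (p ?t) j - strang_step \<tau> (?S n) j))"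
    by (rule gnorm_cong) (simp add: S_Suc del: S2.simps)
  also have "\<dots> \<le> \<tau> * ?c + gnorm M (\<lambda>j. p ?t j - ?S n j)"
    using p_step[OF t(1) \<open>0 \<le> \<tau>\<close> t(2)] by (intro order_trans[OF gnorm_triangle]) (simp add: gnorm_St_diff)
  also have "\<dots> \<le> \<tau> * ?c + (4 * c * \<theta> + ?t * ?c)"
    using Suc t \<open>0 \<le> \<tau>\<close> by (intro add_left_mono) simp
  also have "\<dots> = 4 * c * \<theta> + real (Suc n) * \<tau> * ?c"
  proof -
    have "u * y + (x + k * u * y) = x + (1 + k) * u * y" for u x y k :: real
      by (simp add: algebra_simps)
    then show ?thesis by (simp only: of_nat_Suc)
  qed
  also have "?t + \<tau> = real (Suc n) * \<tau>" by (simp add: algebra_simps)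
  finally show ?case .
qed

text \<open>The interpolant and the projection consist of the same M modes, so by Parseval their
  distance is the same on both grids. 8 = 4 + 4 adds the truncation error on the fine grid to the
  initial error.\<close>

lemma fine_grid_error:
  assumes V0: "\<And>j. j < M \<Longrightarrow> V0 (node a b M j) = V (node a b M j)"
    and A0: "\<And>j. j < M \<Longrightarrow> A0 (node a b M j) = A (node a b M j)"
    and \<Phi>0: "\<And>j. j < M \<Longrightarrow> \<Phi>0 (node a b M j) = F 0 (node a b M j)"
    and "0 \<le> \<tau>" "real n * \<tau> \<le> T"
  shows "gnorm N (\<lambda>i. F (real n * \<tau>) (node a b N i)
      - interpolant a b M (S2 \<epsilon> a b M \<tau> V0 A0 \<Phi>0 n) (node a b N i))
    \<le> 8 * c * \<theta> + real n * \<tau> * (297 * c * (2 + 8 * d) ^ 3 * (\<tau>\<^sup>2 / \<epsilon> ^ 3) + defect_bound)"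
proof -
  let ?t = "real n * \<tau>" and ?S = "S2 \<epsilon> a b M \<tau> V0 A0 \<Phi>0 n"
  have t: "0 \<le> ?t" using assms by simp
  have dist: "distinct_mod N (modes M)"
    using M K by (intro distinct_mod_modes0) (auto simp: N_def)
  have dft_minus: "dft a b M (\<lambda>j. U j - W j) l = dft a b M U l - dft a b M W l" for U W l
    using dft_add[of a b M U "\<lambda>j. (-1) *\<^sub>R W j" l] dft_scaleR[of a b M "-1" W l] by simp
  have trig_sum_minus: "trig_sum N (modes M) (\<lambda>l. x l - y l) i = trig_sum N (modes M) x i - trig_sum N (modes M) y i" for x y i
    using trig_sum_add[of N "modes M" x "\<lambda>l. (-1) *\<^sub>R y l" i] trig_sum_scaleR[of N "modes M" "-1" y i] by simp
  have "gnorm N (\<lambda>i. F ?t (node a b N i) - interpolant a b M ?S (node a b N i))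
      = gnorm N (\<lambda>i. (F ?t (node a b N i) - trig_sum N (modes M) (P ?t) i)
          + trig_sum N (modes M) (\<lambda>l. P ?t l - dft a b M ?S l) i)"
    by (rule gnorm_cong)
       (simp add: interpolant_node[OF ab N(1)] trig_sum_minus)
  also have "\<dots> \<le> 4 * c * \<theta> + gnorm N (trig_sum N (modes M) (\<lambda>l. P ?t l - dft a b M ?S l))"
    using F_minus_p_fine[OF t assms(5)] by (intro order_trans[OF gnorm_triangle]) simp
  also have "gnorm N (trig_sum N (modes M) (\<lambda>l. P ?t l - dft a b M ?S l)) = gnorm M (\<lambda>j. p ?t j - ?S j)"
    unfolding gnorm_trig_sum[OF N(1) dist] gnorm_dft[OF ab M] dft_minus
    by (rule L2_set_cong) (simp_all add: dft_p)
  also have "\<dots> \<le> 4 * c * \<theta> + ?t * (297 * c * (2 + 8 * d) ^ 3 * (\<tau>\<^sup>2 / \<epsilon> ^ 3) + defect_bound)"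
    by (rule scheme_error) (use assms in auto)
  finally show ?thesis by simp
qed

end

section \<open>Smooth cut-off functions\<close>

lemma exp_ge_power: "0 \<le> t \<Longrightarrow> t ^ k / fact k \<le> exp (t::real)"
proof -
  assume t: "0 \<le> t"
  have "(\<Sum>i\<in>{k}. t ^ i /\<^sub>R fact i) \<le> (\<Sum>i. t ^ i /\<^sub>R fact i)"
    using t summable_exp_generic[of t] by (intro sum_le_suminf) auto
  then show ?thesis by (simp add: exp_def divide_inverse mult.commute)
qed

text \<open>A family closed under differentiation: one derivative formula yields smoothness of every
  order. The poles at the end points are outweighed by the exponential.\<close>

definition bumpf :: "real poly \<Rightarrow> nat \<Rightarrow> real \<Rightarrow> real" where
  "bumpf p n x = (if \<bar>x\<bar> < 1 then poly p x / (1 - x\<^sup>2) ^ n * exp (- 1 / (1 - x\<^sup>2)) else 0)"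

text \<open>The numerator of the derivative over the denominator of exponent n + 2;
  \<open>[:1, 0, -1:]\<close> is 1 - x^2.\<close>

definition bumpf_deriv :: "real poly \<Rightarrow> nat \<Rightarrow> real poly" where
  "bumpf_deriv p n = pderiv p * [:1, 0, -1:]\<^sup>2 + [:0, 2 * of_nat n:] * p * [:1, 0, -1:] - [:0, 2:] * p"

lemma has_derivative_zero_quadratic:
  fixes f :: "real \<Rightarrow> real"
  assumes "\<And>y. \<bar>f y - f x\<bar> \<le> c * \<bar>y - x\<bar>\<^sup>2"
  shows "(f has_real_derivative 0) (at x)"
proof -
  have "((\<lambda>y. (f y - f x) / (y - x)) \<longlongrightarrow> 0) (at x)"
  proof (rule Lim_null_comparison)
    show "\<forall>\<^sub>F y in at x. norm ((f y - f x) / (y - x)) \<le> c * \<bar>y - x\<bar>"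
    proof (rule eventually_at_ball[THEN eventually_mono, of 1])
      fix y
      show "norm ((f y - f x) / (y - x)) \<le> c * \<bar>y - x\<bar>"
      proof (cases "y = x")
        case False
        then show ?thesis using assms[of y] by (simp add: abs_divide divide_le_eq power2_eq_square mult.assoc)
      qed simp
    qed simp
    have "((\<lambda>y. c * \<bar>y - x\<bar>) \<longlongrightarrow> c * \<bar>x - x\<bar>) (at x)" by (intro tendsto_intros)
    then show "((\<lambda>y. c * \<bar>y - x\<bar>) \<longlongrightarrow> 0) (at x)" by simp
  qed
  then show ?thesis by (simp add: has_field_derivative_iff)
qed

text \<open>Inside this is the quotient rule, outside everything vanishes. At an end point put u = 1
  - y^2: the exponential is at most (n + 2)! u^(n + 2), which cancels the pole and leaves u^2. As u
  is at most twice the distance to the end point, the function is quadratically small there and has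
  derivative zero.\<close>

lemma bumpf_has_derivative: "(bumpf p n has_real_derivative bumpf (bumpf_deriv p n) (n + 2) x) (at x)"
proof -
  consider "\<bar>x\<bar> < 1" | "\<bar>x\<bar> = 1" | "1 < \<bar>x\<bar>" by linarith
  then show ?thesis
  proof cases
    case 1
    then have u: "0 < 1 - x\<^sup>2" by (simp add: abs_square_less_1)
    let ?u = "1 - x\<^sup>2" and ?E = "exp (- 1 / (1 - x\<^sup>2))"
    have "((\<lambda>x. poly p x / (1 - x\<^sup>2) ^ n * exp (- 1 / (1 - x\<^sup>2))) has_real_derivative
        (poly (pderiv p) x / ?u ^ n + poly p x * (real n * (2 * x) / ?u ^ (n + 1))) * ?E
          + poly p x / ?u ^ n * (?E * (- (2 * x) / ?u\<^sup>2))) (at x)"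
    proof -
      have d1: "((\<lambda>x. 1 - x\<^sup>2) has_real_derivative - (2 * x)) (at x)"
        by (auto intro!: derivative_eq_intros)
      have d2: "((\<lambda>x. inverse (1 - x\<^sup>2)) has_real_derivative 2 * x / ?u\<^sup>2) (at x)"
        using DERIV_inverse_fun[OF d1] u by (simp add: power2_eq_square divide_inverse mult_ac)
      have d3: "((\<lambda>x. inverse (1 - x\<^sup>2) ^ n) has_real_derivative real n * (2 * x) / ?u ^ (n + 1)) (at x)"
      proof (cases n)
        case (Suc k)
        have "of_nat n * (2 * x / ?u\<^sup>2 * inverse ?u ^ (n - Suc 0)) = real n * (2 * x) / ?u ^ (n + 1)"
          using u by (simp add: Suc field_simps power2_eq_square)
        with DERIV_power[OF d2, of n] show ?thesis by (simp only:)
      qed simp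
      have d4: "((\<lambda>x. exp (- inverse (1 - x\<^sup>2))) has_real_derivative
          exp (- inverse (1 - x\<^sup>2)) * (- (2 * x / ?u\<^sup>2))) (at x)"
        by (intro DERIV_fun_exp DERIV_minus d2)
      have "((\<lambda>x. poly p x * inverse (1 - x\<^sup>2) ^ n * exp (- inverse (1 - x\<^sup>2))) has_real_derivative
          (poly p x * inverse (1 - x\<^sup>2) ^ n) * (exp (- inverse (1 - x\<^sup>2)) * (- (2 * x / ?u\<^sup>2)))
          + (poly p x * (real n * (2 * x) / ?u ^ (n + 1)) + poly (pderiv p) x * inverse (1 - x\<^sup>2) ^ n)
            * exp (- inverse (1 - x\<^sup>2))) (at x)"
        by (intro DERIV_mult' d3 d4 poly_DERIV)
      then show ?thesis by (simp add: divide_inverse power_inverse add.commute mult_ac)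
    qed
    moreover have "(poly (pderiv p) x / ?u ^ n + poly p x * (real n * (2 * x) / ?u ^ (n + 1))) * ?E
          + poly p x / ?u ^ n * (?E * (- (2 * x) / ?u\<^sup>2)) = bumpf (bumpf_deriv p n) (n + 2) x"
    proof -
      have pu: "poly [:1, 0, -1:] x = ?u" by (simp add: power2_eq_square)
      have "poly (bumpf_deriv p n) x = poly (pderiv p) x * ?u\<^sup>2 + 2 * real n * x * poly p x * ?u - 2 * x * poly p x"
        unfolding bumpf_deriv_def poly_add poly_diff poly_mult poly_power pu by simp
      moreover have "(p' / w ^ n + y * (k * (2 * x) / w ^ (n + 1))) * e + y / w ^ n * (e * (- (2 * x) / w\<^sup>2))
          = (p' * w\<^sup>2 + 2 * k * x * y * w - 2 * x * y) / w ^ (n + 2) * e" if "0 < w" for p' y k x e w :: real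
        using that by (simp add: field_simps power2_eq_square)
      ultimately show ?thesis using 1 u by (simp add: bumpf_def)
    qed
    ultimately have "((\<lambda>x. poly p x / (1 - x\<^sup>2) ^ n * exp (- 1 / (1 - x\<^sup>2))) has_real_derivative
        bumpf (bumpf_deriv p n) (n + 2) x) (at x)" by simp
    then show ?thesis
      by (rule has_field_derivative_transform_within_open[where S="{-1<..<1}"]) (use 1 in \<open>auto simp: bumpf_def\<close>)
  next
    case 2
    have "bounded (poly p ` {-1..1})"
      by (intro compact_imp_bounded compact_continuous_image) (auto intro!: continuous_intros)
    then obtain B where "\<forall>z\<in>poly p ` {-1..1}. norm z \<le> B" unfolding bounded_iff by blast
    then have B: "\<bar>poly p y\<bar> \<le> B" if "\<bar>y\<bar> \<le> 1" for y using that by (simp add: abs_le_iff)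
    have fx: "bumpf q k x = 0" for q k using 2 by (simp add: bumpf_def)
    have "(bumpf p n has_real_derivative 0) (at x)"
    proof (rule has_derivative_zero_quadratic)
      fix y
      show "\<bar>bumpf p n y - bumpf p n x\<bar> \<le> (B * fact (n + 2) * 4) * \<bar>y - x\<bar>\<^sup>2"
      proof (cases "\<bar>y\<bar> < 1")
        case True
        define u where "u = 1 - y\<^sup>2"
        have u: "0 < u" "u \<le> 2 * \<bar>y - x\<bar>"
        proof -
          show "0 < u" using True by (simp add: u_def abs_square_less_1)
          have "u = (1 - \<bar>y\<bar>) * (1 + \<bar>y\<bar>)" by (simp add: u_def power2_eq_square algebra_simps)
          also have "\<dots> \<le> \<bar>y - x\<bar> * 2" using True 2 by (intro mult_mono) auto
          finally show "u \<le> 2 * \<bar>y - x\<bar>" by simp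
        qed
        have B0: "0 \<le> B" using B[of 0] by simp
        have "(1 / u) ^ (n + 2) / fact (n + 2) \<le> exp (1 / u)" using u by (intro exp_ge_power) auto
        then have "1 / (u ^ (n + 2) * fact (n + 2)) \<le> exp (1 / u)"
          by (simp only: power_one_over divide_divide_eq_left)
        moreover have "1 / e \<le> f * w" if "1 / (w * f) \<le> e" "0 < w" "0 < f" "0 < e" for e f w :: real
          using that by (simp add: field_simps)
        ultimately have "1 / exp (1 / u) \<le> fact (n + 2) * u ^ (n + 2)"
          using u by (metis exp_gt_zero fact_gt_zero zero_less_power)
        moreover have "exp (- 1 / u) = 1 / exp (1 / u)" by (simp add: exp_minus divide_inverse)
        ultimately have "exp (- 1 / u) \<le> (fact (n + 2) * u\<^sup>2) * u ^ n"
          by (simp only: power_add mult.assoc mult.commute[of "u\<^sup>2"])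
        then have "exp (- 1 / u) / u ^ n \<le> fact (n + 2) * u\<^sup>2"
          using u by (simp only: pos_divide_le_eq zero_less_power)
        then have "\<bar>poly p y\<bar> * (exp (- 1 / u) / u ^ n) \<le> B * (fact (n + 2) * u\<^sup>2)"
          using B[of y] B0 True u by (intro mult_mono) auto
        also have "\<dots> \<le> B * (fact (n + 2) * (2 * \<bar>y - x\<bar>)\<^sup>2)"
          using u B0 by (intro mult_left_mono power_mono) auto
        also have "\<dots> = (B * fact (n + 2) * 4) * \<bar>y - x\<bar>\<^sup>2" by (simp only: power_mult_distrib) simp
        also have "\<bar>poly p y\<bar> * (exp (- 1 / u) / u ^ n) = \<bar>bumpf p n y - bumpf p n x\<bar>"
          unfolding fx using True u by (simp add: bumpf_def u_def[symmetric] abs_mult)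
        finally show ?thesis .
      next
        case False
        have "0 \<le> B" using B[of 0] by simp
        then show ?thesis unfolding fx using False by (simp add: bumpf_def[of p n y])
      qed
    qed
    then show ?thesis by (simp add: fx)
  next
    case 3
    have "((\<lambda>x. 0) has_real_derivative 0) (at x)" by simp
    then have "(bumpf p n has_real_derivative 0) (at x)"
      by (rule has_field_derivative_transform_within_open[where S="- {-1..1}"]) (use 3 in \<open>auto simp: bumpf_def abs_if split: if_splits\<close>)
    then show ?thesis using 3 by (simp add: bumpf_def)
  qed
qed

lemma deriv_bumpf_pow: "\<exists>q k. (deriv ^^ j) (bumpf p n) = bumpf q k"
proof (induction j)
  case (Suc j)
  then obtain q k where "(deriv ^^ j) (bumpf p n) = bumpf q k" by blast
  moreover have "deriv (bumpf q k) = bumpf (bumpf_deriv q k) (k + 2)"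
    by (rule ext) (rule DERIV_imp_deriv[OF bumpf_has_derivative])
  ultimately show ?case by (metis funpow.simps(2) o_apply)
qed auto

definition smooth_fun :: "(real \<Rightarrow> real) \<Rightarrow> bool" where
  "smooth_fun f \<longleftrightarrow> (\<forall>k. (deriv ^^ k) f differentiable_on UNIV)"

lemma smooth_fun_has_derivative:
  assumes "smooth_fun f"
  shows "((deriv ^^ k) f has_real_derivative (deriv ^^ Suc k) f x) (at x)"
proof -
  have "(deriv ^^ k) f differentiable at x"
    using assms by (simp add: smooth_fun_def differentiable_on_def)
  then show ?thesis
    by (simp add: real_differentiable_def DERIV_deriv_iff_real_differentiable field_differentiable_def)
qed

text \<open>The step is the normalized antiderivative of a bump. Its derivative lies in the family
  \<open>bumpf\<close> again, whence smoothness.\<close>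

lemma smooth_step_exists:
  obtains \<Theta> :: "real \<Rightarrow> real" where "smooth_fun \<Theta>" "mono \<Theta>" "\<And>x. x \<le> -1 \<Longrightarrow> \<Theta> x = 0" "\<And>x. 1 \<le> x \<Longrightarrow> \<Theta> x = 1"
proof -
  let ?B = "bumpf [:1:] 0"
  have cont: "isCont ?B x" for x by (rule DERIV_isCont[OF bumpf_has_derivative])
  have "\<exists>G. \<forall>x::real. -\<infinity> < ereal x \<longrightarrow> ereal x < \<infinity> \<longrightarrow> (G has_vector_derivative ?B x) (at x)"
    by (rule einterval_antiderivative) (auto intro: cont)
  then obtain G where G: "\<And>x. (G has_real_derivative ?B x) (at x)"
    by (auto simp: has_real_derivative_iff_has_vector_derivative)
  have B0: "0 \<le> ?B x" for x by (simp add: bumpf_def)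
  have mono: "mono G"
    by (rule monoI) (metis DERIV_nonneg_imp_nondecreasing G B0)
  have contG: "continuous_on S G" for S
    by (intro continuous_at_imp_continuous_on ballI DERIV_isCont[OF G])
  have G0: "(G has_real_derivative 0) (at y)" if "1 \<le> \<bar>y\<bar>" for y
    using G[of y] that by (simp add: bumpf_def)
  have left: "G x = G (-1)" if "x \<le> -1" for x
  proof (cases "x = -1")
    case False
    then show ?thesis
      using that by (intro DERIV_isconst_end[symmetric] contG G0) auto
  qed simp
  have right: "G x = G 1" if "1 \<le> x" for x
  proof (cases "x = 1")
    case False
    then show ?thesis
      using that by (intro DERIV_isconst_end contG G0) auto
  qed simp
  have pos: "G (-1) < G 1"
  proof -
    have "G (-1) \<le> G (-1/2)" "G (1/2) \<le> G 1" using mono by (auto simp: mono_def)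
    moreover have "G (-1/2) < G (1/2)"
    proof (rule DERIV_pos_imp_increasing[of "-1/2" "1/2" G])
      show "\<exists>y. (G has_real_derivative y) (at x) \<and> 0 < y" if "-1/2 \<le> x" "x \<le> 1/2" for x :: real
      proof -
        have "0 < ?B x" using that by (simp add: bumpf_def)
        then show ?thesis using G by blast
      qed
    qed simp
    ultimately show ?thesis by linarith
  qed
  define \<Theta> where "\<Theta> x = (G x - G (-1)) / (G 1 - G (-1))" for x
  have D: "(\<Theta> has_real_derivative bumpf [:1 / (G 1 - G (-1)):] 0 x) (at x)" for x
  proof -
    have "(\<Theta> has_real_derivative (?B x - 0) / (G 1 - G (-1))) (at x)"
      unfolding \<Theta>_def[abs_def] by (intro DERIV_cdivide DERIV_diff G DERIV_const)
    then show ?thesis by (simp add: bumpf_def cong: if_cong split: if_splits)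
  qed
  have "smooth_fun \<Theta>"
    unfolding smooth_fun_def
  proof
    fix k
    show "(deriv ^^ k) \<Theta> differentiable_on UNIV"
    proof (cases k)
      case 0
      then show ?thesis using D by (auto simp: differentiable_on_def real_differentiable_def)
    next
      case (Suc j)
      have "deriv \<Theta> = bumpf [:1 / (G 1 - G (-1)):] 0" by (rule ext) (rule DERIV_imp_deriv[OF D])
      then obtain q i where "(deriv ^^ k) \<Theta> = bumpf q i"
        using deriv_bumpf_pow[of j] unfolding Suc funpow_Suc_right o_def by metis
      then show ?thesis
        using bumpf_has_derivative by (auto simp: differentiable_on_def real_differentiable_def)
    qed
  qed
  moreover have "mono \<Theta>"
    using mono pos by (auto simp: mono_def \<Theta>_def divide_right_mono)
  moreover have "\<Theta> x = 0" if "x \<le> -1" for x using left[OF that] by (simp add: \<Theta>_def)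
  moreover have "\<Theta> x = 1" if "1 \<le> x" for x using right[OF that] pos by (simp add: \<Theta>_def)
  ultimately show ?thesis by (rule that)
qed

text \<open>For a smooth step \<open>f\<close> this is the function that rises near x and falls near
  y, later used as a test function.\<close>

lemma smooth_fun_affine_diff:
  assumes "smooth_fun f" "\<delta> \<noteq> 0"
  shows "smooth_fun (\<lambda>z. f ((z - x) / \<delta>) - f ((z - y) / \<delta>))"
proof -
  let ?g = "\<lambda>z. f ((z - x) / \<delta>) - f ((z - y) / \<delta>)"
  let ?h = "\<lambda>k z. ((deriv ^^ k) f ((z - x) / \<delta>) - (deriv ^^ k) f ((z - y) / \<delta>)) / \<delta> ^ k"
  have D: "(?h k has_real_derivative ?h (Suc k) z) (at z)" for k z
  proof -
    have 1: "((\<lambda>z. (deriv ^^ k) f ((z - w) / \<delta>)) has_real_derivative (deriv ^^ Suc k) f ((z - w) / \<delta>) / \<delta>) (at z)" for w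
    proof -
      have "((\<lambda>z. (z - w) / \<delta>) has_real_derivative 1 / \<delta>) (at z)"
        using assms(2) by (auto intro!: derivative_eq_intros)
      from DERIV_chain2[OF smooth_fun_has_derivative[OF assms(1)] this] show ?thesis by simp
    qed
    show ?thesis
      using DERIV_cdivide[OF DERIV_diff[OF 1[of x] 1[of y]], of "\<delta> ^ k"]
      by (simp add: diff_divide_distrib[symmetric] mult.commute)
  qed
  have "(deriv ^^ k) ?g = ?h k" for k
  proof (induction k)
    case (Suc k)
    have "deriv (?h k) = ?h (Suc k)" by (rule ext) (rule DERIV_imp_deriv[OF D])
    with Suc show ?case by simp
  qed simp
  then show ?thesis
    using D by (auto simp: smooth_fun_def differentiable_on_def real_differentiable_def)
qed

section \<open>Weak derivatives\<close>

lemma lebesgue_on_open_interval: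
  fixes f :: "real \<Rightarrow> 'a::euclidean_space"
  assumes "continuous_on {a..b} f"
  shows integrable_open_interval: "integrable (lebesgue_on {a<..<b}) f"
    and integral_open_interval_lebesgue: "(LINT x|lebesgue_on {a<..<b}. f x) = integral {a..b} f"
proof -
  have "set_integrable lebesgue {a..b} f"
    using absolutely_integrable_continuous_real[OF assms] .
  then have "set_integrable lebesgue {a<..<b} f"
    by (rule set_integrable_subset) auto
  then show *: "integrable (lebesgue_on {a<..<b}) f"
    by (simp add: set_integrable_def integrable_restrict_space)
  show "(LINT x|lebesgue_on {a<..<b}. f x) = integral {a..b} f"
    using lebesgue_integral_eq_integral[OF *] by (simp add: integral_open_interval_real)
qed

text \<open>The integral identity alone, without integrability conditions. It links consecutive weak
  derivatives of a function and also applies to auxiliary functions such as primitives.\<close>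

definition weak_pair :: "real \<Rightarrow> real \<Rightarrow> (real \<Rightarrow> 'a::euclidean_space) \<Rightarrow> (real \<Rightarrow> 'a) \<Rightarrow> bool" where
  "weak_pair a b g w \<longleftrightarrow> (\<forall>\<phi>. test_fun a b \<phi> \<longrightarrow>
     (LINT x|lebesgue_on {a<..<b}. deriv \<phi> x *\<^sub>R g x) = - (LINT x|lebesgue_on {a<..<b}. \<phi> x *\<^sub>R w x))"

lemma test_fun_iff: "test_fun a b \<phi> \<longleftrightarrow> smooth_fun \<phi> \<and>
    compact (closure {x. \<phi> x \<noteq> 0}) \<and> closure {x. \<phi> x \<noteq> 0} \<subseteq> {a<..<b}"
  by (simp add: test_fun_def smooth_fun_def)

lemma test_fun_deriv:
  assumes "test_fun a b \<phi>" shows "test_fun a b (deriv \<phi>)"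
proof -
  let ?S = "closure {x. \<phi> x \<noteq> 0}"
  have "deriv \<phi> x = 0" if "x \<notin> ?S" for x
  proof -
    have "((\<lambda>x. 0) has_real_derivative 0) (at x)" by simp
    then have "(\<phi> has_real_derivative 0) (at x)"
      by (rule has_field_derivative_transform_within_open[where S="- ?S"])
        (use that closure_subset[of "{x. \<phi> x \<noteq> 0}"] in auto)
    then show ?thesis by (rule DERIV_imp_deriv)
  qed
  then have "closure {x. deriv \<phi> x \<noteq> 0} \<subseteq> ?S" by (intro closure_minimal) auto
  moreover have "smooth_fun (deriv \<phi>)"
    unfolding smooth_fun_def
  proof
    fix k
    show "(deriv ^^ k) (deriv \<phi>) differentiable_on UNIV"
      using assms unfolding test_fun_def by (metis funpow_Suc_right o_apply)
  qed
  moreover from calculation have "closure {x. deriv \<phi> x \<noteq> 0} = ?S \<inter> closure {x. deriv \<phi> x \<noteq> 0}"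
    by blast
  then have "compact (closure {x. deriv \<phi> x \<noteq> 0})"
    using assms unfolding test_fun_iff by (metis closed_closure compact_Int_closed)
  ultimately show ?thesis
    using assms unfolding test_fun_iff by blast
qed

lemma test_fun_D:
  assumes "test_fun a b \<phi>" "a \<le> b"
  shows test_fun_has_derivative: "(\<phi> has_real_derivative deriv \<phi> x) (at x)"
    and test_fun_continuous: "continuous_on S \<phi>" "continuous_on S (deriv \<phi>)"
    and test_fun_ends: "\<phi> a = 0" "\<phi> b = 0"
proof -
  have s: "smooth_fun \<phi>" using assms by (simp add: test_fun_iff)
  show "(\<phi> has_real_derivative deriv \<phi> x) (at x)"
    using smooth_fun_has_derivative[OF s, of 0] by simp
  show "continuous_on S \<phi>" "continuous_on S (deriv \<phi>)"
    using smooth_fun_has_derivative[OF s, of 0] smooth_fun_has_derivative[OF s, of 1]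
    by (auto intro!: continuous_at_imp_continuous_on dest: DERIV_isCont)
  have "a \<notin> {x. \<phi> x \<noteq> 0}" "b \<notin> {x. \<phi> x \<noteq> 0}"
    using assms closure_subset[of "{x. \<phi> x \<noteq> 0}"] unfolding test_fun_iff by (auto simp: subset_iff)
  then show "\<phi> a = 0" "\<phi> b = 0" by auto
qed

text \<open>The identity of order k, tested with the derivative of a test function, and the identity
  of order k + 1 evaluate the same integral; the signs cancel up to one minus.\<close>

lemma weak_derivs_weak_pair:
  assumes f: "weak_deriv a b k f g" "weak_deriv a b (Suc k) f w"
  shows "weak_pair a b g w"
  unfolding weak_pair_def
proof (intro allI impI)
  fix \<phi> assume \<phi>: "test_fun a b \<phi>"
  let ?I = "LINT x|lebesgue_on {a<..<b}. (deriv ^^ Suc k) \<phi> x *\<^sub>R f x"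
  have "?I = (-1) ^ k *\<^sub>R (LINT x|lebesgue_on {a<..<b}. deriv \<phi> x *\<^sub>R g x)"
    using f(1) test_fun_deriv[OF \<phi>] unfolding weak_deriv_def funpow_Suc_right o_def by blast
  moreover have "?I = (-1) ^ Suc k *\<^sub>R (LINT x|lebesgue_on {a<..<b}. \<phi> x *\<^sub>R w x)"
    using f(2) \<phi> unfolding weak_deriv_def by blast
  ultimately have "((-1) ^ k * (-1) ^ k) *\<^sub>R (LINT x|lebesgue_on {a<..<b}. deriv \<phi> x *\<^sub>R g x)
      = ((-1) ^ k * (-1) ^ Suc k) *\<^sub>R (LINT x|lebesgue_on {a<..<b}. \<phi> x *\<^sub>R w x)"
    unfolding scaleR_scaleR[symmetric] by simp
  moreover have "(-1) ^ k * (-1) ^ k = (1::real)" "(-1) ^ k * (-1) ^ Suc k = (-1::real)"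
    by (simp_all add: power_add[symmetric] flip: power_Suc)
  ultimately show "(LINT x|lebesgue_on {a<..<b}. deriv \<phi> x *\<^sub>R g x) = - (LINT x|lebesgue_on {a<..<b}. \<phi> x *\<^sub>R w x)"
    by simp
qed

lemma weak_pair_classical:
  fixes H :: "real \<Rightarrow> 'a::euclidean_space"
  assumes ab: "a < b" and H: "\<And>x. x \<in> {a..b} \<Longrightarrow> (H has_vector_derivative w x) (at x within {a..b})"
    and w: "continuous_on {a..b} w"
  shows "weak_pair a b H w"
  unfolding weak_pair_def
proof (intro allI impI)
  fix \<phi> assume \<phi>: "test_fun a b \<phi>"
  note D = test_fun_D[OF \<phi> less_imp_le[OF ab]]
  have contH: "continuous_on {a..b} H"
    using H has_vector_derivative_continuous continuous_on_eq_continuous_within by blast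
  have "((\<lambda>x. \<phi> x *\<^sub>R w x + deriv \<phi> x *\<^sub>R H x) has_integral (\<phi> b *\<^sub>R H b - \<phi> a *\<^sub>R H a)) {a..b}"
    using D(1) H ab
    by (intro fundamental_theorem_of_calculus has_vector_derivative_scaleR)
       (auto intro: has_field_derivative_at_within)
  then have "integral {a..b} (\<lambda>x. \<phi> x *\<^sub>R w x + deriv \<phi> x *\<^sub>R H x) = 0"
    using D(4,5) by (simp add: integral_unique)
  moreover have c: "continuous_on {a..b} (\<lambda>x. \<phi> x *\<^sub>R w x)" "continuous_on {a..b} (\<lambda>x. deriv \<phi> x *\<^sub>R H x)"
    using D(2,3) w contH by (auto intro!: continuous_intros)
  ultimately have "integral {a..b} (\<lambda>x. \<phi> x *\<^sub>R w x) + integral {a..b} (\<lambda>x. deriv \<phi> x *\<^sub>R H x) = 0"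
    by (simp add: Henstock_Kurzweil_Integration.integral_add integrable_continuous_real)
  then show "(LINT x|lebesgue_on {a<..<b}. deriv \<phi> x *\<^sub>R H x) = - (LINT x|lebesgue_on {a<..<b}. \<phi> x *\<^sub>R w x)"
    unfolding integral_open_interval_lebesgue[OF c(1)] integral_open_interval_lebesgue[OF c(2)]
    by (simp add: eq_neg_iff_add_eq_0 add.commute)
qed

lemma smooth_fun_rescaled:
  assumes "smooth_fun \<Theta>" "0 < \<delta>"
  shows rescaled_has_derivative: "((\<lambda>u. \<Theta> ((u - z) / \<delta>)) has_real_derivative deriv \<Theta> ((u - z) / \<delta>) / \<delta>) (at u)"
    and continuous_on_rescaled: "continuous_on S (\<lambda>u. deriv \<Theta> ((u - z) / \<delta>) / \<delta>)"
proof -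
  have "((\<lambda>u. (u - z) / \<delta>) has_real_derivative 1 / \<delta>) (at u)"
    using assms(2) by (auto intro!: derivative_eq_intros)
  from DERIV_chain2[OF smooth_fun_has_derivative[OF assms(1), of 0] this]
  show "((\<lambda>u. \<Theta> ((u - z) / \<delta>)) has_real_derivative deriv \<Theta> ((u - z) / \<delta>) / \<delta>) (at u)" by simp
  have "continuous_on UNIV (deriv \<Theta>)"
    using smooth_fun_has_derivative[OF assms(1), of 1]
    by (auto intro!: continuous_at_imp_continuous_on dest: DERIV_isCont)
  then show "continuous_on S (\<lambda>u. deriv \<Theta> ((u - z) / \<delta>) / \<delta>)"
    using assms(2) by (auto intro!: continuous_intros continuous_on_compose2[of UNIV "deriv \<Theta>"])
qed

text \<open>The derivative of the rescaled step is a nonnegative kernel of mass one that vanishes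
  for |u - z| > \<delta>.\<close>

lemma mollifier_approx:
  fixes g :: "real \<Rightarrow> 'a::euclidean_space"
  assumes \<Theta>: "smooth_fun \<Theta>" "mono \<Theta>" "\<And>x. x \<le> -1 \<Longrightarrow> \<Theta> x = 0" "\<And>x. 1 \<le> x \<Longrightarrow> \<Theta> x = 1"
    and \<delta>: "0 < \<delta>" "a \<le> z - \<delta>" "z + \<delta> \<le> b"
    and g: "continuous_on {a..b} g" "\<And>u. \<bar>u - z\<bar> \<le> \<delta> \<Longrightarrow> norm (g u - g z) \<le> e"
  shows "norm (integral {a..b} (\<lambda>u. (deriv \<Theta> ((u - z) / \<delta>) / \<delta>) *\<^sub>R g u) - g z) \<le> e"
proof -
  let ?\<psi> = "\<lambda>u. deriv \<Theta> ((u - z) / \<delta>) / \<delta>"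
  have D: "(\<Theta> has_real_derivative deriv \<Theta> v) (at v)" for v
    using smooth_fun_has_derivative[OF \<Theta>(1), of 0] by simp
  note cont = continuous_on_rescaled[OF \<Theta>(1) \<delta>(1), where S="{a..b}" and z=z]
  have nn: "0 \<le> ?\<psi> u" for u
  proof -
    have "0 \<le> deriv \<Theta> v" for v
      by (rule mono_on_imp_deriv_nonneg[of UNIV \<Theta>]) (use \<Theta>(2) D in auto)
    then show ?thesis using \<delta>(1) by simp
  qed
  have zero: "?\<psi> u = 0" if "\<delta> < \<bar>u - z\<bar>" for u
  proof -
    let ?v = "(u - z) / \<delta>"
    have "?v < -1 \<or> 1 < ?v" using that \<delta>(1) by (auto simp: field_simps abs_if split: if_splits)
    then have "(\<Theta> has_real_derivative 0) (at ?v)"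
    proof
      assume v: "?v < -1"
      have "((\<lambda>_. 0) has_real_derivative 0) (at ?v)" by simp
      then show ?thesis
        by (rule has_field_derivative_transform_within_open[where S="{..<-1}"])
           (use v \<Theta>(3) in \<open>simp_all\<close>)
    next
      assume v: "1 < ?v"
      have "((\<lambda>_. 1) has_real_derivative 0) (at ?v)" by simp
      then show ?thesis
        by (rule has_field_derivative_transform_within_open[where S="{1<..}"])
           (use v \<Theta>(4) in \<open>simp_all\<close>)
    qed
    then show ?thesis by (simp add: DERIV_imp_deriv)
  qed
  have int1: "(?\<psi> has_integral 1) {a..b}"
  proof -
    have "((\<lambda>u. \<Theta> ((u - z) / \<delta>)) has_real_derivative ?\<psi> u) (at u)" for u
      by (rule rescaled_has_derivative[OF \<Theta>(1) \<delta>(1)])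
    then have "(?\<psi> has_integral (\<Theta> ((b - z) / \<delta>) - \<Theta> ((a - z) / \<delta>))) {a..b}"
      using \<delta> by (intro fundamental_theorem_of_calculus)
        (auto simp: has_real_derivative_iff_has_vector_derivative[symmetric] intro: has_field_derivative_at_within)
    moreover have "1 \<le> (b - z) / \<delta>" "(a - z) / \<delta> \<le> -1" using \<delta> by (simp_all add: field_simps)
    ultimately show ?thesis by (simp add: \<Theta>)
  qed
  have "((\<lambda>u. ?\<psi> u *\<^sub>R g u - ?\<psi> u *\<^sub>R g z) has_integral
      (integral {a..b} (\<lambda>u. ?\<psi> u *\<^sub>R g u) - 1 *\<^sub>R g z)) {a..b}"
    by (intro has_integral_diff has_integral_scaleR_left int1 integrable_integral
        integrable_continuous_real continuous_on_scaleR cont g(1))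
  then have eq: "integral {a..b} (\<lambda>u. ?\<psi> u *\<^sub>R g u) - g z = integral {a..b} (\<lambda>u. ?\<psi> u *\<^sub>R (g u - g z))"
    by (simp add: scaleR_right_diff_distrib integral_unique)
  also have "norm \<dots> \<le> integral {a..b} (\<lambda>u. ?\<psi> u * e)"
  proof (rule Henstock_Kurzweil_Integration.integral_norm_bound_integral)
    show "(\<lambda>u. ?\<psi> u *\<^sub>R (g u - g z)) integrable_on {a..b}"
      by (intro integrable_continuous_real continuous_on_scaleR cont continuous_on_diff g(1) continuous_on_const)
    show "(\<lambda>u. ?\<psi> u * e) integrable_on {a..b}"
      by (intro integrable_continuous_real continuous_on_mult cont continuous_on_const)
    fix u
    show "norm (?\<psi> u *\<^sub>R (g u - g z)) \<le> ?\<psi> u * e"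
    proof (cases "\<bar>u - z\<bar> \<le> \<delta>")
      case True
      have "\<bar>?\<psi> u\<bar> * norm (g u - g z) \<le> ?\<psi> u * e"
        unfolding abs_of_nonneg[OF nn] using g(2)[OF True] nn by (intro mult_left_mono)
      then show ?thesis by (simp only: norm_scaleR)
    qed (simp add: zero)
  qed
  also have "\<dots> = e" using integral_unique[OF has_integral_mult_left[OF int1, of e]] by (simp only: mult_1)
  finally show ?thesis .
qed

text \<open>The test function is a smoothed indicator of [x, y]: it lies between 0 and 1, vanishes
  outside an interval of length y - x + 2 \<delta>, and its derivative is a mollifier at x minus one
  at y. Pairing the derivative with \<open>g\<close> yields g x - g y up to 2 e, while pairing the
  function with \<open>w\<close> yields at most \<Lambda> times that length.\<close>

lemma weak_lipschitz_interior:
  fixes g w :: "real \<Rightarrow> 'a::euclidean_space"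
  assumes wp: "weak_pair a b g w" and g: "continuous_on {a..b} g"
    and w: "AE x in lebesgue_on {a<..<b}. norm (w x) \<le> \<Lambda>" and \<Lambda>: "0 \<le> \<Lambda>"
    and xy: "a < x" "x < y" "y < b"
  shows "norm (g y - g x) \<le> \<Lambda> * (y - x)"
proof (rule field_le_epsilon)
  fix e0 :: real assume e0: "0 < e0"
  \<comment> \<open>Chosen so that the two mollification errors, 2 e together, and the widening of
    the support, at most 2 \<Lambda> e, add up to \<open>e0\<close>.\<close>
  define e where "e = e0 / (2 * \<Lambda> + 2)"
  have e: "0 < e" and "e * (2 * \<Lambda> + 2) = e0" using e0 \<Lambda> by (simp_all add: e_def)
  then have e2: "\<Lambda> * (2 * e) + 2 * e = e0" by (simp add: algebra_simps)
  obtain \<Theta> where \<Theta>: "smooth_fun \<Theta>" "mono \<Theta>" "\<And>x. x \<le> -1 \<Longrightarrow> \<Theta> x = 0" "\<And>x. 1 \<le> x \<Longrightarrow> \<Theta> x = 1"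
    using smooth_step_exists by blast
  have near: "\<exists>d>0. \<forall>u. \<bar>u - z\<bar> \<le> d \<longrightarrow> norm (g u - g z) \<le> e" if "a < z" "z < b" for z
  proof -
    have "isCont g z" using g that by (simp add: continuous_on_interior)
    then obtain d where d: "d > 0" "\<And>u. dist u z < d \<Longrightarrow> dist (g u) (g z) < e"
      using e unfolding continuous_at_eps_delta by blast
    show ?thesis
      by (rule exI[of _ "d / 2"]) (use d in \<open>force simp: dist_norm intro: less_imp_le\<close>)
  qed
  obtain d1 d2 where d12: "0 < d1" "\<And>u. \<bar>u - x\<bar> \<le> d1 \<Longrightarrow> norm (g u - g x) \<le> e"
    "0 < d2" "\<And>u. \<bar>u - y\<bar> \<le> d2 \<Longrightarrow> norm (g u - g y) \<le> e"
    using near[of x] near[of y] xy by (metis less_trans)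
  define \<delta> where "\<delta> = Min {d1, d2, e, (x - a) / 2, (b - y) / 2}"
  have \<delta>: "0 < \<delta>" "\<delta> \<le> d1" "\<delta> \<le> d2" "\<delta> \<le> e" and "\<delta> \<le> (x - a) / 2" "\<delta> \<le> (b - y) / 2"
  proof -
    show "0 < \<delta>" unfolding \<delta>_def using d12 e xy by (subst Min_gr_iff) auto
    have "\<delta> \<le> z" if "z \<in> {d1, d2, e, (x - a) / 2, (b - y) / 2}" for z
      unfolding \<delta>_def using that by (intro Min_le) auto
    then show "\<delta> \<le> d1" "\<delta> \<le> d2" "\<delta> \<le> e" "\<delta> \<le> (x - a) / 2" "\<delta> \<le> (b - y) / 2"
      by blast+
  qed
  then have \<delta>2: "a < x - \<delta>" "y + \<delta> < b" using xy by (simp_all add: field_simps)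
  define \<phi> where "\<phi> z = \<Theta> ((z - x) / \<delta>) - \<Theta> ((z - y) / \<delta>)" for z
  have Tle: "0 \<le> \<Theta> v" "\<Theta> v \<le> 1" for v
  proof -
    have "\<Theta> (min v (-1)) \<le> \<Theta> v" "\<Theta> v \<le> \<Theta> (max v 1)" using \<Theta>(2) by (auto simp: mono_def)
    then show "0 \<le> \<Theta> v" "\<Theta> v \<le> 1" by (simp_all add: \<Theta>(3,4))
  qed
  have phi0: "\<phi> z = 0" if "z \<notin> {x - \<delta>..y + \<delta>}" for z
  proof (cases "z < x - \<delta>")
    case True
    then have "(z - x) / \<delta> \<le> -1" "(z - y) / \<delta> \<le> -1" using \<delta> xy by (auto simp: field_simps)
    then show ?thesis by (simp add: \<phi>_def \<Theta>)
  next
    case False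
    with that have "1 \<le> (z - x) / \<delta>" "1 \<le> (z - y) / \<delta>" using \<delta> xy by (auto simp: field_simps)
    then show ?thesis by (simp add: \<phi>_def \<Theta>)
  qed
  have phi_le: "0 \<le> \<phi> z" "\<phi> z \<le> 1" for z
  proof -
    have "(z - y) / \<delta> \<le> (z - x) / \<delta>" using \<delta> xy by (simp add: divide_right_mono)
    then show "0 \<le> \<phi> z" using \<Theta>(2) by (simp add: \<phi>_def mono_def)
    show "\<phi> z \<le> 1" using Tle[of "(z - x) / \<delta>"] Tle[of "(z - y) / \<delta>"] by (simp add: \<phi>_def)
  qed
  have sub: "closure {z. \<phi> z \<noteq> 0} \<subseteq> {x - \<delta>..y + \<delta>}"
    using phi0 by (intro closure_minimal) (blast, simp)
  have tf: "test_fun a b \<phi>"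
    unfolding test_fun_iff
  proof (intro conjI)
    show "smooth_fun \<phi>" unfolding \<phi>_def[abs_def] using \<Theta>(1) \<delta> by (intro smooth_fun_affine_diff) auto
    show "compact (closure {z. \<phi> z \<noteq> 0})"
      using sub by (meson bounded_closed_interval bounded_subset closed_closure compact_eq_bounded_closed)
    show "closure {z. \<phi> z \<noteq> 0} \<subseteq> {a<..<b}" using sub \<delta>2 by force
  qed
  let ?\<psi> = "\<lambda>z u. deriv \<Theta> ((u - z) / \<delta>) / \<delta>"
  note cont = continuous_on_rescaled[OF \<Theta>(1) \<delta>(1), where S="{a..b}"]
  have dphi: "deriv \<phi> u = ?\<psi> x u - ?\<psi> y u" for u
    unfolding \<phi>_def[abs_def]
    by (rule DERIV_imp_deriv[OF DERIV_diff[OF rescaled_has_derivative[OF \<Theta>(1) \<delta>(1)]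
      rescaled_has_derivative[OF \<Theta>(1) \<delta>(1)]]])
  let ?I = "\<lambda>z. integral {a..b} (\<lambda>u. ?\<psi> z u *\<^sub>R g u)"
  have "(LINT u|lebesgue_on {a<..<b}. deriv \<phi> u *\<^sub>R g u) = integral {a..b} (\<lambda>u. ?\<psi> x u *\<^sub>R g u - ?\<psi> y u *\<^sub>R g u)"
    unfolding dphi scaleR_left_diff_distrib
    by (intro integral_open_interval_lebesgue continuous_on_diff continuous_on_scaleR cont g)
  also have "\<dots> = ?I x - ?I y"
    by (intro Henstock_Kurzweil_Integration.integral_diff integrable_continuous_real continuous_on_scaleR cont g)
  finally have I: "(LINT u|lebesgue_on {a<..<b}. deriv \<phi> u *\<^sub>R g u) = ?I x - ?I y" .
  have Ix: "norm (?I x - g x) \<le> e"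
    using \<delta> \<delta>2 xy d12 by (intro mollifier_approx[OF \<Theta>] g) auto
  have Iy: "norm (?I y - g y) \<le> e"
    using \<delta> \<delta>2 xy d12 by (intro mollifier_approx[OF \<Theta>] g) auto
  have cphi: "continuous_on {a..b} \<phi>" using test_fun_D(2)[OF tf] xy by simp
  have "norm (LINT u|lebesgue_on {a<..<b}. \<phi> u *\<^sub>R w u) \<le> (LINT u|lebesgue_on {a<..<b}. norm (\<phi> u *\<^sub>R w u))"
    by (rule integral_norm_bound)
  also have "\<dots> \<le> (LINT u|lebesgue_on {a<..<b}. \<phi> u * \<Lambda>)"
  proof (rule integral_mono_AE')
    show "integrable (lebesgue_on {a<..<b}) (\<lambda>u. \<phi> u * \<Lambda>)"
      using cphi by (intro integrable_open_interval continuous_intros)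
    show "AE u in lebesgue_on {a<..<b}. norm (\<phi> u *\<^sub>R w u) \<le> \<phi> u * \<Lambda>"
      using w by eventually_elim (simp add: phi_le mult_left_mono)
  qed (simp add: phi_le \<Lambda>)
  also have "\<dots> = integral {a..b} (\<lambda>u. \<phi> u * \<Lambda>)"
    using cphi by (intro integral_open_interval_lebesgue continuous_intros)
  also have "\<dots> \<le> \<Lambda> * (y - x + 2 * \<delta>)"
  proof (rule has_integral_le)
    show "((\<lambda>u. \<phi> u * \<Lambda>) has_integral integral {a..b} (\<lambda>u. \<phi> u * \<Lambda>)) {a..b}"
      using cphi by (intro integrable_integral integrable_continuous_real continuous_intros)
    have "((\<lambda>u. \<Lambda>) has_integral ((y + \<delta>) - (x - \<delta>)) *\<^sub>R \<Lambda>) {x - \<delta>..y + \<delta>}"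
      using has_integral_const_real[of \<Lambda> "x - \<delta>" "y + \<delta>"] \<delta> xy by (simp add: content_real)
    then show "((\<lambda>u. if u \<in> {x - \<delta>..y + \<delta>} then \<Lambda> else 0) has_integral \<Lambda> * (y - x + 2 * \<delta>)) {a..b}"
      using \<delta>2 by (subst has_integral_restrict) (auto simp: algebra_simps)
    fix u
    show "\<phi> u * \<Lambda> \<le> (if u \<in> {x - \<delta>..y + \<delta>} then \<Lambda> else 0)"
      using phi_le[of u] phi0[of u] \<Lambda> by (auto simp: mult_left_le_one_le)
  qed
  finally have "norm (?I x - ?I y) \<le> \<Lambda> * (y - x + 2 * \<delta>)"
    using wp tf unfolding weak_pair_def I[symmetric] by simp
  moreover have "norm (g y - g x) \<le> norm (?I x - g x) + norm (?I y - g y) + norm (?I x - ?I y)"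
  proof -
    have "g y - g x = (?I x - g x) - (?I y - g y) - (?I x - ?I y)" by simp
    moreover have "norm (p - q - r) \<le> norm p + norm q + norm r" for p q r :: 'a
      using norm_triangle_ineq4[of "p - q" r] norm_triangle_ineq4[of p q] by linarith
    ultimately show ?thesis by (simp only:)
  qed
  moreover have "\<Lambda> * \<delta> \<le> \<Lambda> * e" using \<delta> \<Lambda> by (intro mult_left_mono) auto
  moreover have "\<Lambda> * (y - x + 2 * \<delta>) = \<Lambda> * (y - x) + 2 * (\<Lambda> * \<delta>)" "2 * (\<Lambda> * e) + 2 * e = e0"
    using e2 by (simp_all add: algebra_simps)
  ultimately show "norm (g y - g x) \<le> \<Lambda> * (y - x) + e0"
    using Ix Iy by linarith
qed

lemma lipschitz_closure:
  fixes g :: "real \<Rightarrow> 'a::real_normed_vector"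
  assumes ab: "a < b" and g: "continuous_on {a..b} g"
    and lip: "\<And>x y. a < x \<Longrightarrow> x < y \<Longrightarrow> y < b \<Longrightarrow> norm (g y - g x) \<le> \<Lambda> * (y - x)"
    and xy: "a \<le> x" "x \<le> y" "y \<le> b"
  shows "norm (g y - g x) \<le> \<Lambda> * (y - x)"
proof (cases "x = y")
  case False
  define c where "c = (x + y) / 2"
  define xs where "xs n = x + (c - x) / real (n + 2)" for n
  define ys where "ys n = y - (y - c) / real (n + 2)" for n
  have c: "x < c" "c < y" using False xy by (auto simp: c_def)
  have frac: "0 < z / real (n + 2)" "z / real (n + 2) < z" if "0 < z" for z n
  proof -
    have "z * 1 < z * real (n + 2)" using that by (intro mult_strict_left_mono) auto
    then show "0 < z / real (n + 2)" "z / real (n + 2) < z"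
      using that by (simp_all only: zero_less_divide_iff pos_divide_less_eq) auto
  qed
  have in1: "x < xs n" "xs n < c" "c < ys n" "ys n < y" for n
    using frac[of "c - x" n] frac[of "y - c" n] c by (simp_all add: xs_def ys_def)
  have lim0: "(\<lambda>n. z / real (n + 2)) \<longlonglongrightarrow> 0" for z
    using LIMSEQ_ignore_initial_segment[OF lim_const_over_n[of z], of 2] by simp
  have xs: "xs \<longlonglongrightarrow> x" unfolding xs_def using tendsto_add[OF tendsto_const lim0, of x] by simp
  have ys: "ys \<longlonglongrightarrow> y" unfolding ys_def using tendsto_diff[OF tendsto_const lim0, of y] by simp
  have inab: "xs n \<in> {a..b}" "ys n \<in> {a..b}" for n
    unfolding atLeastAtMost_iff using in1[of n] xy by linarith+
  have gx: "(\<lambda>n. g (xs n)) \<longlonglongrightarrow> g x"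
    by (rule continuous_on_tendsto_compose[OF g xs _ always_eventually]) (use inab xy in auto)
  have gy: "(\<lambda>n. g (ys n)) \<longlonglongrightarrow> g y"
    by (rule continuous_on_tendsto_compose[OF g ys _ always_eventually]) (use inab xy in auto)
  show ?thesis
  proof (rule LIMSEQ_le)
    show "(\<lambda>n. norm (g (ys n) - g (xs n))) \<longlonglongrightarrow> norm (g y - g x)" by (intro tendsto_intros gx gy)
    show "(\<lambda>n. \<Lambda> * (ys n - xs n)) \<longlonglongrightarrow> \<Lambda> * (y - x)" by (intro tendsto_intros xs ys)
    have "norm (g (ys n) - g (xs n)) \<le> \<Lambda> * (ys n - xs n)" for n
    proof (rule lip)
      show "a < xs n" "xs n < ys n" "ys n < b" using in1[of n] xy by linarith+
    qed
    then show "\<exists>N. \<forall>n\<ge>N. norm (g (ys n) - g (xs n)) \<le> \<Lambda> * (ys n - xs n)" by blast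
  qed
qed simp

lemma weak_lipschitz:
  fixes g w :: "real \<Rightarrow> 'a::euclidean_space"
  assumes "a < b" "weak_pair a b g w" "continuous_on {a..b} g"
    and "AE x in lebesgue_on {a<..<b}. norm (w x) \<le> \<Lambda>" "0 \<le> \<Lambda>"
    and "a \<le> x" "x \<le> y" "y \<le> b"
  shows "norm (g y - g x) \<le> \<Lambda> * (y - x)"
  by (rule lipschitz_closure[OF assms(1,3) weak_lipschitz_interior[OF assms(2-5)] assms(6-8)])

text \<open>Subtracting a primitive of \<open>w\<close> leaves a continuous function with weak
  derivative zero, and the Lipschitz bound with constant 0 makes it constant.\<close>

lemma weak_deriv_classical:
  fixes g w :: "real \<Rightarrow> 'a::euclidean_space"
  assumes ab: "a < b" and wp: "weak_pair a b g w" and g: "continuous_on {a..b} g"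
    and w: "continuous_on {a..b} w" and x: "x \<in> {a..b}"
  shows "(g has_vector_derivative w x) (at x within {a..b})"
proof -
  define H where "H x = integral {a..x} w" for x
  have H: "(H has_vector_derivative w x) (at x within {a..b})" if "x \<in> {a..b}" for x
    unfolding H_def[abs_def] by (rule integral_has_vector_derivative[OF w that])
  have contH: "continuous_on {a..b} H"
    using H has_vector_derivative_continuous continuous_on_eq_continuous_within by blast
  have "weak_pair a b (\<lambda>x. g x - H x) (\<lambda>_. 0)"
    unfolding weak_pair_def
  proof (intro allI impI)
    fix \<phi> assume \<phi>: "test_fun a b \<phi>"
    have c: "continuous_on {a..b} (deriv \<phi>)" using test_fun_D(3)[OF \<phi>] ab by simp
    have "(LINT x|lebesgue_on {a<..<b}. deriv \<phi> x *\<^sub>R g x - deriv \<phi> x *\<^sub>R H x)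
        = (LINT x|lebesgue_on {a<..<b}. deriv \<phi> x *\<^sub>R g x) - (LINT x|lebesgue_on {a<..<b}. deriv \<phi> x *\<^sub>R H x)"
      by (intro Bochner_Integration.integral_diff integrable_open_interval continuous_intros c g contH)
    also have "\<dots> = 0"
      using wp weak_pair_classical[OF ab H w] \<phi> unfolding weak_pair_def by simp
    finally show "(LINT x|lebesgue_on {a<..<b}. deriv \<phi> x *\<^sub>R (g x - H x))
        = - (LINT x|lebesgue_on {a<..<b}. \<phi> x *\<^sub>R 0)"
      by (simp add: scaleR_right_diff_distrib)
  qed
  then have "norm ((g y - H y) - (g a - H a)) \<le> 0 * (y - a)" if "y \<in> {a..b}" for y
    using ab that by (intro weak_lipschitz[where g="\<lambda>x. g x - H x"]) (auto intro!: continuous_intros g contH)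
  then have "g y = (g a - H a) + H y" if "y \<in> {a..b}" for y using that by (simp add: algebra_simps)
  moreover have "((\<lambda>y. (g a - H a) + H y) has_vector_derivative w x) (at x within {a..b})"
    using H[OF x] by (auto intro!: derivative_eq_intros)
  ultimately show ?thesis by (rule has_vector_derivative_transform[OF x])
qed

lemma norm_derivative_le:
  fixes H :: "real \<Rightarrow> 'a::real_normed_vector"
  assumes ab: "a < b" and H: "(H has_vector_derivative v) (at x within {a..b})" and x: "x \<in> {a..b}"
    and lip: "\<And>y. y \<in> {a..b} \<Longrightarrow> norm (H y - H x) \<le> \<Lambda> * \<bar>y - x\<bar>"
  shows "norm v \<le> \<Lambda>"
proof (rule field_le_epsilon)
  fix e :: real assume e: "0 < e"
  obtain d where d: "0 < d" "\<And>y. y \<in> {a..b} \<Longrightarrow> norm (y - x) < d \<Longrightarrow>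
      norm (H y - H x - (y - x) *\<^sub>R v) \<le> e * norm (y - x)"
    using H e unfolding has_vector_derivative_def has_derivative_within_alt by blast
  obtain y where y: "y \<in> {a..b}" "y \<noteq> x" "\<bar>y - x\<bar> < d"
  proof (cases "x < b")
    case True
    define z where "z = min (d / 2) (b - x)"
    have "0 < z" "z < d" "z \<le> b - x" using True d(1) by (auto simp: z_def min_def)
    then show ?thesis using that[of "x + z"] x by simp
  next
    case False
    define z where "z = min (d / 2) (x - a)"
    have "0 < z" "z < d" "z \<le> x - a" using False ab x d(1) by (auto simp: z_def min_def)
    then show ?thesis using that[of "x - z"] x by simp
  qed
  have "\<bar>y - x\<bar> * norm v = norm ((H y - H x) - (H y - H x - (y - x) *\<^sub>R v))" by simp
  also have "\<dots> \<le> \<Lambda> * \<bar>y - x\<bar> + e * \<bar>y - x\<bar>"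
    using lip[OF y(1)] d(2)[OF y(1), unfolded real_norm_def, OF y(3)]
      norm_triangle_ineq4[of "H y - H x" "H y - H x - (y - x) *\<^sub>R v"] by linarith
  finally have "\<bar>y - x\<bar> * norm v \<le> \<bar>y - x\<bar> * (\<Lambda> + e)" by (simp add: algebra_simps)
  then show "norm v \<le> \<Lambda> + e" using y(2) by simp
qed

text \<open>At order zero the weak derivative is another representative of \<open>f\<close>. Rather
  than proving equality almost everywhere, one observes that a primitive of \<open>f\<close> has
  weak derivative \<open>w\<close>; it is then Lipschitz with constant \<Lambda>, and
  \<open>f\<close> is its classical derivative.\<close>

lemma weak_bound:
  fixes f w :: "real \<Rightarrow> 'a::euclidean_space"
  assumes ab: "a < b" and f: "continuous_on {a..b} f" and wd: "weak_deriv a b 0 f w"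
    and w: "AE x in lebesgue_on {a<..<b}. norm (w x) \<le> \<Lambda>" "0 \<le> \<Lambda>" and x: "x \<in> {a..b}"
  shows "norm (f x) \<le> \<Lambda>"
proof -
  define H where "H x = integral {a..x} f" for x
  have H: "(H has_vector_derivative f x) (at x within {a..b})" if "x \<in> {a..b}" for x
    unfolding H_def[abs_def] by (rule integral_has_vector_derivative[OF f that])
  have contH: "continuous_on {a..b} H"
    using H has_vector_derivative_continuous continuous_on_eq_continuous_within by blast
  have "weak_pair a b H w"
    using weak_pair_classical[OF ab H f] wd unfolding weak_pair_def weak_deriv_def by simp
  note lip = weak_lipschitz[OF ab this contH w]
  have "norm (H y - H x) \<le> \<Lambda> * \<bar>y - x\<bar>" if "y \<in> {a..b}" for y
  proof (cases "x \<le> y")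
    case True
    then show ?thesis using lip[of x y] x that by simp
  next
    case False
    then show ?thesis using lip[of y x] x that by (simp add: norm_minus_commute)
  qed
  then show ?thesis using norm_derivative_le[OF ab H[OF x] x] by blast
qed

section \<open>Periodic extensions\<close>

text \<open>Arguments are reduced to the half-open cell from a to b, so the value at b is replaced
  by the one at a; with equal end values closed cells can be used instead.\<close>

definition periodic_ext :: "real \<Rightarrow> real \<Rightarrow> (real \<Rightarrow> 'a) \<Rightarrow> real \<Rightarrow> 'a" where
  "periodic_ext a b f x = f (x - (b - a) * of_int \<lfloor>(x - a) / (b - a)\<rfloor>)"

lemma periodic_ext_periodic:
  assumes "a < b" shows "periodic_ext a b f (x + (b - a)) = periodic_ext a b f x"
proof -
  have "(x + (b - a) - a) / (b - a) = (x - a) / (b - a) + 1" using assms by (simp add: field_simps)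
  then have "\<lfloor>(x + (b - a) - a) / (b - a)\<rfloor> = \<lfloor>(x - a) / (b - a)\<rfloor> + 1" by simp
  then show ?thesis unfolding periodic_ext_def by (simp add: algebra_simps)
qed

lemma periodic_ext_cell:
  assumes "a < b" "f a = f b" "a + (b - a) * of_int n \<le> x" "x \<le> b + (b - a) * of_int n"
  shows "periodic_ext a b f x = f (x - (b - a) * of_int n)"
proof (cases "x = b + (b - a) * of_int n")
  case True
  then have "(x - a) / (b - a) = of_int (n + 1)" using assms(1) by (simp add: field_simps)
  then have "\<lfloor>(x - a) / (b - a)\<rfloor> = n + 1" by simp
  moreover have "x - (b - a) * of_int (n + 1) = a" "x - (b - a) * of_int n = b"
    by (simp_all add: True algebra_simps)
  ultimately show ?thesis using assms(2) by (simp only: periodic_ext_def)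
next
  case False
  then have "\<lfloor>(x - a) / (b - a)\<rfloor> = n"
    using assms by (intro floor_unique) (auto simp: field_simps)
  then show ?thesis by (simp add: periodic_ext_def)
qed

lemma periodic_ext_id: "a < b \<Longrightarrow> f a = f b \<Longrightarrow> a \<le> x \<Longrightarrow> x \<le> b \<Longrightarrow> periodic_ext a b f x = f x"
  using periodic_ext_cell[of a b f 0 x] by simp

lemma cell_exists:
  fixes x :: real
  assumes "a < b"
  obtains n :: int where "a + (b - a) * of_int n \<le> x" "x < b + (b - a) * of_int n"
proof -
  define z where "z = (x - a) / (b - a)"
  have "x = a + (b - a) * z" using assms by (simp add: z_def)
  moreover have "(b - a) * of_int \<lfloor>z\<rfloor> \<le> (b - a) * z" "(b - a) * z < (b - a) * (of_int \<lfloor>z\<rfloor> + 1)"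
    using assms by (auto intro!: mult_left_mono mult_strict_left_mono)
  ultimately show ?thesis using that[of "\<lfloor>z\<rfloor>"] by (simp add: algebra_simps)
qed

lemma periodic_ext_in_range: "a < b \<Longrightarrow> \<exists>y\<in>{a..b}. periodic_ext a b f x = f y"
proof -
  assume ab: "a < b"
  obtain n :: int where n: "a + (b - a) * of_int n \<le> x" "x < b + (b - a) * of_int n"
    by (rule cell_exists[OF ab])
  then have "\<lfloor>(x - a) / (b - a)\<rfloor> = n"
    using ab by (intro floor_unique) (auto simp: field_simps)
  then show ?thesis using n by (intro bexI[of _ "x - (b - a) * of_int n"]) (auto simp: periodic_ext_def)
qed

text \<open>On each closed cell the derivative within the cell is that of a translate of
  \<open>f\<close>. A cell boundary belongs to two cells whose one-sided derivatives agree because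
  f' a = f' b, and near it the union of the two cells is a full neighbourhood.\<close>

lemma periodic_ext_has_derivative:
  fixes f :: "real \<Rightarrow> 'a::real_normed_vector"
  assumes ab: "a < b" and fab: "f a = f b" "f' a = f' b"
    and f: "\<And>x. x \<in> {a..b} \<Longrightarrow> (f has_vector_derivative f' x) (at x within {a..b})"
  shows "(periodic_ext a b f has_vector_derivative periodic_ext a b f' x) (at x)"
proof -
  let ?L = "b - a"
  have cell: "(periodic_ext a b f has_vector_derivative periodic_ext a b f' x) (at x within {a + ?L * of_int n..b + ?L * of_int n})"
    if "x \<in> {a + ?L * of_int n..b + ?L * of_int n}" for x and n :: int
  proof -
    let ?I = "{a + ?L * of_int n..b + ?L * of_int n}"
    have img: "(\<lambda>x. x - ?L * of_int n) ` ?I \<subseteq> {a..b}" by auto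
    have "((\<lambda>x. x - ?L * of_int n) has_vector_derivative 1) (at x within ?I)"
      by (auto intro!: derivative_eq_intros)
    moreover have "(f has_vector_derivative f' (x - ?L * of_int n))
        (at (x - ?L * of_int n) within (\<lambda>x. x - ?L * of_int n) ` ?I)"
      using that by (intro has_vector_derivative_within_subset[OF f img]) auto
    ultimately have "((\<lambda>x. f (x - ?L * of_int n)) has_vector_derivative f' (x - ?L * of_int n)) (at x within ?I)"
      using vector_diff_chain_within[of "\<lambda>x. x - ?L * of_int n" 1 x ?I f "f' (x - ?L * of_int n)"]
      by (simp add: o_def)
    then have "(periodic_ext a b f has_vector_derivative f' (x - ?L * of_int n)) (at x within ?I)"
      by (rule has_vector_derivative_transform[OF that, rotated]) (auto simp: periodic_ext_cell[OF ab fab(1)])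
    then show ?thesis using periodic_ext_cell[OF ab fab(2), of n x] that by simp
  qed
  obtain n :: int where n: "a + ?L * of_int n \<le> x" "x < b + ?L * of_int n"
    by (rule cell_exists[OF ab])
  show ?thesis
  proof (cases "x = a + ?L * of_int n")
    case False
    then have "x \<in> interior {a + ?L * of_int n..b + ?L * of_int n}" using n by (simp add: interior_atLeastAtMost_real)
    then show ?thesis using cell[of x n] n at_within_interior by fastforce
  next
    case True
    let ?I = "{a + ?L * of_int n..b + ?L * of_int n}" and ?J = "{a + ?L * of_int (n - 1)..b + ?L * of_int (n - 1)}"
    have "x \<in> ?I" "x \<in> ?J" using True ab by (auto simp: algebra_simps)
    then have "(periodic_ext a b f has_vector_derivative periodic_ext a b f' x) (at x within ?J \<union> ?I)"
      using cell[of x n] cell[of x "n - 1"]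
      unfolding has_vector_derivative_def has_derivative_within Lim_within_Un by blast
    moreover have "x \<in> interior (?J \<union> ?I)"
    proof (rule interiorI)
      show "open {x - ?L <..< x + ?L}" by simp
      show "x \<in> {x - ?L <..< x + ?L}" using ab by simp
      show "{x - ?L <..< x + ?L} \<subseteq> ?J \<union> ?I" using True by (auto simp: algebra_simps)
    qed
    then have "at x within ?J \<union> ?I = at x" by (rule at_within_interior)
    ultimately show ?thesis by (simp only:)
  qed
qed

text \<open>A step of length at most b - a crosses at most one cell boundary; there the increment is
  split, the two end values being equal.\<close>

lemma periodic_ext_lipschitz:
  fixes g :: "real \<Rightarrow> 'a::real_normed_vector"
  assumes ab: "a < b" and gab: "g a = g b"
    and lip: "\<And>x y. a \<le> x \<Longrightarrow> x \<le> y \<Longrightarrow> y \<le> b \<Longrightarrow> norm (g y - g x) \<le> \<Lambda> * (y - x)"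
    and s: "0 < s" "s \<le> b - a"
  shows "norm (fdiff s (periodic_ext a b g) x) \<le> \<Lambda> * s"
proof -
  let ?L = "b - a"
  obtain n :: int where n: "a + ?L * of_int n \<le> x" "x < b + ?L * of_int n"
    by (rule cell_exists[OF ab])
  show ?thesis
  proof (cases "x + s \<le> b + ?L * of_int n")
    case True
    have "periodic_ext a b g (x + s) = g (x + s - ?L * of_int n)" "periodic_ext a b g x = g (x - ?L * of_int n)"
      using n True s by (auto intro!: periodic_ext_cell[OF ab gab])
    then show ?thesis
      using lip[of "x - ?L * of_int n" "x + s - ?L * of_int n"] n True s by (simp add: fdiff_def algebra_simps)
  next
    case False
    have 1: "periodic_ext a b g (x + s) = g (x + s - ?L * of_int (n + 1))"
      using n False s by (intro periodic_ext_cell[OF ab gab]) (auto simp: algebra_simps)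
    have 2: "periodic_ext a b g x = g (x - ?L * of_int n)"
      using n by (intro periodic_ext_cell[OF ab gab]) auto
    have "fdiff s (periodic_ext a b g) x = (g (x + s - ?L * of_int (n + 1)) - g a) + (g b - g (x - ?L * of_int n))"
      unfolding fdiff_def 1 2 gab by simp
    also have "norm \<dots> \<le> \<Lambda> * (x + s - ?L * of_int (n + 1) - a) + \<Lambda> * (b - (x - ?L * of_int n))"
      using n False s by (intro order_trans[OF norm_triangle_ineq] add_mono lip) (auto simp: algebra_simps)
    also have "\<dots> = \<Lambda> * s" by (simp add: algebra_simps)
    finally show ?thesis .
  qed
qed

lemma fdiff_pow_has_derivative:
  fixes f :: "real \<Rightarrow> 'a::real_normed_vector"
  assumes "\<And>x. (f has_vector_derivative f' x) (at x)"
  shows "((fdiff s ^^ k) f has_vector_derivative (fdiff s ^^ k) f' x) (at x)"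
proof (induction k arbitrary: x)
  case (Suc k)
  have "((\<lambda>x. x + s) has_vector_derivative 1) (at x)" by (auto intro!: derivative_eq_intros)
  from vector_diff_chain_at[OF this Suc.IH]
  have "((\<lambda>x. (fdiff s ^^ k) f (x + s)) has_vector_derivative (fdiff s ^^ k) f' (x + s)) (at x)"
    by (simp add: o_def)
  then show ?case
    using Suc.IH by (auto simp: fdiff_def[abs_def] intro!: has_vector_derivative_diff)
qed (simp add: assms)

lemma fdiff_le_derivative:
  fixes f :: "real \<Rightarrow> 'a::real_normed_vector"
  assumes f: "\<And>x. (f has_vector_derivative f' x) (at x)" and "\<And>x. norm (f' x) \<le> B" "0 \<le> s"
  shows "norm (fdiff s f x) \<le> B * s"
proof -
  have "((\<lambda>\<sigma>. f (x + \<sigma>)) has_vector_derivative f' (x + \<sigma>)) (at \<sigma>)" for \<sigma>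
  proof -
    have "((\<lambda>\<sigma>. x + \<sigma>) has_vector_derivative 1) (at \<sigma>)" by (auto intro!: derivative_eq_intros)
    from vector_diff_chain_at[OF this f] show ?thesis by (simp add: o_def)
  qed
  from norm_le_of_deriv_le[OF assms(3) this, of B 0] show ?thesis
    using assms(2) by (simp add: fdiff_def)
qed

text \<open>Each of the j classical derivatives trades one difference for a factor s by the mean
  value inequality; the remaining difference falls on \<open>G j\<close>, where a Lipschitz bound is
  enough. Thus j + 1 orders are reached with j derivatives, as suits functions whose top derivative
  is only weak or lives only in the open interval.\<close>

lemma periodic_fdiff_bound:
  fixes G :: "nat \<Rightarrow> real \<Rightarrow> 'a::real_normed_vector"
  assumes ab: "a < b" and s: "0 < s" "s \<le> b - a"
  shows "(\<And>i. i \<le> j \<Longrightarrow> G i a = G i b) \<Longrightarrow>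
    (\<And>i x. i < j \<Longrightarrow> x \<in> {a..b} \<Longrightarrow> (G i has_vector_derivative G (Suc i) x) (at x within {a..b})) \<Longrightarrow>
    (\<And>x y. a \<le> x \<Longrightarrow> x \<le> y \<Longrightarrow> y \<le> b \<Longrightarrow> norm (G j y - G j x) \<le> \<Lambda> * (y - x)) \<Longrightarrow>
    norm ((fdiff s ^^ Suc j) (periodic_ext a b (G 0)) x) \<le> \<Lambda> * s ^ Suc j"
proof (induction j arbitrary: G x)
  case 0
  show ?case using periodic_ext_lipschitz[OF ab 0(1) 0(3) s] by simp
next
  case (Suc j)
  have IH: "norm ((fdiff s ^^ Suc j) (periodic_ext a b (G 1)) x) \<le> \<Lambda> * s ^ Suc j" for x
    using Suc.IH[of "\<lambda>i. G (Suc i)"] Suc.prems by simp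
  have "(periodic_ext a b (G 0) has_vector_derivative periodic_ext a b (G 1) x) (at x)" for x
    using Suc.prems(1)[of 0] Suc.prems(1)[of 1] Suc.prems(2)[of 0] by (intro periodic_ext_has_derivative ab) auto
  from fdiff_le_derivative[OF fdiff_pow_has_derivative[OF this, where s=s and k="Suc j"] IH] s
  have "norm (fdiff s ((fdiff s ^^ Suc j) (periodic_ext a b (G 0))) x) \<le> \<Lambda> * s ^ Suc j * s" by simp
  then show ?case by (simp add: mult_ac)
qed

section \<open>From essential bounds to bounds on differences\<close>

lemma AE_dense:
  fixes x :: real
  assumes AE: "AE t in lebesgue_on S. P t" and S: "S \<in> sets lebesgue" "{u<..<v} \<subseteq> S" "u < v"
    and x: "x \<in> {u..v}" and e: "0 < e"
  shows "\<exists>t\<in>{u<..<v}. P t \<and> \<bar>t - x\<bar> < e"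
proof (rule ccontr)
  assume not: "\<not> ?thesis"
  let ?U = "{max u (x - e)<..<min v (x + e)}"
  have "AE t in lebesgue. t \<in> S \<longrightarrow> P t" using AE S(1) by (simp add: AE_restrict_space_iff)
  then have "AE t in lebesgue. t \<notin> ?U"
  proof eventually_elim
    case (elim t)
    show ?case
    proof
      assume t: "t \<in> ?U"
      then have "t \<in> {u<..<v}" "\<bar>t - x\<bar> < e" by auto
      then show False using not elim S(2) by blast
    qed
  qed
  then have "?U \<in> null_sets lebesgue" by (subst (asm) AE_iff_null_sets[symmetric]) auto
  then have "negligible ?U" by (simp add: negligible_iff_null_sets)
  moreover have "max u (x - e) < min v (x + e)" using x e S(3) by (simp add: max_def min_def)
  then have "?U \<noteq> {}" unfolding greaterThanLessThan_empty_iff by linarith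
  ultimately show False using open_not_negligible[of ?U] by simp
qed

lemma AE_continuous_bound:
  fixes f :: "real \<Rightarrow> 'a::real_normed_vector"
  assumes "AE x in lebesgue_on {a<..<b}. norm (f x) \<le> c" "continuous_on {a<..<b} f" "x \<in> {a<..<b}"
  shows "norm (f x) \<le> c"
proof (rule field_le_epsilon)
  fix e :: real assume "0 < e"
  have "isCont f x" using assms(2,3) by (simp add: continuous_on_eq_continuous_at)
  then obtain d where d: "0 < d" "\<And>y. dist y x < d \<Longrightarrow> dist (f y) (f x) < e"
    using \<open>0 < e\<close> unfolding continuous_at_eps_delta by blast
  obtain y where "norm (f y) \<le> c" "\<bar>y - x\<bar> < d"
    using AE_dense[OF assms(1) _ order_refl, of x d] assms(3) d(1) by auto
  then show "norm (f x) \<le> c + e"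
    using d(2)[of y] norm_triangle_ineq3[of "f y" "f x"] by (simp add: dist_norm abs_le_iff)
qed

lemma Linf_norm_AE:
  assumes "Linf_norm a b f \<le> ereal c"
  shows "AE x in lebesgue_on {a<..<b}. norm (f x) \<le> c"
  using esssup_AE[where M="lebesgue_on {a<..<b}" and f="\<lambda>x. ereal (norm (f x))"]
proof eventually_elim
  case (elim x)
  then show ?case using assms by (simp add: Linf_norm_def) (metis ereal_less_eq(3) order_trans)
qed

text \<open>The fundamental theorem works with differentiability in the interior and represents
  \<open>g\<close> by an integral of \<open>w\<close>, which is differentiable at the end points as
  well.\<close>

lemma interior_deriv_closed:
  fixes g :: "real \<Rightarrow> 'a::banach"
  assumes "continuous_on {a..b} g" "continuous_on {a..b} w"
    and g: "\<And>x. x \<in> {a<..<b} \<Longrightarrow> (g has_vector_derivative w x) (at x)" and x: "x \<in> {a..b}"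
  shows "(g has_vector_derivative w x) (at x within {a..b})"
proof -
  have "g y = g a + integral {a..y} w" if "y \<in> {a..b}" for y
  proof -
    have "(w has_integral (g y - g a)) {a..y}"
      using that g by (intro fundamental_theorem_of_calculus_interior continuous_on_subset[OF assms(1)]) auto
    then show ?thesis by (simp add: integral_unique)
  qed
  moreover have "((\<lambda>y. g a + integral {a..y} w) has_vector_derivative w x) (at x within {a..b})"
    using integral_has_vector_derivative[OF assms(2) x] by (auto intro!: derivative_eq_intros)
  ultimately show ?thesis by (rule has_vector_derivative_transform[OF x])
qed

text \<open>The derivative of order m is controlled only inside the interval. Hence the top order
  enters through a Lipschitz bound for the derivative below it, obtained from the mean value
  inequality inside and extended to the end points by continuity.\<close>

lemma Cm_periodic_fdiff:
  assumes ab: "a < b" and m: "0 < m" and V: "Cm_periodic m a b V"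
    and D: "\<And>k. k \<le> m \<Longrightarrow> Linf_norm a b (cderiv a b k V) \<le> ereal (D k)"
    and s: "0 < s" "s \<le> b - a" and k: "k \<le> m"
  shows "norm ((fdiff s ^^ k) (periodic_ext a b V) x) \<le> D k * s ^ k"
proof -
  have cont: "continuous_on {a..b} (cderiv a b k V)" if "k < m" for k
    using V that by (simp add: Cm_periodic_def)
  have cont': "continuous_on {a<..<b} (cderiv a b k V)" if "k \<le> m" for k
  proof (cases "k = m")
    case False
    then show ?thesis using cont[of k] that by (auto intro: continuous_on_subset)
  qed (use V in \<open>simp add: Cm_periodic_def\<close>)
  have bound: "norm (cderiv a b k V x) \<le> D k" if "k \<le> m" "x \<in> {a<..<b}" for k x
    using AE_continuous_bound[OF Linf_norm_AE[OF D[OF that(1)]] cont'[OF that(1)] that(2)] .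
  have deriv: "(cderiv a b k V has_vector_derivative cderiv a b (Suc k) V x) (at x)" if "k < m" "x \<in> {a<..<b}" for k x
  proof -
    have "cderiv a b k V differentiable (at x within {a<..<b})"
      using V that unfolding Cm_periodic_def differentiable_on_def by blast
    then have "cderiv a b k V differentiable (at x)"
      using at_within_open[OF that(2)] by (simp only: open_greaterThanLessThan)
    then have "(cderiv a b k V has_vector_derivative vector_derivative (cderiv a b k V) (at x)) (at x)"
      by (simp only: vector_derivative_works)
    moreover have "at x within {a..b} = at x"
      using that(2) by (intro at_within_interior) (simp add: interior_atLeastAtMost_real)
    ultimately show ?thesis by (simp only: cderiv.simps)
  qed
  show ?thesis
  proof (cases k)
    case 0
    have "norm (V y) \<le> D 0" if "y \<in> {a..b}" for y
      using continuous_on_closure_norm_le[of "{a<..<b}" V "D 0" y] cont[of 0] bound[of 0] m ab that by simp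
    then show ?thesis using periodic_ext_in_range[OF ab, of V x] 0 by auto
  next
    case (Suc j)
    have "norm ((fdiff s ^^ Suc j) (periodic_ext a b (cderiv a b 0 V)) x) \<le> D (Suc j) * s ^ Suc j"
    proof (rule periodic_fdiff_bound[OF ab s])
      show "cderiv a b i V a = cderiv a b i V b" if "i \<le> j" for i
        using V that k Suc by (simp add: Cm_periodic_def)
      show "(cderiv a b i V has_vector_derivative cderiv a b (Suc i) V x) (at x within {a..b})"
        if "i < j" "x \<in> {a..b}" for i x
        using that k Suc deriv by (intro interior_deriv_closed cont) auto
      show "norm (cderiv a b j V y - cderiv a b j V x) \<le> D (Suc j) * (y - x)"
        if "a \<le> x" "x \<le> y" "y \<le> b" for x y
      proof (rule lipschitz_closure[OF ab cont _ that])
        show "j < m" using k Suc by simp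
        fix x y assume xy: "a < x" "x < y" "y < b"
        have "norm (cderiv a b j V y - cderiv a b j V x) \<le> D (Suc j) * norm (y - x)"
        proof (rule differentiable_bound[where S="{x..y}" and f'="\<lambda>z h. h *\<^sub>R cderiv a b (Suc j) V z"])
          show "onorm (\<lambda>h. h *\<^sub>R cderiv a b (Suc j) V z) \<le> D (Suc j)" if "z \<in> {x..y}" for z
          proof (rule onorm_le)
            fix h :: real
            show "norm (h *\<^sub>R cderiv a b (Suc j) V z) \<le> D (Suc j) * norm h"
              using bound[of "Suc j" z] that xy k Suc
              by (simp del: cderiv.simps add: abs_mult mult.commute[of _ "\<bar>h\<bar>"] mult_left_mono)
          qed
          show "(cderiv a b j V has_derivative (\<lambda>h. h *\<^sub>R cderiv a b (Suc j) V z)) (at z within {x..y})"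
            if "z \<in> {x..y}" for z
            using deriv[of j z] that xy k Suc
            by (auto simp del: cderiv.simps simp: has_vector_derivative_def intro: has_derivative_at_withinI)
        qed (use xy in auto)
        then show "norm (cderiv a b j V y - cderiv a b j V x) \<le> D (Suc j) * (y - x)" using xy by simp
      qed
    qed
    then show ?thesis using Suc by simp
  qed
qed

text \<open>The continuous representatives of the weak derivatives below order k form a chain of
  classical derivatives, and the essential bound at order k makes the last of them Lipschitz. The
  absolute value appears because \<open>C k\<close> has no prescribed sign.\<close>

lemma Winf_fdiff:
  fixes f :: "real \<Rightarrow> 'a::euclidean_space"
  assumes ab: "a < b" and f: "in_Winf_per m a b f" "continuous_on {a..b} f" "f a = f b"
    and C: "\<And>k. k \<le> m \<Longrightarrow> Linf_norm a b (wderiv a b k f) \<le> ereal (C k)"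
    and s: "0 < s" "s \<le> b - a" and k: "k \<le> m"
  shows "norm ((fdiff s ^^ k) (periodic_ext a b f) x) \<le> \<bar>C k\<bar> * s ^ k"
proof -
  have wd: "weak_deriv a b k f (wderiv a b k f)" if "k \<le> m" for k
  proof -
    have "\<exists>g. weak_deriv a b k f g" using f(1) that unfolding in_Winf_per_def in_Winf_def by simp
    then show ?thesis unfolding wderiv_def by (rule someI_ex)
  qed
  have AE: "AE x in lebesgue_on {a<..<b}. norm (wderiv a b k f x) \<le> \<bar>C k\<bar>" if "k \<le> m" for k
    using Linf_norm_AE[OF C[OF that]] by eventually_elim simp
  show ?thesis
  proof (cases k)
    case 0
    then show ?thesis
      using weak_bound[OF ab f(2) wd AE] k periodic_ext_in_range[OF ab, of f x] by auto
  next
    case (Suc j)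
    \<comment> \<open>At order zero the function itself is chosen as representative, so that the
      bound concerns its actual values and not those of a function equal to it almost
      everywhere.\<close>
    have "\<exists>g. weak_deriv a b i f g \<and> continuous_on {a..b} g \<and> g a = g b \<and> (i = 0 \<longrightarrow> g = f)" if "i < m" for i
    proof (cases "i = 0")
      case True
      have "weak_deriv a b 0 f f" using wd[of 0] by (simp add: weak_deriv_def)
      then show ?thesis using True f by auto
    next
      case False
      then show ?thesis using f(1) that by (auto simp: in_Winf_per_def)
    qed
    then have "\<exists>G. \<forall>i. i < m \<longrightarrow> weak_deriv a b i f (G i) \<and> continuous_on {a..b} (G i) \<and> G i a = G i b
        \<and> (i = 0 \<longrightarrow> G i = f)"
      by (intro choice allI) blast
    then obtain G where G: "\<And>i. i < m \<Longrightarrow> weak_deriv a b i f (G i)" "\<And>i. i < m \<Longrightarrow> continuous_on {a..b} (G i)"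
      "\<And>i. i < m \<Longrightarrow> G i a = G i b" "0 < m \<Longrightarrow> G 0 = f" by blast
    have "norm ((fdiff s ^^ Suc j) (periodic_ext a b (G 0)) x) \<le> \<bar>C (Suc j)\<bar> * s ^ Suc j"
    proof (rule periodic_fdiff_bound[OF ab s])
      show "G i a = G i b" if "i \<le> j" for i using G(3) that k Suc by simp
      show "(G i has_vector_derivative G (Suc i) x) (at x within {a..b})" if "i < j" "x \<in> {a..b}" for i x
        using that k Suc
        by (intro weak_deriv_classical[OF ab weak_derivs_weak_pair[OF G(1) G(1)] G(2) G(2)]) auto
      show "norm (G j y - G j x) \<le> \<bar>C (Suc j)\<bar> * (y - x)" if "a \<le> x" "x \<le> y" "y \<le> b" for x y
        using k Suc by (intro weak_lipschitz[OF ab weak_derivs_weak_pair[OF G(1) wd] G(2) AE] that) auto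
    qed
    then show ?thesis using G(4) k Suc by simp
  qed
qed

section \<open>Convergence\<close>

lemma fdiff_pow_tendsto:
  fixes f :: "nat \<Rightarrow> real \<Rightarrow> 'a::real_normed_vector"
  assumes "\<And>x. (\<lambda>i. f i x) \<longlonglongrightarrow> g x"
  shows "(\<lambda>i. (fdiff s ^^ k) (f i) x) \<longlonglongrightarrow> (fdiff s ^^ k) g x"
proof (induction k arbitrary: x)
  case (Suc k)
  show ?case using tendsto_diff[OF Suc.IH[of "x + s"] Suc.IH[of x]] by (simp add: fdiff_def)
qed (simp add: assms)

text \<open>The difference quotients with steps \<open>s / 2 ^ n\<close> form a telescoping series whose terms are
  second differences.\<close>

lemma taylor_second_difference:
  fixes f :: "real \<Rightarrow> 'a::real_normed_vector"
  assumes f: "(f has_vector_derivative v) (at x within {a..b})" and x: "a \<le> x" "0 < s" "x + s \<le> b"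
    and B: "\<And>r. 0 < r \<Longrightarrow> 2 * r \<le> s \<Longrightarrow> norm (f (x + 2 * r) - f (x + r) - (f (x + r) - f x)) \<le> B * r\<^sup>2"
    and "0 \<le> B"
  shows "norm (f (x + s) - f x - s *\<^sub>R v) \<le> B * s\<^sup>2"
proof -
  define e where "e n = 2 ^ n *\<^sub>R (f (x + s / 2 ^ n) - f x)" for n :: nat
  have step: "norm (e n - e (Suc n)) \<le> B * s\<^sup>2 * (1 / 2) ^ n / 4" for n
  proof -
    define r where "r = s / 2 ^ Suc n"
    have r: "0 < r" "2 * r = s / 2 ^ n" using x by (simp_all add: r_def)
    have "s / 2 ^ n \<le> s" using x by (simp add: divide_le_eq)
    have "e n - e (Suc n) = 2 ^ n *\<^sub>R (f (x + 2 * r) - f (x + r) - (f (x + r) - f x))"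
    proof -
      have "e n = 2 ^ n *\<^sub>R (f (x + 2 * r) - f x)" by (simp only: e_def r(2))
      moreover have "e (Suc n) = 2 ^ n *\<^sub>R (2 *\<^sub>R (f (x + r) - f x))" by (simp add: e_def r_def)
      moreover have "y - z - 2 *\<^sub>R (w - z) = y - w - (w - z)" for y z w :: 'a
        by (simp add: scaleR_2)
      ultimately show ?thesis by (simp only: scaleR_right_diff_distrib[of "2 ^ n", symmetric])
    qed
    then have "norm (e n - e (Suc n)) \<le> 2 ^ n * (B * r\<^sup>2)"
      using B[OF r(1)] r(2) \<open>s / 2 ^ n \<le> s\<close> by simp
    also have "\<dots> = B * s\<^sup>2 * (1 / 2) ^ n / 4"
      by (simp add: r_def power_divide power2_eq_square field_simps)
    finally show ?thesis .
  qed
  have tel: "norm (e 0 - e n) \<le> B * s\<^sup>2 * (1 - (1 / 2) ^ n)" for n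
  proof (induction n)
    case (Suc n)
    have "norm (e 0 - e (Suc n)) \<le> norm (e 0 - e n) + norm (e n - e (Suc n))"
      using norm_triangle_ineq[of "e 0 - e n" "e n - e (Suc n)"] by simp
    also have "\<dots> \<le> B * s\<^sup>2 * (1 - (1 / 2) ^ n) + B * s\<^sup>2 * (1 / 2) ^ n / 4"
      by (intro add_mono Suc step)
    also have "\<dots> \<le> B * s\<^sup>2 * (1 - (1 / 2) ^ n) + B * s\<^sup>2 * (1 / 2) ^ n / 2"
      using \<open>0 \<le> B\<close> by (intro add_left_mono divide_left_mono) auto
    also have "\<dots> = B * s\<^sup>2 * (1 - (1 / 2) ^ Suc n)" by (simp add: algebra_simps)
    finally show ?case .
  qed simp
  have le: "norm (e 0 - e n) \<le> B * s\<^sup>2" for n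
  proof -
    have "B * s\<^sup>2 * (1 - (1 / 2) ^ n) \<le> B * s\<^sup>2 * 1" using \<open>0 \<le> B\<close> by (intro mult_left_mono) auto
    with tel[of n] show ?thesis by simp
  qed
  have "e \<longlonglongrightarrow> s *\<^sub>R v"
  proof (rule LIMSEQ_I)
    fix r :: real assume r: "0 < r"
    obtain d where d: "0 < d" "\<And>y. y \<in> {a..b} \<Longrightarrow> norm (y - x) < d \<Longrightarrow>
        norm (f y - f x - (y - x) *\<^sub>R v) \<le> (r / (2 * s)) * norm (y - x)"
      using f r x unfolding has_vector_derivative_def has_derivative_within_alt
      by (metis divide_pos_pos mult_pos_pos zero_less_numeral)
    have "(\<lambda>n. s * (1 / 2) ^ n) \<longlonglongrightarrow> s * 0" by (intro tendsto_intros LIMSEQ_realpow_zero) auto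
    then have "\<forall>\<^sub>F n in sequentially. s * (1 / 2) ^ n < d" using d(1) by (intro order_tendstoD(2)) auto
    then obtain N where N: "\<And>n. N \<le> n \<Longrightarrow> s / 2 ^ n < d"
      unfolding eventually_sequentially by (auto simp: power_one_over)
    have "norm (e n - s *\<^sub>R v) < r" if "N \<le> n" for n
    proof -
      let ?y = "x + s / 2 ^ n"
      have "s / 2 ^ n \<le> s" "0 < s / 2 ^ n" using x by (simp_all add: divide_le_eq)
      moreover from this have "a \<le> ?y" using x by linarith
      ultimately have "norm (f ?y - f x - (s / 2 ^ n) *\<^sub>R v) \<le> (r / (2 * s)) * (s / 2 ^ n)"
        using d(2)[of ?y] N[OF that] x by simp
      then have "2 ^ n * norm (f ?y - f x - (s / 2 ^ n) *\<^sub>R v) \<le> 2 ^ n * ((r / (2 * s)) * (s / 2 ^ n))"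
        by (intro mult_left_mono) auto
      moreover have "e n - s *\<^sub>R v = 2 ^ n *\<^sub>R (f ?y - f x - (s / 2 ^ n) *\<^sub>R v)"
        by (simp add: e_def scaleR_right_diff_distrib)
      ultimately have "norm (e n - s *\<^sub>R v) \<le> r / 2" using x by simp
      then show ?thesis using r by simp
    qed
    then show "\<exists>no. \<forall>n\<ge>no. norm (e n - s *\<^sub>R v) < r" by blast
  qed
  then have "(\<lambda>n. norm (e 0 - e n)) \<longlonglongrightarrow> norm (e 0 - s *\<^sub>R v)" by (intro tendsto_intros)
  then have "norm (e 0 - s *\<^sub>R v) \<le> B * s\<^sup>2" by (rule LIMSEQ_le_const2) (use le in blast)
  then show ?thesis by (simp add: e_def)
qed

section \<open>From grid norms to the L2 norm\<close>

lemma riemann_sum: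
  fixes \<phi> :: "real \<Rightarrow> real"
  assumes ab: "a < b" and \<phi>: "continuous_on {a..b} \<phi>"
  shows "(\<lambda>N. mesh a b N * (\<Sum>i<N. \<phi> (node a b N i))) \<longlonglongrightarrow> integral {a..b} \<phi>"
proof (rule LIMSEQ_I)
  fix r :: real assume r: "0 < r"
  define e where "e = r / (2 * (b - a))"
  have e: "0 < e" using r ab by (simp add: e_def)
  have "uniformly_continuous_on {a..b} \<phi>" using \<phi> by (simp add: compact_uniformly_continuous)
  then obtain d where d: "0 < d" "\<And>x y. x \<in> {a..b} \<Longrightarrow> y \<in> {a..b} \<Longrightarrow> dist y x < d \<Longrightarrow> dist (\<phi> y) (\<phi> x) < e"
    using e unfolding uniformly_continuous_on_def by metis
  obtain N0 where N0: "(b - a) / d < real N0" using reals_Archimedean2 by blast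
  show "\<exists>no. \<forall>N\<ge>no. norm (mesh a b N * (\<Sum>i<N. \<phi> (node a b N i)) - integral {a..b} \<phi>) < r"
  proof (intro exI allI impI)
    fix N assume N: "Suc N0 \<le> N"
    let ?h = "mesh a b N" and ?z = "node a b N"
    have h: "0 < ?h" "?h < d"
    proof -
      have N0': "0 < real N" "(b - a) / d < real N" using N N0 by linarith+
      then show "0 < ?h" "?h < d" using ab d(1) by (simp_all add: mesh_def field_simps)
    qed
    have zN: "?z N = b" using N by (simp add: node_def mesh_def)
    have z0: "?z 0 = a" by (simp add: node_def)
    have mono: "?z i \<le> ?z j" if "i \<le> j" for i j using that h by (simp add: node_def mult_right_mono)
    have in_ab: "?z i \<in> {a..b}" if "i \<le> N" for i using mono[of 0 i] mono[OF that] zN z0 by simp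
    have int: "\<phi> integrable_on {?z i..?z j}" if "j \<le> N" for i j
      using in_ab[of j] that mono[of 0 i] z0
      by (intro integrable_continuous_real continuous_on_subset[OF \<phi>]) auto
    have split: "integral {a..?z k} \<phi> = (\<Sum>i<k. integral {?z i..?z (Suc i)} \<phi>)" if "k \<le> N" for k
      using that
    proof (induction k)
      case (Suc k)
      have "integral {?z 0..?z k} \<phi> + integral {?z k..?z (Suc k)} \<phi> = integral {?z 0..?z (Suc k)} \<phi>"
        using Suc.prems by (intro Henstock_Kurzweil_Integration.integral_combine mono int) auto
      with Suc show ?case by (simp add: z0)
    qed (simp add: z0)
    have cell: "\<bar>?h * \<phi> (?z i) - integral {?z i..?z (Suc i)} \<phi>\<bar> \<le> e * ?h" if "i < N" for i
    proof -
      have len: "?z (Suc i) = ?z i + ?h" by (rule node_Suc)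
      have "((\<lambda>x. \<phi> (?z i) - \<phi> x) has_integral (?h * \<phi> (?z i) - integral {?z i..?z (Suc i)} \<phi>)) {?z i..?z (Suc i)}"
        using has_integral_const_real[of "\<phi> (?z i)" "?z i" "?z (Suc i)"] that int[of "Suc i" i] h
        by (intro has_integral_diff integrable_integral) (auto simp: len)
      moreover have "norm (\<phi> (?z i) - \<phi> x) \<le> e" if "x \<in> {?z i..?z (Suc i)}" for x
      proof -
        have "x \<in> {a..b}" using that in_ab[of i] in_ab[of "Suc i"] \<open>i < N\<close> by auto
        moreover have "dist (?z i) x < d" using that h by (auto simp: len dist_real_def)
        ultimately show ?thesis
          using d(2)[of x "?z i"] in_ab[of i] \<open>i < N\<close> by (simp add: dist_norm less_imp_le)
      qed
      ultimately have "norm (?h * \<phi> (?z i) - integral {?z i..?z (Suc i)} \<phi>)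
          \<le> e * measure lborel (cbox (?z i) (?z (Suc i)))"
        using e by (intro has_integral_bound) auto
      then show ?thesis using h by (simp add: len)
    qed
    have "?h * (\<Sum>i<N. \<phi> (?z i)) - integral {a..b} \<phi>
        = (\<Sum>i<N. ?h * \<phi> (?z i) - integral {?z i..?z (Suc i)} \<phi>)"
      using split[of N] by (simp add: zN sum_subtractf sum_distrib_left)
    also have "\<bar>\<dots>\<bar> \<le> (\<Sum>i<N. e * ?h)"
      by (intro order_trans[OF sum_abs] sum_mono cell) auto
    also have "\<dots> = e * (b - a)" using N by (simp add: mesh_def)
    also have "\<dots> = r / 2"
    proof -
      have "r / (2 * L) * L = r / 2" if "0 < L" for L :: real using that by simp
      from this[of "b - a"] show ?thesis using ab by (simp only: e_def diff_gt_0_iff_gt)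
    qed
    finally show "norm (?h * (\<Sum>i<N. \<phi> (?z i)) - integral {a..b} \<phi>) < r" using r by simp
  qed
qed

text \<open>The squared grid norm times b - a is exactly a Riemann sum for the integral of the
  squared norm of \<open>g\<close>.\<close>

lemma L2_norm_le:
  fixes g :: "real \<Rightarrow> complex^2"
  assumes ab: "a < b" and g: "continuous_on {a..b} g"
    and N: "filterlim N at_top sequentially" "\<And>i. 0 < N i"
    and le: "\<And>i. gnorm (N i) (\<lambda>j. g (node a b (N i) j)) \<le> \<beta> i" and \<beta>: "\<beta> \<longlonglongrightarrow> \<beta>'"
  shows "L2_norm a b g \<le> sqrt (b - a) * \<beta>'"
proof -
  let ?\<phi> = "\<lambda>x. (norm (g x))\<^sup>2"
  have c: "continuous_on {a..b} ?\<phi>" using g by (intro continuous_intros)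
  have "(\<lambda>i. mesh a b (N i) * (\<Sum>j<N i. ?\<phi> (node a b (N i) j))) \<longlonglongrightarrow> integral {a..b} ?\<phi>"
    by (rule filterlim_compose[OF riemann_sum[OF ab c] N(1)])
  moreover have "mesh a b (N i) * (\<Sum>j<N i. ?\<phi> (node a b (N i) j)) = (b - a) * (gnorm (N i) (\<lambda>j. g (node a b (N i) j)))\<^sup>2" for i
    using N(2)[of i] by (simp add: gnorm_power2 mesh_def)
  ultimately have lim: "(\<lambda>i. (b - a) * (gnorm (N i) (\<lambda>j. g (node a b (N i) j)))\<^sup>2) \<longlonglongrightarrow> integral {a..b} ?\<phi>"
    by simp
  have "integral {a..b} ?\<phi> \<le> (b - a) * \<beta>'\<^sup>2"
  proof (rule LIMSEQ_le[OF lim])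
    show "(\<lambda>i. (b - a) * (\<beta> i)\<^sup>2) \<longlonglongrightarrow> (b - a) * \<beta>'\<^sup>2" by (intro tendsto_intros \<beta>)
    show "\<exists>K. \<forall>i\<ge>K. (b - a) * (gnorm (N i) (\<lambda>j. g (node a b (N i) j)))\<^sup>2 \<le> (b - a) * (\<beta> i)\<^sup>2"
      using ab le by (intro exI[of _ 0] allI impI mult_left_mono power_mono) auto
  qed
  then have "L2_norm a b g \<le> sqrt ((b - a) * \<beta>'\<^sup>2)"
    unfolding L2_norm_def integral_open_interval_lebesgue[OF c] by (rule real_sqrt_le_mono)
  moreover have "0 \<le> \<beta>'"
    by (rule LIMSEQ_le_const[OF \<beta>]) (use le order_trans[OF gnorm_nonneg] in blast)
  ultimately show ?thesis using ab by (simp add: real_sqrt_mult)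
qed

lemma continuous_interpolant: "continuous_on S (interpolant a b M U)"
  unfolding interpolant_def vector_scalar_mult_def
  by (intro continuous_intros)


locale dirac_problem =
  fixes a b \<epsilon> T :: real and m :: nat and C D :: "nat \<Rightarrow> real"
    and V A1 :: "real \<Rightarrow> real" and \<Phi>0 :: "real \<Rightarrow> complex^2" and \<Phi> :: "real \<Rightarrow> real \<Rightarrow> complex^2"
  assumes ab: "a < b" and eps: "0 < \<epsilon>" "\<epsilon> \<le> 1" and T: "0 < T" and m: "4 \<le> m"
    and sol: "dirac_solution \<epsilon> T a b V A1 \<Phi>0 \<Phi>"
    and W: "\<And>t. t \<in> {0..T} \<Longrightarrow> in_Winf_per m a b (\<Phi> t)"
    and V: "Cm_periodic m a b V" and A1: "Cm_periodic m a b A1"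
    and C: "\<And>k. k \<le> m \<Longrightarrow> Linf_time_norm T a b (\<lambda>t. wderiv a b k (\<Phi> t)) \<le> ereal (C k / \<epsilon> ^ k)"
    and DV: "\<And>k. k \<le> m \<Longrightarrow> Linf_norm a b (cderiv a b k V) \<le> ereal (D k)"
    and DA: "\<And>k. k \<le> m \<Longrightarrow> Linf_norm a b (cderiv a b k A1) \<le> ereal (D k)"
begin

definition c where "c = (\<Sum>k\<le>m. \<bar>C k\<bar>)"
definition d where "d = (\<Sum>k\<le>m. \<bar>D k\<bar>)"
definition X where "X t x = vector_derivative (\<Phi> t) (at x within {a..b})"

lemma c_ge: "k \<le> m \<Longrightarrow> \<bar>C k\<bar> \<le> c"
  unfolding c_def by (rule member_le_sum[of k "{..m}" "\<lambda>k. \<bar>C k\<bar>"]) auto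

lemma d_ge: "k \<le> m \<Longrightarrow> \<bar>D k\<bar> \<le> d"
  unfolding d_def by (rule member_le_sum[of k "{..m}" "\<lambda>k. \<bar>D k\<bar>"]) auto

lemma c_nonneg: "0 \<le> c" and d_nonneg: "0 \<le> d"
  by (simp_all add: c_def d_def sum_nonneg)

lemma Phi_deriv: "t \<in> {0..T} \<Longrightarrow> x \<in> {a..b} \<Longrightarrow> (\<Phi> t has_vector_derivative X t x) (at x within {a..b})"
  using sol unfolding dirac_solution_def X_def differentiable_on_def
  by (simp add: vector_derivative_works[symmetric])

lemma Phi_cont: "t \<in> {0..T} \<Longrightarrow> continuous_on {a..b} (\<Phi> t)"
  using Phi_deriv has_vector_derivative_continuous continuous_on_eq_continuous_within by blast

lemma Phi_ends: "t \<in> {0..T} \<Longrightarrow> \<Phi> t a = \<Phi> t b"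
  using sol by (simp add: dirac_solution_def)

lemma V_ends: "V a = V b" "A1 a = A1 b"
  using V A1 m unfolding Cm_periodic_def by (auto dest!: spec[of _ 0])

lemma pot_fdiff_bounded:
  assumes "Cm_periodic m a b U" "\<And>k. k \<le> m \<Longrightarrow> Linf_norm a b (cderiv a b k U) \<le> ereal (D k)" "0 < s" "s \<le> b - a"
  shows "fdiff_bounded s (s / \<epsilon>) m d (periodic_ext a b U)"
  unfolding fdiff_bounded_def
proof (intro allI impI)
  fix k x assume k: "k \<le> m"
  have "norm ((fdiff s ^^ k) (periodic_ext a b U) x) \<le> D k * s ^ k"
    using m k by (intro Cm_periodic_fdiff[OF ab _ assms]) auto
  also have "\<dots> \<le> d * (s / \<epsilon>) ^ k"
  proof (rule mult_mono)
    show "D k \<le> d" using d_ge[OF k] by simp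
    have "s \<le> s / \<epsilon>" using eps assms(3) by (simp add: le_divide_eq mult_left_le)
    then show "s ^ k \<le> (s / \<epsilon>) ^ k" using assms(3) by (intro power_mono) auto
  qed (use d_nonneg assms(3) in auto)
  finally show "norm ((fdiff s ^^ k) (periodic_ext a b U) x) \<le> d * (s / \<epsilon>) ^ k" .
qed

text \<open>An essential supremum in time gives the bounds at almost every time only; these are the
  times at which all of them hold.\<close>

definition good :: "real \<Rightarrow> bool" where
  "good t \<longleftrightarrow> (\<forall>k\<in>{..m}. Linf_norm a b (wderiv a b k (\<Phi> t)) \<le> ereal (C k / \<epsilon> ^ k))"

lemma AE_good: "AE t in lebesgue_on {0..T}. good t"
  unfolding good_def
proof (intro eventually_ball_finite ballI)
  fix k assume "k \<in> {..m}"
  then have "Linf_time_norm T a b (\<lambda>t. wderiv a b k (\<Phi> t)) \<le> ereal (C k / \<epsilon> ^ k)" using C by simp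
  then show "AE t in lebesgue_on {0..T}. Linf_norm a b (wderiv a b k (\<Phi> t)) \<le> ereal (C k / \<epsilon> ^ k)"
    unfolding Linf_time_norm_def by (rule eventually_mono[OF esssup_AE order_trans, rotated])
qed simp

lemma good_fdiff_bounded:
  assumes "good t" "t \<in> {0..T}" "0 < s" "s \<le> b - a"
  shows "fdiff_bounded s (s / \<epsilon>) m c (periodic_ext a b (\<Phi> t))"
  unfolding fdiff_bounded_def
proof (intro allI impI)
  fix k x assume k: "k \<le> m"
  have "norm ((fdiff s ^^ k) (periodic_ext a b (\<Phi> t)) x) \<le> \<bar>C k / \<epsilon> ^ k\<bar> * s ^ k"
    using assms k by (intro Winf_fdiff[OF ab W Phi_cont Phi_ends]) (auto simp: good_def)
  also have "\<dots> = \<bar>C k\<bar> * (s / \<epsilon>) ^ k" using eps by (simp add: abs_divide power_divide)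
  also have "\<dots> \<le> c * (s / \<epsilon>) ^ k" using c_ge[OF k] assms(3) eps by (intro mult_right_mono) auto
  finally show "norm ((fdiff s ^^ k) (periodic_ext a b (\<Phi> t)) x) \<le> c * (s / \<epsilon>) ^ k" .
qed

lemma fdiff_bounded_lipschitz:
  assumes "f a = f b" "\<And>s. 0 < s \<Longrightarrow> s \<le> b - a \<Longrightarrow> fdiff_bounded s (s / \<epsilon>) m \<beta> (periodic_ext a b f)" "a \<le> x" "x \<le> y" "y \<le> b"
  shows "norm (f y - f x) \<le> \<beta> * ((y - x) / \<epsilon>)"
proof (cases "x = y")
  case False
  then have "fdiff_bounded (y - x) ((y - x) / \<epsilon>) m \<beta> (periodic_ext a b f)" using assms by (intro assms(2)) auto
  then have "norm ((fdiff (y - x) ^^ 1) (periodic_ext a b f) x) \<le> \<beta> * ((y - x) / \<epsilon>) ^ 1"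
    using m unfolding fdiff_bounded_def by (metis le_trans one_le_numeral)
  then show ?thesis using periodic_ext_id[of a b f, OF ab assms(1)] assms by (simp add: fdiff_def)
qed simp

text \<open>Good times are dense, and difference bounds pass to pointwise limits. Continuity in time
  is available for interior x; at the end point, convergence follows from that at a nearby interior
  point together with the Lipschitz bounds in x, which are uniform over good times.\<close>

lemma Phi_fdiff_bounded:
  assumes t: "t \<in> {0..T}" and s: "0 < s" "s \<le> b - a"
  shows "fdiff_bounded s (s / \<epsilon>) m c (periodic_ext a b (\<Phi> t))"
proof -
  have "\<exists>u\<in>{0<..<T}. good u \<and> \<bar>u - t\<bar> < 1 / real (Suc n)" for n
    by (rule AE_dense[OF AE_good _ _ T t]) auto
  then obtain u where u: "\<And>n. u n \<in> {0<..<T}" "\<And>n. good (u n)" "\<And>n. \<bar>u n - t\<bar> < 1 / real (Suc n)" by metis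
  have uT: "u n \<in> {0..T}" for n using u(1)[of n] by auto
  have "(\<lambda>n. u n - t) \<longlonglongrightarrow> 0"
    by (rule Lim_null_comparison[OF _ LIMSEQ_inverse_real_of_nat])
       (use u(3) in \<open>auto intro!: always_eventually less_imp_le simp: inverse_eq_divide\<close>)
  then have ut: "u \<longlonglongrightarrow> t" by (simp add: LIM_zero_iff)
  have int: "(\<lambda>n. \<Phi> (u n) x) \<longlonglongrightarrow> \<Phi> t x" if "x \<in> {a<..<b}" for x
  proof -
    have "continuous_on {0..T} (\<lambda>t. \<Phi> t x)"
      using sol that by (auto simp: dirac_solution_def intro: differentiable_imp_continuous_on)
    then show ?thesis by (rule continuous_on_tendsto_compose[OF _ ut t]) (use uT in auto)
  qed
  have left: "(\<lambda>n. \<Phi> (u n) a) \<longlonglongrightarrow> \<Phi> t a"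
  proof (rule LIMSEQ_I)
    fix r :: real assume r: "0 < r"
    have "continuous (at a within {a..b}) (\<Phi> t)"
      using Phi_cont[OF t] ab by (simp add: continuous_on_eq_continuous_within)
    then obtain e where e: "0 < e" "\<And>x. x \<in> {a..b} \<Longrightarrow> dist x a < e \<Longrightarrow> dist (\<Phi> t x) (\<Phi> t a) < r / 3"
      using r unfolding continuous_within_eps_delta by (metis divide_pos_pos zero_less_numeral)
    \<comment> \<open>The three terms make a + \<delta> close enough to a for the limiting time t,
      keep it inside the interval, and bring the Lipschitz increment c \<delta> / \<epsilon> at good
      times below r / 3.\<close>
    define \<delta> where "\<delta> = min (min (e / 2) ((b - a) / 2)) (r * \<epsilon> / (3 * (c + 1)))"
    have \<delta>: "0 < \<delta>" "\<delta> < e" "\<delta> < b - a" "\<delta> \<le> r * \<epsilon> / (3 * (c + 1))"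
    proof -
      show "0 < \<delta>" using e(1) ab r eps c_nonneg by (simp add: \<delta>_def)
      have "\<delta> \<le> e / 2" "\<delta> \<le> (b - a) / 2" unfolding \<delta>_def by linarith+
      then show "\<delta> < e" "\<delta> < b - a" using e(1) ab by simp_all
      show "\<delta> \<le> r * \<epsilon> / (3 * (c + 1))" unfolding \<delta>_def by linarith
    qed
    obtain N where N: "\<And>n. N \<le> n \<Longrightarrow> norm (\<Phi> (u n) (a + \<delta>) - \<Phi> t (a + \<delta>)) < r / 3"
      using LIMSEQ_D[OF int[of "a + \<delta>"], of "r / 3"] \<delta> r by auto
    have "norm (\<Phi> (u n) a - \<Phi> t a) < r" if "N \<le> n" for n
    proof -
      have "norm (\<Phi> (u n) (a + \<delta>) - \<Phi> (u n) a) \<le> c * ((a + \<delta> - a) / \<epsilon>)"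
        using \<delta> by (intro fdiff_bounded_lipschitz Phi_ends uT good_fdiff_bounded u(2)) auto
      also have "\<dots> \<le> (c + 1) * (r * \<epsilon> / (3 * (c + 1)) / \<epsilon>)"
        using \<delta> c_nonneg eps by (intro mult_mono divide_right_mono) auto
      also have "\<dots> = r / 3"
      proof -
        have "y * (r * \<epsilon> / (3 * y) / \<epsilon>) = r / 3" if "0 < y" for y using that eps by simp
        moreover have "0 < c + 1" using c_nonneg by simp
        ultimately show ?thesis by blast
      qed
      finally have 1: "norm (\<Phi> (u n) (a + \<delta>) - \<Phi> (u n) a) \<le> r / 3" .
      have 2: "norm (\<Phi> t (a + \<delta>) - \<Phi> t a) < r / 3"
        using e(2)[of "a + \<delta>"] \<delta> by (simp add: dist_norm)
      have "norm (x - y) \<le> norm (x' - x) + norm (x' - y') + norm (y' - y)" for x y x' y' :: "complex^2"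
        using norm_triangle_ineq[of "x - x'" "x' - y"] norm_triangle_ineq[of "x' - y'" "y' - y"]
        by (simp add: norm_minus_commute)
      from this[of "\<Phi> (u n) a" "\<Phi> t a" "\<Phi> (u n) (a + \<delta>)" "\<Phi> t (a + \<delta>)"] show ?thesis
        using 1 2 N[OF that] by linarith
    qed
    then show "\<exists>no. \<forall>n\<ge>no. norm (\<Phi> (u n) a - \<Phi> t a) < r" by blast
  qed
  have lim: "(\<lambda>n. periodic_ext a b (\<Phi> (u n)) x) \<longlonglongrightarrow> periodic_ext a b (\<Phi> t) x" for x
  proof -
    obtain n :: int where n: "a + (b - a) * of_int n \<le> x" "x < b + (b - a) * of_int n"
      by (rule cell_exists[OF ab])
    have "(\<lambda>i. \<Phi> (u i) (x - (b - a) * of_int n)) \<longlonglongrightarrow> \<Phi> t (x - (b - a) * of_int n)"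
      using left int[of "x - (b - a) * of_int n"] n by (cases "x = a + (b - a) * of_int n") auto
    moreover have "periodic_ext a b (\<Phi> t') x = \<Phi> t' (x - (b - a) * of_int n)" if "t' \<in> {0..T}" for t'
      using n by (intro periodic_ext_cell ab Phi_ends that) auto
    ultimately show ?thesis by (simp only: uT t)
  qed
  show ?thesis
    unfolding fdiff_bounded_def
  proof (intro allI impI)
    fix k x assume k: "k \<le> m"
    have "(\<lambda>n. norm ((fdiff s ^^ k) (periodic_ext a b (\<Phi> (u n))) x)) \<longlonglongrightarrow> norm ((fdiff s ^^ k) (periodic_ext a b (\<Phi> t)) x)"
      by (intro tendsto_norm fdiff_pow_tendsto lim)
    then show "norm ((fdiff s ^^ k) (periodic_ext a b (\<Phi> t)) x) \<le> c * (s / \<epsilon>) ^ k"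
      by (rule LIMSEQ_le_const2) (use good_fdiff_bounded[OF u(2) uT s] k in \<open>auto simp: fdiff_bounded_def\<close>)
  qed
qed

lemma X_approx:
  assumes t: "t \<in> {0..T}" and x: "a \<le> x" "0 < s" "x + s \<le> b"
  shows "norm (\<Phi> t (x + s) - \<Phi> t x - s *\<^sub>R X t x) \<le> c * (s / \<epsilon>)\<^sup>2"
proof -
  have "norm (\<Phi> t (x + s) - \<Phi> t x - s *\<^sub>R X t x) \<le> (c / \<epsilon>\<^sup>2) * s\<^sup>2"
  proof (rule taylor_second_difference[OF Phi_deriv[OF t] x])
    fix r :: real assume r: "0 < r" "2 * r \<le> s"
    have "norm ((fdiff r ^^ 2) (periodic_ext a b (\<Phi> t)) x) \<le> c * (r / \<epsilon>)\<^sup>2"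
      using Phi_fdiff_bounded[OF t, of r] r x m by (auto simp: fdiff_bounded_def)
    moreover have "(fdiff r ^^ 2) (periodic_ext a b (\<Phi> t)) x = \<Phi> t (x + 2 * r) - \<Phi> t (x + r) - (\<Phi> t (x + r) - \<Phi> t x)"
      using periodic_ext_id[of a b "\<Phi> t", OF ab Phi_ends[OF t]] x r
      by (simp add: numeral_2_eq_2 fdiff_def) (simp add: algebra_simps)
    ultimately show "norm (\<Phi> t (x + 2 * r) - \<Phi> t (x + r) - (\<Phi> t (x + r) - \<Phi> t x)) \<le> (c / \<epsilon>\<^sup>2) * r\<^sup>2"
      by (simp add: power_divide)
  qed (use x c_nonneg in auto)
  then show ?thesis by (simp add: power_divide)
qed

section \<open>The evolution equation solved for the time derivative, including the left end
  point\<close>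

definition R where
  "R t x = pot_gen \<epsilon> (V x) (A1 x) *v \<Phi> t x - (\<i> / of_real \<epsilon>) *s (sigma3 *v \<Phi> t x) - sigma1 *v X t x"

lemma pde_interior:
  assumes t: "t \<in> {0..T}" and x: "x \<in> {a<..<b}"
  shows "((\<lambda>s. \<Phi> s x) has_vector_derivative R t x) (at t within {0..T})"
proof -
  let ?v = "vector_derivative (\<lambda>s. \<Phi> s x) (at t within {0..T})"
  have "(\<lambda>s. \<Phi> s x) differentiable (at t within {0..T})"
    using sol t x by (auto simp: dirac_solution_def differentiable_on_def)
  then have "((\<lambda>s. \<Phi> s x) has_vector_derivative ?v) (at t within {0..T})"
    by (simp only: vector_derivative_works)
  moreover have eq: "(\<i> * of_real \<epsilon>) *s ?v = (- \<i> * of_real \<epsilon>) *s (sigma1 *v X t x)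
      + (sigma3 + V x *\<^sub>R mat 1 - A1 x *\<^sub>R sigma1) *v \<Phi> t x"
    using sol t x unfolding dirac_solution_def X_def by simp
  moreover have "?v = R t x"
  proof -
    have sc: "(r *\<^sub>R B) *v w = r *\<^sub>R (B *v w)" for r and B :: "complex^2^2" and w
      by (simp add: vec2_eq_iff matrix_vector_mult_2 algebra_simps)
    have "?v = (- \<i> / of_real \<epsilon>) *s ((\<i> * of_real \<epsilon>) *s ?v)"
      using eps by (simp add: vec2_eq_iff)
    also have "\<dots> = R t x"
      unfolding eq R_def pot_gen_vec matrix_vector_mult_add_rdistrib matrix_vector_mult_diff_rdistrib sc
      using eps by (simp add: vec2_eq_iff scaleR_conv_of_real[where 'a=complex] field_simps)
    finally show ?thesis .
  qed
  ultimately show ?thesis by simp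
qed

text \<open>A modulus of continuity of the x-derivative at a that is uniform in t. Both derivatives
  are replaced by difference quotients with step s, at a cost of order s / \<epsilon>^2, and these
  quotients differ by Lipschitz increments divided by s. The step is free and will be large compared
  with x - a.\<close>

lemma X_diff:
  assumes t: "t \<in> {0..T}" and x: "a < x" "0 < s" "x + s \<le> b"
  shows "norm (X t x - X t a) \<le> 2 * c * s / \<epsilon>\<^sup>2 + 2 * c * (x - a) / (\<epsilon> * s)"
proof -
  let ?e = "\<lambda>z. \<Phi> t (z + s) - \<Phi> t z - s *\<^sub>R X t z"
  have lip: "norm (\<Phi> t (y + (x - a)) - \<Phi> t y) \<le> c * ((x - a) / \<epsilon>)" if "a \<le> y" "y + (x - a) \<le> b" for y
    using fdiff_bounded_lipschitz[OF Phi_ends[OF t] Phi_fdiff_bounded[OF t], of y "y + (x - a)"] that x by simp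
  have eq: "s *\<^sub>R (X t x - X t a) = (\<Phi> t (a + s + (x - a)) - \<Phi> t (a + s)) - (\<Phi> t (a + (x - a)) - \<Phi> t a) - ?e x + ?e a"
    by (simp add: algebra_simps)
  have "norm (s *\<^sub>R (X t x - X t a)) \<le> norm (\<Phi> t (a + s + (x - a)) - \<Phi> t (a + s))
      + norm (\<Phi> t (a + (x - a)) - \<Phi> t a) + norm (?e x) + norm (?e a)"
    unfolding eq by (intro order_refl add_mono order_trans[OF norm_triangle_ineq] order_trans[OF norm_triangle_ineq4])
  also have "\<dots> \<le> c * ((x - a) / \<epsilon>) + c * ((x - a) / \<epsilon>) + c * (s / \<epsilon>)\<^sup>2 + c * (s / \<epsilon>)\<^sup>2"
    using x by (intro add_mono lip X_approx t) auto
  also have "\<dots> = 2 * c * ((x - a) / \<epsilon>) + 2 * c * (s / \<epsilon>)\<^sup>2" by simp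
  finally have "s * norm (X t x - X t a) \<le> 2 * c * ((x - a) / \<epsilon>) + 2 * c * (s / \<epsilon>)\<^sup>2"
    using x(2) by (simp only: norm_scaleR abs_of_pos)
  then have "norm (X t x - X t a) \<le> (2 * c * ((x - a) / \<epsilon>) + 2 * c * (s / \<epsilon>)\<^sup>2) / s"
    using x by (simp add: pos_le_divide_eq mult.commute)
  also have "\<dots> = 2 * c * s / \<epsilon>\<^sup>2 + 2 * c * (x - a) / (\<epsilon> * s)"
    using x eps by (simp add: field_simps power2_eq_square)
  finally show ?thesis .
qed

lemma norm_Phi: "t \<in> {0..T} \<Longrightarrow> x \<in> {a..b} \<Longrightarrow> norm (\<Phi> t x) \<le> c"
  using fdiff_bounded_0[OF Phi_fdiff_bounded, of t "b - a" x] periodic_ext_id[of a b "\<Phi> t" x, OF ab Phi_ends] ab by simp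

lemma R_diff:
  assumes t: "t \<in> {0..T}" and x: "a < x" "0 < s" "x + s \<le> b"
  shows "norm (R t x - R t a) \<le> (4 * c * d + c) / \<epsilon>\<^sup>2 * (x - a)
    + (2 * c * s / \<epsilon>\<^sup>2 + 2 * c * (x - a) / (\<epsilon> * s))"
proof -
  have ends: "a \<in> {a..b}" "x \<in> {a..b}" using x ab by auto
  have lipP: "norm (\<Phi> t x - \<Phi> t a) \<le> c * ((x - a) / \<epsilon>)"
    using x by (intro fdiff_bounded_lipschitz Phi_ends Phi_fdiff_bounded t) auto
  have prod: "norm (U x *\<^sub>R \<Phi> t x - U a *\<^sub>R \<Phi> t a) \<le> 2 * c * d * ((x - a) / \<epsilon>)"
    if U: "U a = U b" "\<And>s. 0 < s \<Longrightarrow> s \<le> b - a \<Longrightarrow> fdiff_bounded s (s / \<epsilon>) m d (periodic_ext a b U)" for U :: "real \<Rightarrow> real"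
  proof -
    have lipU: "norm (U x - U a) \<le> d * ((x - a) / \<epsilon>)"
      using x by (intro fdiff_bounded_lipschitz U) auto
    have Ua: "norm (U a) \<le> d" using fdiff_bounded_0[OF U(2), of "b - a" a] periodic_ext_id[of a b U a, OF ab U(1)] ab by simp
    have "U x *\<^sub>R \<Phi> t x - U a *\<^sub>R \<Phi> t a = (U x - U a) *\<^sub>R \<Phi> t x + U a *\<^sub>R (\<Phi> t x - \<Phi> t a)"
      by (simp add: algebra_simps)
    then have "norm (U x *\<^sub>R \<Phi> t x - U a *\<^sub>R \<Phi> t a) \<le> norm (U x - U a) * norm (\<Phi> t x) + norm (U a) * norm (\<Phi> t x - \<Phi> t a)"
      using norm_triangle_ineq[of "(U x - U a) *\<^sub>R \<Phi> t x" "U a *\<^sub>R (\<Phi> t x - \<Phi> t a)"] by simp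
    also have "\<dots> \<le> (d * ((x - a) / \<epsilon>)) * c + d * (c * ((x - a) / \<epsilon>))"
      using x eps c_nonneg d_nonneg by (intro add_mono mult_mono lipU lipP Ua norm_Phi t ends) auto
    also have "\<dots> = 2 * c * d * ((x - a) / \<epsilon>)" by simp
    finally show ?thesis .
  qed
  let ?v = "V x *\<^sub>R \<Phi> t x - V a *\<^sub>R \<Phi> t a" and ?w = "A1 x *\<^sub>R \<Phi> t x - A1 a *\<^sub>R \<Phi> t a" and ?p = "\<Phi> t x - \<Phi> t a"
  have eq: "R t x - R t a = (- \<i> / of_real \<epsilon>) *s ?v + (\<i> / of_real \<epsilon>) *s (sigma1 *v ?w)
      - (\<i> / of_real \<epsilon>) *s (sigma3 *v ?p) - sigma1 *v (X t x - X t a)"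
    unfolding R_def pot_gen_vec
    by (simp add: matrix_vector_mult_diff_distrib matrix_vector_scaleR vector_ssub_ldistrib)
  have "norm (R t x - R t a) \<le> norm ((- \<i> / of_real \<epsilon>) *s ?v) + norm ((\<i> / of_real \<epsilon>) *s (sigma1 *v ?w))
      + norm ((\<i> / of_real \<epsilon>) *s (sigma3 *v ?p)) + norm (sigma1 *v (X t x - X t a))"
    unfolding eq by (intro order_refl add_mono order_trans[OF norm_triangle_ineq] order_trans[OF norm_triangle_ineq4])
  also have "\<dots> = (1 / \<epsilon>) * norm ?v + (1 / \<epsilon>) * norm ?w + (1 / \<epsilon>) * norm ?p + norm (X t x - X t a)"
    using eps by (simp only: norm_smult_vec norm_sigma1 norm_sigma3) (simp add: norm_divide)
  also have "\<dots> \<le> (1 / \<epsilon>) * (2 * c * d * ((x - a) / \<epsilon>)) + (1 / \<epsilon>) * (2 * c * d * ((x - a) / \<epsilon>))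
      + (1 / \<epsilon>) * (c * ((x - a) / \<epsilon>)) + (2 * c * s / \<epsilon>\<^sup>2 + 2 * c * (x - a) / (\<epsilon> * s))"
    using eps by (intro add_mono mult_left_mono prod lipP X_diff t x V_ends pot_fdiff_bounded V A1 DV DA) auto
  also have "\<dots> = (4 * c * d + c) / \<epsilon>\<^sup>2 * (x - a) + (2 * c * s / \<epsilon>\<^sup>2 + 2 * c * (x - a) / (\<epsilon> * s))"
    using eps by (simp add: field_simps power2_eq_square)
  finally show ?thesis .
qed

text \<open>The point a is a node, but the equation is given inside the interval. It holds at
  interior points tending to a, and the right-hand sides converge uniformly in time, so the limit is
  differentiable with the limiting derivative.\<close>

lemma pde_left:
  assumes t: "t \<in> {0..T}"
  shows "((\<lambda>s. \<Phi> s a) has_vector_derivative R t a) (at t within {0..T})"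
proof -
  define s where "s n = (b - a) / real (n + 2)" for n
  \<comment> \<open>The distance to a is quadratic in \<open>s n\<close>, so that both
    \<open>s n\<close> and the ratio of that distance to \<open>s n\<close> tend to 0, as the bound
    of \<open>X_diff\<close> requires.\<close>
  define z where "z n = a + (s n)\<^sup>2 / (b - a)" for n
  have s: "0 < s n" "2 * s n \<le> b - a" for n
  proof -
    show "0 < s n" using ab by (simp add: s_def)
    have "2 * (b - a) \<le> real (n + 2) * (b - a)" using ab by (intro mult_right_mono) auto
    then show "2 * s n \<le> b - a" by (simp add: s_def divide_le_eq mult.commute)
  qed
  have zs: "a < z n" "z n - a \<le> s n / 2" for n
  proof -
    show "a < z n" using s[of n] ab by (simp add: z_def)
    have "s n * (2 * s n) \<le> s n * (b - a)" using s[of n] by (intro mult_left_mono) auto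
    then show "z n - a \<le> s n / 2" using ab by (simp add: z_def divide_le_eq power2_eq_square)
  qed
  have z: "z n \<in> {a<..<b}" "z n + s n \<le> b" for n using zs[of n] s[of n] by auto
  have s0: "s \<longlonglongrightarrow> 0"
    unfolding s_def using LIMSEQ_ignore_initial_segment[OF lim_const_over_n[of "b - a"], of 2] by simp
  have za: "z \<longlonglongrightarrow> a"
  proof -
    have "(\<lambda>n. a + (s n)\<^sup>2 / (b - a)) \<longlonglongrightarrow> a + 0\<^sup>2 / (b - a)" using ab by (intro tendsto_intros s0) auto
    then show ?thesis by (simp add: z_def[abs_def])
  qed
  define E where "E n = (4 * c * d + c) / \<epsilon>\<^sup>2 * (z n - a) + (2 * c * s n / \<epsilon>\<^sup>2 + 2 * c * (s n / (b - a)) / \<epsilon>)" for n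
  have RE: "norm (R u (z n) - R u a) \<le> E n" if "u \<in> {0..T}" for u n
  proof -
    have "2 * c * (z n - a) / (\<epsilon> * s n) = 2 * c * (s n / (b - a)) / \<epsilon>"
      using s[of n] by (simp add: z_def power2_eq_square)
    then show ?thesis using R_diff[OF that, of "z n" "s n"] z[of n] s[of n] by (simp add: E_def)
  qed
  have "E \<longlonglongrightarrow> (4 * c * d + c) / \<epsilon>\<^sup>2 * (a - a) + (2 * c * 0 / \<epsilon>\<^sup>2 + 2 * c * (0 / (b - a)) / \<epsilon>)"
    unfolding E_def[abs_def] using ab eps by (intro tendsto_intros za s0) auto
  then have E0: "E \<longlonglongrightarrow> 0" by simp
  have Phi_lim: "(\<lambda>n. \<Phi> u (z n)) \<longlonglongrightarrow> \<Phi> u a" if "u \<in> {0..T}" for u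
    by (rule continuous_on_tendsto_compose[OF Phi_cont[OF that] za])
       (use ab z in \<open>auto intro!: always_eventually less_imp_le\<close>)
  have "\<exists>g. \<forall>u\<in>{0..T}. (\<lambda>n. \<Phi> u (z n)) \<longlonglongrightarrow> g u \<and> (g has_derivative (\<lambda>h. h *\<^sub>R R u a)) (at u within {0..T})"
  proof (rule has_derivative_sequence)
    show "((\<lambda>u. \<Phi> u (z n)) has_derivative (\<lambda>h. h *\<^sub>R R u (z n))) (at u within {0..T})" if "u \<in> {0..T}" for n u
      using pde_interior[OF that z(1)] by (simp add: has_vector_derivative_def)
    show "\<forall>\<^sub>F n in sequentially. \<forall>u\<in>{0..T}. \<forall>h. norm (h *\<^sub>R R u (z n) - h *\<^sub>R R u a) \<le> e * norm h" if "0 < e" for e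
      using order_tendstoD(2)[OF E0 that]
    proof eventually_elim
      case (elim n)
      have "norm (h *\<^sub>R R u (z n) - h *\<^sub>R R u a) \<le> e * norm h" if "u \<in> {0..T}" for u h
      proof -
        have "norm (R u (z n) - R u a) \<le> e" using RE[OF that, of n] elim by linarith
        then have "norm h * norm (R u (z n) - R u a) \<le> norm h * e" by (intro mult_left_mono) auto
        then show ?thesis by (simp add: scaleR_right_diff_distrib[symmetric] mult.commute)
      qed
      then show ?case by blast
    qed
    show "(\<lambda>n. \<Phi> t (z n)) \<longlonglongrightarrow> \<Phi> t a" by (rule Phi_lim[OF t])
  qed (use t in auto)
  then obtain g where g0: "\<forall>u\<in>{0..T}. (\<lambda>n. \<Phi> u (z n)) \<longlonglongrightarrow> g u
      \<and> (g has_derivative (\<lambda>h. h *\<^sub>R R u a)) (at u within {0..T})" by (rule exE)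
  have g: "\<And>u. u \<in> {0..T} \<Longrightarrow> (\<lambda>n. \<Phi> u (z n)) \<longlonglongrightarrow> g u"
    "(g has_vector_derivative R t a) (at t within {0..T})"
    using g0 t by (simp_all add: has_vector_derivative_def)
  have "\<Phi> u a = g u" if "u \<in> {0..T}" for u using LIMSEQ_unique[OF Phi_lim g(1)] that by blast
  then show ?thesis by (rule has_vector_derivative_transform[OF t _ g(2)])
qed

lemma dirac_fdiff: "dirac_fdiff a b \<epsilon> T c d m (periodic_ext a b V) (periodic_ext a b A1) (\<lambda>t. periodic_ext a b (\<Phi> t)) X"
proof
  show "a < b" "0 < \<epsilon>" "3 \<le> m" using ab eps m by auto
  show "fdiff_bounded s (s / \<epsilon>) m d (periodic_ext a b V)" "fdiff_bounded s (s / \<epsilon>) m d (periodic_ext a b A1)" if "0 < s" "s \<le> b - a" for s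
    using that by (auto intro!: pot_fdiff_bounded V A1 DV DA)
  show "fdiff_bounded s (s / \<epsilon>) m c (periodic_ext a b (\<Phi> t))" if "0 \<le> t" "t \<le> T" "0 < s" "s \<le> b - a" for t s
    using that by (intro Phi_fdiff_bounded) auto
  show "norm (periodic_ext a b (\<Phi> t) (x + s) - periodic_ext a b (\<Phi> t) x - s *\<^sub>R X t x) \<le> c * (s / \<epsilon>)\<^sup>2"
    if "0 \<le> t" "t \<le> T" "a \<le> x" "0 < s" "x + s \<le> b" for t x s
    using X_approx[of t x s] periodic_ext_id[of a b "\<Phi> t", OF ab Phi_ends] that by simp
  show "((\<lambda>s. periodic_ext a b (\<Phi> s) x) has_vector_derivative
      (pot_gen \<epsilon> (periodic_ext a b V x) (periodic_ext a b A1 x) *v periodic_ext a b (\<Phi> t) x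
        - (\<i> / of_real \<epsilon>) *s (sigma3 *v periodic_ext a b (\<Phi> t) x) - sigma1 *v X t x)) (at t within {0..T})"
    if "0 \<le> t" "t \<le> T" "a \<le> x" "x < b" for t x
  proof -
    have t: "t \<in> {0..T}" using that by simp
    have "((\<lambda>s. \<Phi> s x) has_vector_derivative R t x) (at t within {0..T})"
      using pde_interior[OF t, of x] pde_left[OF t] that by (cases "x = a") auto
    moreover have "R t x = pot_gen \<epsilon> (periodic_ext a b V x) (periodic_ext a b A1 x) *v periodic_ext a b (\<Phi> t) x
        - (\<i> / of_real \<epsilon>) *s (sigma3 *v periodic_ext a b (\<Phi> t) x) - sigma1 *v X t x"
      using that by (simp add: R_def periodic_ext_id[OF ab] V_ends Phi_ends)
    ultimately have "((\<lambda>s. \<Phi> s x) has_vector_derivative (pot_gen \<epsilon> (periodic_ext a b V x) (periodic_ext a b A1 x) *v periodic_ext a b (\<Phi> t) x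
        - (\<i> / of_real \<epsilon>) *s (sigma3 *v periodic_ext a b (\<Phi> t) x) - sigma1 *v X t x)) (at t within {0..T})" by simp
    then show ?thesis
      by (rule has_vector_derivative_transform[OF t, rotated]) (use that in \<open>simp add: periodic_ext_id[OF ab] Phi_ends\<close>)
  qed
qed (simp_all add: periodic_ext_periodic[OF ab])

text \<open>The fine-grid estimate for fixed M with Q tending to infinity: the grid norms become the
  L2 norm, and the part of the defect that stems from discretizing the x-derivative
  vanishes.\<close>

lemma error_bound:
  assumes M: "0 < M" "even M" and \<tau>: "0 \<le> \<tau>" "real n * \<tau> \<le> T"
  shows "L2_norm a b (\<lambda>x. \<Phi> (real n * \<tau>) x - interpolant a b M (S2 \<epsilon> a b M \<tau> V A1 \<Phi>0 n) x)
    \<le> sqrt (b - a) * (8 * c * (mesh a b M / \<epsilon>) ^ m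
        + real n * \<tau> * (297 * c * (2 + 8 * d) ^ 3 * (\<tau>\<^sup>2 / \<epsilon> ^ 3)
            + 16 * 2 ^ m * (d * c) / \<epsilon> * (mesh a b M / \<epsilon>) ^ m))"
proof -
  let ?t = "real n * \<tau>" and ?S = "S2 \<epsilon> a b M \<tau> V A1 \<Phi>0 n"
  have t: "?t \<in> {0..T}" using \<tau> by simp
  define N where "N Q = (2 * Q + 1) * M" for Q :: nat
  define R where "R Q = (c / \<epsilon>\<^sup>2 + (2 * pi * real M / (b - a))\<^sup>2 * c) * mesh a b (N Q)" for Q
  define \<theta> where "\<theta> = (mesh a b M / \<epsilon>) ^ m"
  define \<beta> where "\<beta> Q = 8 * c * \<theta> + ?t * (297 * c * (2 + 8 * d) ^ 3 * (\<tau>\<^sup>2 / \<epsilon> ^ 3)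
            + (16 * 2 ^ m * (d * c) / \<epsilon> * \<theta> + sqrt (real M) * R Q))" for Q
  have Npos: "0 < N Q" for Q using M by (simp add: N_def)
  have node: "node a b n j \<in> {a..b}" if "j < n" for n j
  proof -
    have "real j * mesh a b n \<le> real n * mesh a b n"
      using that ab by (intro mult_right_mono) (auto simp: mesh_def)
    also have "\<dots> = b - a" using that by (simp add: mesh_def)
    finally show ?thesis using that ab by (simp add: node_def mesh_def)
  qed
  have Ntop: "filterlim N at_top sequentially"
  proof (rule filterlim_at_top_mono[OF filterlim_ident])
    have "Q \<le> N Q" for Q
    proof -
      have "Q * 1 \<le> (2 * Q + 1) * M" using M by (intro mult_mono) auto
      then show ?thesis by (simp add: N_def)
    qed
    then show "\<forall>\<^sub>F Q in sequentially. Q \<le> N Q" by simp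
  qed
  have "(\<lambda>n. mesh a b n) \<longlonglongrightarrow> 0" unfolding mesh_def by (rule lim_const_over_n)
  then have "(\<lambda>Q. mesh a b (N Q)) \<longlonglongrightarrow> 0" by (rule filterlim_compose[OF _ Ntop])
  then have "R \<longlonglongrightarrow> (c / \<epsilon>\<^sup>2 + (2 * pi * real M / (b - a))\<^sup>2 * c) * 0"
    unfolding R_def[abs_def] by (intro tendsto_intros)
  then have "R \<longlonglongrightarrow> 0" by simp
  then have \<beta>: "\<beta> \<longlonglongrightarrow> 8 * c * \<theta> + ?t * (297 * c * (2 + 8 * d) ^ 3 * (\<tau>\<^sup>2 / \<epsilon> ^ 3)
            + (16 * 2 ^ m * (d * c) / \<epsilon> * \<theta> + sqrt (real M) * 0))"
    unfolding \<beta>_def[abs_def] by (intro tendsto_intros)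
  have le: "gnorm (N Q) (\<lambda>j. \<Phi> ?t (node a b (N Q) j) - interpolant a b M ?S (node a b (N Q) j)) \<le> \<beta> Q" for Q
  proof -
    interpret G: dirac_fdiff a b \<epsilon> T c d m "periodic_ext a b V" "periodic_ext a b A1" "\<lambda>t. periodic_ext a b (\<Phi> t)" X
      by (rule dirac_fdiff)
    interpret G: dirac_grid a b \<epsilon> T c d m "periodic_ext a b V" "periodic_ext a b A1" "\<lambda>t. periodic_ext a b (\<Phi> t)" X M Q
      by unfold_locales (use M in auto)
    have N: "G.N = N Q" by (simp add: G.N_def G.K_def N_def)
    have "gnorm G.N (\<lambda>i. periodic_ext a b (\<Phi> ?t) (node a b G.N i) - interpolant a b M ?S (node a b G.N i))
      \<le> 8 * c * G.\<theta> + ?t * (297 * c * (2 + 8 * d) ^ 3 * (\<tau>\<^sup>2 / \<epsilon> ^ 3) + G.defect_bound)"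
    proof (rule G.fine_grid_error)
      fix j assume "j < M"
      note j = node[OF this]
      show "V (node a b M j) = periodic_ext a b V (node a b M j)" "A1 (node a b M j) = periodic_ext a b A1 (node a b M j)"
        "\<Phi>0 (node a b M j) = periodic_ext a b (\<Phi> 0) (node a b M j)"
        using j T sol by (simp_all add: periodic_ext_id[OF ab] V_ends Phi_ends dirac_solution_def)
    qed (use \<tau> in auto)
    moreover have "gnorm G.N (\<lambda>i. periodic_ext a b (\<Phi> ?t) (node a b G.N i) - interpolant a b M ?S (node a b G.N i))
        = gnorm (N Q) (\<lambda>j. \<Phi> ?t (node a b (N Q) j) - interpolant a b M ?S (node a b (N Q) j))"
      unfolding N using node by (intro gnorm_cong) (simp add: periodic_ext_id[OF ab] Phi_ends[OF t])
    ultimately show ?thesis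
      by (simp add: \<beta>_def R_def \<theta>_def G.\<theta>_def G.h_def G.defect_bound_def G.derivative_defect_def G.h'_def N)
  qed
  have "continuous_on {a..b} (\<lambda>x. \<Phi> ?t x - interpolant a b M ?S x)"
    by (intro continuous_on_diff Phi_cont t continuous_interpolant)
  from L2_norm_le[OF ab this Ntop Npos le \<beta>] show ?thesis by (simp add: \<theta>_def)
qed

end

theorem theorem3p2:
  fixes m :: nat and a b T\<^sub>e\<^sub>n\<^sub>d :: real
    and C D :: "nat \<Rightarrow> real" and \<eta> :: "real \<Rightarrow> real"
  assumes "4 \<le> m" and "a < b" and "0 < T\<^sub>e\<^sub>n\<^sub>d"
    and "\<forall>\<epsilon>\<in>{0<..1}. 0 < \<eta> \<epsilon>" and "bounded (\<eta> ` {0<..1})" and "(\<eta> \<longlongrightarrow> 0) (at_right 0)"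
  shows "\<exists>C2>0. \<exists>E>0.
    \<forall>(\<epsilon>::real) (V::real \<Rightarrow> real) (A1::real \<Rightarrow> real) (\<Phi>0::real \<Rightarrow> complex^2)
      (\<Phi>::real \<Rightarrow> real \<Rightarrow> complex^2) (dt\<Phi>::nat \<Rightarrow> real \<Rightarrow> real \<Rightarrow> complex^2)
      (M::nat) (\<tau>::real) (n::nat).
      0 < \<epsilon> \<and> \<epsilon> \<le> 1 \<and>
      dirac_solution \<epsilon> T\<^sub>e\<^sub>n\<^sub>d a b V A1 \<Phi>0 \<Phi> \<and>
      dt\<Phi> 0 = \<Phi> \<and> Cn_into_Winf_per 2 T\<^sub>e\<^sub>n\<^sub>d m a b dt\<Phi> \<and>
      Cm_periodic m a b V \<and> Cm_periodic m a b A1 \<and>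
      (\<forall>r\<le>2. \<forall>k\<le>m.
         Linf_time_norm T\<^sub>e\<^sub>n\<^sub>d a b (\<lambda>t. wderiv a b k (dt\<Phi> r t)) \<le> ereal (C (r + k) / \<epsilon> ^ (r + k))) \<and>
      (\<forall>k\<le>m. Linf_norm a b (cderiv a b k V) \<le> ereal (D k) \<and>
              Linf_norm a b (cderiv a b k A1) \<le> ereal (D k)) \<and>
      0 < M \<and> even M \<and> 0 < \<tau> \<and>
      \<tau> / \<epsilon> \<le> \<eta> \<epsilon> \<and> mesh a b M / \<epsilon> \<le> \<eta> \<epsilon> \<and>
      real n \<le> T\<^sub>e\<^sub>n\<^sub>d / \<tau>
      \<longrightarrow>
      L2_norm a b (\<lambda>x. \<Phi> (real n * \<tau>) x - interpolant a b M (S2 \<epsilon> a b M \<tau> V A1 \<Phi>0 n) x)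
        \<le> C2 * T\<^sub>e\<^sub>n\<^sub>d * (\<tau>\<^sup>2 / \<epsilon> ^ 3) + E * (T\<^sub>e\<^sub>n\<^sub>d / \<tau>) * (mesh a b M / (\<epsilon> * (b - a))) ^ m"
proof -
  let ?T = "T\<^sub>e\<^sub>n\<^sub>d" and ?L = "b - a"
  define c where c_eq: "c = (\<Sum>k\<le>m. \<bar>C k\<bar>)"
  define d where d_eq: "d = (\<Sum>k\<le>m. \<bar>D k\<bar>)"
  have cd: "0 \<le> c" "0 \<le> d" by (simp_all add: c_eq d_eq sum_nonneg)
  obtain B where B: "0 < B" "\<And>\<epsilon>. \<epsilon> \<in> {0<..1} \<Longrightarrow> \<eta> \<epsilon> \<le> B"
  proof -
    obtain B where "\<forall>y\<in>\<eta> ` {0<..1}. norm y \<le> B" using assms(5) unfolding bounded_iff by blast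
    then have "\<eta> \<epsilon> \<le> max B 1" if "\<epsilon> \<in> {0<..1}" for \<epsilon> using that by (auto simp: abs_le_iff max.coboundedI1)
    then show ?thesis using that[of "max B 1"] by simp
  qed
  \<comment> \<open>The summand 1, here and in \<open>E\<close>, keeps the constant positive even
    when c is 0.\<close>
  define C2 where "C2 = sqrt ?L * (297 * c * (2 + 8 * d) ^ 3) + 1"
  \<comment> \<open>The factor (b - a)^m rescales h / \<epsilon> to h / (\<epsilon> (b - a)). The
    term with B / T absorbs the initial error, since \<tau> <= B gives 1 <= (B / T) (T / \<tau>);
    the other term comes from T / \<epsilon> = (\<tau> / \<epsilon>) (T / \<tau>) <= B T /
    \<tau>.\<close>
  define E where "E = sqrt ?L * ?L ^ m * (8 * c * (B / ?T) + 16 * 2 ^ m * (d * c) * B) + 1"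
  have pos: "0 < C2" "0 < E"
    using cd B(1) assms(2,3) by (auto simp: C2_def E_def intro!: add_nonneg_pos mult_nonneg_nonneg)
  have main: "L2_norm a b (\<lambda>x. \<Phi> (real n * \<tau>) x - interpolant a b M (S2 \<epsilon> a b M \<tau> V A1 \<Phi>0 n) x)
      \<le> C2 * ?T * (\<tau>\<^sup>2 / \<epsilon> ^ 3) + E * (?T / \<tau>) * (mesh a b M / (\<epsilon> * ?L)) ^ m"
    if eps: "0 < \<epsilon>" "\<epsilon> \<le> 1" and sol: "dirac_solution \<epsilon> ?T a b V A1 \<Phi>0 \<Phi>"
      and dt: "dt\<Phi> 0 = \<Phi>" "Cn_into_Winf_per 2 ?T m a b dt\<Phi>"
      and V: "Cm_periodic m a b V" "Cm_periodic m a b A1"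
      and C: "\<forall>r\<le>2. \<forall>k\<le>m. Linf_time_norm ?T a b (\<lambda>t. wderiv a b k (dt\<Phi> r t)) \<le> ereal (C (r + k) / \<epsilon> ^ (r + k))"
      and D: "\<forall>k\<le>m. Linf_norm a b (cderiv a b k V) \<le> ereal (D k) \<and> Linf_norm a b (cderiv a b k A1) \<le> ereal (D k)"
      and M: "0 < M" "even M" and \<tau>: "0 < \<tau>" "\<tau> / \<epsilon> \<le> \<eta> \<epsilon>" and n: "real n \<le> ?T / \<tau>"
    for \<epsilon> V A1 \<Phi>0 \<Phi> dt\<Phi> M \<tau> n
  proof -
    interpret dirac_problem a b \<epsilon> ?T m C D V A1 \<Phi>0 \<Phi>
    proof
      show "in_Winf_per m a b (\<Phi> t)" if "t \<in> {0..?T}" for t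
        using dt that by (auto simp: Cn_into_Winf_per_def)
      show "Linf_time_norm ?T a b (\<lambda>t. wderiv a b k (\<Phi> t)) \<le> ereal (C k / \<epsilon> ^ k)" if "k \<le> m" for k
        using C[rule_format, of 0 k] that dt by simp
    qed (use assms eps sol V D in auto)
    let ?\<theta> = "(mesh a b M / \<epsilon>) ^ m"
    have nT: "real n * \<tau> \<le> ?T" using n \<tau>(1) by (simp add: le_divide_eq)
    have \<theta>: "0 \<le> ?\<theta>" using assms(2) eps M by (simp add: mesh_def)
    have \<tau>B: "\<tau> / \<epsilon> \<le> B" using \<tau>(2) B(2)[of \<epsilon>] eps by simp
    then have "\<tau> \<le> B * \<epsilon>" using eps by (simp add: divide_le_eq)
    also have "B * \<epsilon> \<le> B * 1" using B(1) eps by (intro mult_left_mono) auto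
    finally have \<tau>B': "\<tau> \<le> B" by simp
    let ?k = "297 * c * (2 + 8 * d) ^ 3 * (\<tau>\<^sup>2 / \<epsilon> ^ 3)" and ?j = "16 * 2 ^ m * (d * c)"
    have k: "0 \<le> ?k" "0 \<le> ?j" using cd eps by auto
    have "L2_norm a b (\<lambda>x. \<Phi> (real n * \<tau>) x - interpolant a b M (S2 \<epsilon> a b M \<tau> V A1 \<Phi>0 n) x)
        \<le> sqrt ?L * (8 * c * ?\<theta> + real n * \<tau> * (?k + ?j / \<epsilon> * ?\<theta>))"
      using error_bound[OF M less_imp_le[OF \<tau>(1)] nT] unfolding c_def d_def c_eq[symmetric] d_eq[symmetric] .
    also have "\<dots> \<le> sqrt ?L * ((8 * c * (B / ?T)) * (?T / \<tau>) * ?\<theta> + (?T * ?k + (?j * B) * (?T / \<tau>) * ?\<theta>))"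
    proof (intro mult_left_mono add_mono)
      have "1 \<le> (B / ?T) * (?T / \<tau>)" using \<tau>B' \<tau>(1) assms(3) by (simp add: le_divide_eq)
      then have "8 * c * ?\<theta> * 1 \<le> 8 * c * ?\<theta> * ((B / ?T) * (?T / \<tau>))" using cd \<theta> by (intro mult_left_mono) auto
      then show "8 * c * ?\<theta> \<le> (8 * c * (B / ?T)) * (?T / \<tau>) * ?\<theta>" by (simp only: mult_ac mult_1_right mult_1_left)
      have "real n * \<tau> * (?k + ?j / \<epsilon> * ?\<theta>) \<le> ?T * (?k + ?j / \<epsilon> * ?\<theta>)"
        using nT k \<theta> eps cd by (intro mult_right_mono add_nonneg_nonneg mult_nonneg_nonneg divide_nonneg_pos) auto
      also have "?T * (?j / \<epsilon> * ?\<theta>) = (?j * (\<tau> / \<epsilon>)) * (?T / \<tau>) * ?\<theta>" using \<tau>(1) by simp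
      then have "?T * (?k + ?j / \<epsilon> * ?\<theta>) = ?T * ?k + (?j * (\<tau> / \<epsilon>)) * (?T / \<tau>) * ?\<theta>"
        by (simp only: distrib_left)
      also have "\<dots> \<le> ?T * ?k + (?j * B) * (?T / \<tau>) * ?\<theta>"
        using k \<theta> \<tau>(1) assms(3) by (intro add_left_mono mult_right_mono mult_left_mono \<tau>B) auto
      finally show "real n * \<tau> * (?k + ?j / \<epsilon> * ?\<theta>) \<le> ?T * ?k + (?j * B) * (?T / \<tau>) * ?\<theta>" .
    qed (use assms(2) in auto)
    also have "\<dots> = (C2 - 1) * ?T * (\<tau>\<^sup>2 / \<epsilon> ^ 3) + (E - 1) * (?T / \<tau>) * (mesh a b M / (\<epsilon> * ?L)) ^ m"
    proof -
      have "(mesh a b M / (\<epsilon> * ?L)) ^ m * ?L ^ m = ?\<theta>"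
        using assms(2) by (simp add: power_mult_distrib[symmetric])
      then show ?thesis unfolding C2_def E_def by (simp add: algebra_simps)
    qed
    also have "\<dots> \<le> C2 * ?T * (\<tau>\<^sup>2 / \<epsilon> ^ 3) + E * (?T / \<tau>) * (mesh a b M / (\<epsilon> * ?L)) ^ m"
      using assms(2,3) eps M \<tau>(1) by (intro add_mono mult_right_mono) (auto simp: mesh_def)
    finally show ?thesis .
  qed
  show ?thesis
    by (rule exI[of _ C2], rule conjI[OF pos(1)], rule exI[of _ E], rule conjI[OF pos(2)],
        intro allI impI, elim conjE, rule main; assumption)
qed

end
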